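(* Let $f:\mathcal U\times\mathcal V\to\mathcal Z$ be a function between finite sets, and let $\pi$ be a two-party quantum protocol for the evaluation of $f$ that is perfectly correct ($0$-correct) and perfectly secure ($0$-secure) against dishonest Bob. Then, if (honest) Bob has input $v$, Alice can compute $f(u,v)$ for all $u$. That is, there is a cheating strategy for Alice such that, for every $v\in\mathcal V$, when it is run against honest Bob with input $v$, with probability $1$ Alice obtains classical data from which she can compute $f(u,v)$ for all $u\in\mathcal U$ simultaneously (her data determines a function $h:\mathcal U\to\mathcal Z$ with $h(u)=f(u,v)$ for every $u\in\mathcal U$).
   Context: All registers are finite-dimensional Hilbert spaces. CPTP means completely positive trace-preserving. **Protocols.** A two-party quantum protocol $\pi$ for $f$ is specified by the local quantum operations of honest Alice $\mathsf A$ and honest Bob $\mathsf B$, who are connected only by a quantum channel: over finitely many rounds they apply local CPTP maps to registers they hold and exchange message registers. Alice receives input register $U$ (basis $\{|u\rangle\}_{u\in\mathcal U}$), Bob receives input register $V$ (basis $\{|v\rangle\}_{v\in\mathcal V}$). At the end honest Alice outputs register $X$ and honest Bob outputs register $Y$ (both with basis indexed by $\mathcal Z$). A dishonest player may replace his or her local operations by arbitrary CPTP maps with an arbitrary final output register, while the other player stays honest. The execution is a CPTP map: $\pi_{\mathsf A,\mathsf B}:UV\to XY$ if both are honest, $\pi_{\mathsf A,\mathsf B'}:UV\to XY'$ for honest Alice and dishonest Bob $\mathsf B'$ with output register $Y'$. **Ideal functionality.** $\mathcal F:\tilde U\tilde V\to\tilde X\tilde Y$ is the CPTP map $$\mathcal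 F(|u\rangle\langle u'|_{\tilde U}\otimes|v\rangle\langle v'|_{\tilde V})=\delta_{u,u'}\delta_{v,v'}\,|f(u,v)\rangle\langle f(u,v)|_{\tilde X}\otimes|f(u,v)\rangle\langle f(u,v)|_{\tilde Y}.$$ Ideal honest players just forward inputs and outputs to and from $\mathcal F$; with both honest, the joint map $\mathcal F_{\hat{\mathsf A},\hat{\mathsf B}}$ is $\mathcal F$ with $\tilde U,\tilde V,\tilde X,\tilde Y$ identified with $U,V,X,Y$. An ideal adversary $\hat{\mathsf B}'$ is given by CPTP maps $\Lambda^1_{V\to\tilde VK}$ and $\Lambda^2_{K\tilde Y\to Y'}$ ($K$ an auxiliary register), and $$\mathcal F_{\hat{\mathsf A},\hat{\mathsf B}'}=[\mathrm{id}_{\tilde X\to X}\otimes\Lambda^2_{K\tilde Y\to Y'}]\circ[\mathcal F_{\tilde U\tilde V\to\tilde X\tilde Y}\otimes\mathrm{id}_K]\circ[\mathrm{id}_{U\to\tilde U}\otimes\Lambda^1_{V\to\tilde VK}].$$ **Closeness.** For states $\rho,\sigma$, write $\rho\approx_\varepsilon\sigma$ if $\sqrt{1-F(\rho,\sigma)^2}\le\varepsilon$, where $F(\rho,\sigma)=\mathrm{tr}\sqrt{\sqrt\rho\,\sigma\sqrt\rho}$. **Correctness and security.** For a probability distribution $p$ on $\mathcal U\times\mathcal V$, let $\rho_{UVR}$ be a purification, with reference register $R$, of $\sum_{u,v}p(u,v)|u\rangle\langle u|_U\otimes|v\rangle\langle v|_V$, for instance the pure state $\sum_{u,v}\sqrt{p(u,v)}\,|u\rangle_U|v\rangle_V|uv\rangle_R$.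 Let $\varepsilon\ge0$. The protocol $\pi$ is *$\varepsilon$-correct* if for every $p$, $$[\mathrm{id}_R\otimes\pi_{\mathsf A,\mathsf B}](\rho_{UVR})\approx_\varepsilon[\mathrm{id}_R\otimes\mathcal F_{\hat{\mathsf A},\hat{\mathsf B}}](\rho_{UVR}).$$ It is *$\varepsilon$-secure against dishonest Bob* if for every $p$ and every real adversary (dishonest Bob) $\mathsf B'$ there exists an ideal adversary $\hat{\mathsf B}'$ (which may depend on $p$) such that $$[\mathrm{id}_R\otimes\pi_{\mathsf A,\mathsf B'}](\rho_{UVR})\approx_\varepsilon[\mathrm{id}_R\otimes\mathcal F_{\hat{\mathsf A},\hat{\mathsf B}'}](\rho_{UVR}).$$ **Cheating strategy for Alice.** A choice of dishonest behaviour for Alice in the protocol $\pi$, run against honest Bob, ending with a measurement that gives Alice a classical outcome. The strategy does not depend on Bob's input $v$, and Bob's input register is prepared in the state $|v\rangle$. *)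

theory Defs
  imports
    "Jordan_Normal_Form.Schur_Decomposition"
    "HOL-Library.Countable_Set"
    "HOL-Library.Complex_Order"
begin

text \<open>
  A register is given by its dimension \<open>d\<close>, with basis \<open>0, ..., d - 1\<close>. The composite of registers
  of dimensions \<open>a\<close> and \<open>b\<close> has dimension \<open>a * b\<close>, and its basis vector \<open>(i, j)\<close> has index
  \<open>i * b + j\<close>; with this encoding composition of registers is strictly associative and the register
  of dimension 1 is a strict unit.
\<close>

definition kron :: "complex mat \<Rightarrow> complex mat \<Rightarrow> complex mat" where
  "kron A B = mat (dim_row A * dim_row B) (dim_col A * dim_col B)
     (\<lambda>(i, j). A $$ (i div dim_row B, j div dim_col B) * B $$ (i mod dim_row B, j mod dim_col B))"

definition msum :: "nat \<Rightarrow> 'i set \<Rightarrow> ('i \<Rightarrow> complex mat) \<Rightarrow> complex mat" where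
  "msum d I F = mat d d (\<lambda>ij. \<Sum>k\<in>I. F k $$ ij)"

definition tr :: "complex mat \<Rightarrow> complex" where
  "tr A = (\<Sum>i<dim_row A. A $$ (i, i))"

definition ketbra :: "nat \<Rightarrow> nat \<Rightarrow> nat \<Rightarrow> complex mat" where
  "ketbra d i j = mat d d (\<lambda>(r, c). if r = i \<and> c = j then 1 else 0)"

definition psd :: "nat \<Rightarrow> complex mat \<Rightarrow> bool" where
  "psd d A \<longleftrightarrow> A \<in> carrier_mat d d \<and> mat_adjoint A = A \<and>
     (\<forall>x \<in> carrier_vec d. 0 \<le> (A *\<^sub>v x) \<bullet>c x)"

text \<open>A positive semidefinite matrix has exactly one positive semidefinite square root.\<close>

definition msqrt :: "complex mat \<Rightarrow> complex mat" where
  "msqrt A = (SOME B. psd (dim_row A) B \<and> B * B = A)"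

definition fidelity :: "complex mat \<Rightarrow> complex mat \<Rightarrow> real" where
  "fidelity \<rho> \<sigma> = Re (tr (msqrt (msqrt \<rho> * \<sigma> * msqrt \<rho>)))"

definition close :: "real \<Rightarrow> complex mat \<Rightarrow> complex mat \<Rightarrow> bool" where
  "close \<epsilon> \<rho> \<sigma> \<longleftrightarrow> sqrt (1 - (fidelity \<rho> \<sigma>)\<^sup>2) \<le> \<epsilon>"

text \<open>
  A map from operators on a register of dimension \<open>src\<close> to operators on a register of dimension
  \<open>trg\<close>. Only the values of \<open>app\<close> on \<open>src \<times> src\<close> matrices are meaningful.
\<close>

record qmap =
  src :: nat
  trg :: nat
  app :: "complex mat \<Rightarrow> complex mat"

definition id_map :: "nat \<Rightarrow> qmap" where
  "id_map d = \<lparr>src = d, trg = d, app = (\<lambda>\<rho>. \<rho>)\<rparr>"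

definition comp_map :: "qmap \<Rightarrow> qmap \<Rightarrow> qmap" where
  "comp_map G E = \<lparr>src = src E, trg = trg G, app = (\<lambda>\<rho>. app G (app E \<rho>))\<rparr>"

text \<open>The linear extension of \<open>|i\<rangle>\<langle>j| \<otimes> |k\<rangle>\<langle>l| \<mapsto> E(|i\<rangle>\<langle>j|) \<otimes> F(|k\<rangle>\<langle>l|)\<close>.\<close>

definition tensor :: "qmap \<Rightarrow> qmap \<Rightarrow> qmap" where
  "tensor E F = \<lparr>src = src E * src F, trg = trg E * trg F,
     app = (\<lambda>\<rho>. msum (trg E * trg F)
       (({..<src E} \<times> {..<src E}) \<times> ({..<src F} \<times> {..<src F}))
       (\<lambda>((i, j), (k, l)). \<rho> $$ (i * src F + k, j * src F + l) \<cdot>\<^sub>m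
          kron (app E (ketbra (src E) i j)) (app F (ketbra (src F) k l))))\<rparr>"

text \<open>The exchange \<open>|i\<rangle>|j\<rangle> \<mapsto> |j\<rangle>|i\<rangle>\<close> of adjacent registers of dimensions \<open>m\<close> and \<open>n\<close>.\<close>

definition swap_map :: "nat \<Rightarrow> nat \<Rightarrow> qmap" where
  "swap_map m n = \<lparr>src = m * n, trg = n * m,
     app = (\<lambda>\<rho>. mat (n * m) (n * m)
       (\<lambda>(r, c). \<rho> $$ ((r mod m) * n + r div m, (c mod m) * n + c div m)))\<rparr>"

definition linear_qmap :: "qmap \<Rightarrow> bool" where
  "linear_qmap E \<longleftrightarrow>
     (\<forall>\<rho> \<in> carrier_mat (src E) (src E). app E \<rho> \<in> carrier_mat (trg E) (trg E)) \<and>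
     (\<forall>\<rho> \<in> carrier_mat (src E) (src E). \<forall>\<sigma> \<in> carrier_mat (src E) (src E).
        app E (\<rho> + \<sigma>) = app E \<rho> + app E \<sigma>) \<and>
     (\<forall>c. \<forall>\<rho> \<in> carrier_mat (src E) (src E). app E (c \<cdot>\<^sub>m \<rho>) = c \<cdot>\<^sub>m app E \<rho>)"

definition completely_positive :: "qmap \<Rightarrow> bool" where
  "completely_positive E \<longleftrightarrow>
     (\<forall>k \<rho>. psd (k * src E) \<rho> \<longrightarrow> psd (k * trg E) (app (tensor (id_map k) E) \<rho>))"

definition trace_preserving :: "qmap \<Rightarrow> bool" where
  "trace_preserving E \<longleftrightarrow> (\<forall>\<rho> \<in> carrier_mat (src E) (src E). tr (app E \<rho>) = tr \<rho>)"

definition cptp :: "qmap \<Rightarrow> bool" where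
  "cptp E \<longleftrightarrow> linear_qmap E \<and> completely_positive E \<and> trace_preserving E"

text \<open>
  \<open>mem P i\<close> is the dimension of the private register of a player before round \<open>i\<close> (for \<open>i\<close> equal to
  the number of rounds: of the output register), \<open>act P i\<close> is the player's operation in round \<open>i\<close>.
\<close>

record player =
  mem :: "nat \<Rightarrow> nat"
  act :: "nat \<Rightarrow> qmap"

text \<open>
  \<open>to_alice i\<close> and \<open>to_bob i\<close> are the dimensions of the messages that the players receive before round
  \<open>i\<close>. In every round both players act on their private register and the message they hold, and then
  the two new messages are exchanged. A trivial message has dimension 1; in particular the players
  may take turns.
\<close>

record protocol =
  rounds :: nat
  to_alice :: "nat \<Rightarrow> nat"
  to_bob :: "nat \<Rightarrow> nat"
  alice :: player
  bob :: player

definition alice_strategy :: "protocol \<Rightarrow> nat \<Rightarrow> player \<Rightarrow> bool" where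
  "alice_strategy \<pi> d A \<longleftrightarrow> mem A 0 = d \<and>
     (\<forall>i < rounds \<pi>. cptp (act A i) \<and>
        src (act A i) = mem A i * to_alice \<pi> i \<and>
        trg (act A i) = mem A (Suc i) * to_bob \<pi> (Suc i))"

definition bob_strategy :: "protocol \<Rightarrow> nat \<Rightarrow> player \<Rightarrow> bool" where
  "bob_strategy \<pi> d B \<longleftrightarrow> mem B 0 = d \<and>
     (\<forall>i < rounds \<pi>. cptp (act B i) \<and>
        src (act B i) = to_bob \<pi> i * mem B i \<and>
        trg (act B i) = to_alice \<pi> (Suc i) * mem B (Suc i))"

text \<open>
  The registers are ordered as follows: Alice's private register, message for Alice, message for Bob,
  Bob's private register. The local operations leave the message written by Alice (for Bob) to the
  left of the message written by Bob (for Alice), hence the swap.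
\<close>

primrec exec_upto :: "protocol \<Rightarrow> player \<Rightarrow> player \<Rightarrow> nat \<Rightarrow> qmap" where
  "exec_upto \<pi> A B 0 = id_map (mem A 0 * mem B 0)"
| "exec_upto \<pi> A B (Suc i) =
     comp_map (tensor (id_map (mem A (Suc i)))
             (tensor (swap_map (to_bob \<pi> (Suc i)) (to_alice \<pi> (Suc i))) (id_map (mem B (Suc i)))))
       (comp_map (tensor (act A i) (act B i)) (exec_upto \<pi> A B i))"

definition execution :: "protocol \<Rightarrow> player \<Rightarrow> player \<Rightarrow> qmap" where
  "execution \<pi> A B = exec_upto \<pi> A B (rounds \<pi>)"

definition two_party_protocol :: "protocol \<Rightarrow> 'u set \<Rightarrow> 'v set \<Rightarrow> 'z set \<Rightarrow> bool" where
  "two_party_protocol \<pi> U V Z \<longleftrightarrow>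
     (\<forall>i \<le> rounds \<pi>. 0 < to_alice \<pi> i \<and> 0 < to_bob \<pi> i) \<and>
     to_alice \<pi> 0 = 1 \<and> to_bob \<pi> 0 = 1 \<and>
     to_alice \<pi> (rounds \<pi>) = 1 \<and> to_bob \<pi> (rounds \<pi>) = 1 \<and>
     alice_strategy \<pi> (card U) (alice \<pi>) \<and> mem (alice \<pi>) (rounds \<pi>) = card Z \<and>
     bob_strategy \<pi> (card V) (bob \<pi>) \<and> mem (bob \<pi>) (rounds \<pi>) = card Z"

text \<open>A register with basis indexed by a finite set \<open>S\<close> is encoded through \<^const>\<open>to_nat_on\<close> \<open>S\<close>.\<close>

definition basis_state :: "'a set \<Rightarrow> 'a \<Rightarrow> complex mat" where
  "basis_state S a = ketbra (card S) (to_nat_on S a) (to_nat_on S a)"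

definition pair_index :: "'u set \<Rightarrow> 'v set \<Rightarrow> 'u \<times> 'v \<Rightarrow> nat" where
  "pair_index U V = (\<lambda>(u, v). to_nat_on U u * card V + to_nat_on V v)"

definition ideal_functionality ::
  "('u \<Rightarrow> 'v \<Rightarrow> 'z) \<Rightarrow> 'u set \<Rightarrow> 'v set \<Rightarrow> 'z set \<Rightarrow> qmap" where
  "ideal_functionality f U V Z = \<lparr>src = card U * card V, trg = card Z * card Z,
     app = (\<lambda>\<rho>. msum (card Z * card Z) (U \<times> V)
       (\<lambda>(u, v). \<rho> $$ (pair_index U V (u, v), pair_index U V (u, v)) \<cdot>\<^sub>m
          kron (basis_state Z (f u v)) (basis_state Z (f u v))))\<rparr>"

definition ideal_with_bob ::
  "('u \<Rightarrow> 'v \<Rightarrow> 'z) \<Rightarrow> 'u set \<Rightarrow> 'v set \<Rightarrow> 'z set \<Rightarrow> nat \<Rightarrow> qmap \<Rightarrow> qmap \<Rightarrow> qmap" where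
  "ideal_with_bob f U V Z k \<Lambda>1 \<Lambda>2 =
     comp_map (tensor (id_map (card Z)) \<Lambda>2)
       (comp_map (tensor (ideal_functionality f U V Z) (id_map k))
         (tensor (id_map (card U)) \<Lambda>1))"

definition ideal_bob :: "'v set \<Rightarrow> 'z set \<Rightarrow> nat \<Rightarrow> nat \<Rightarrow> qmap \<Rightarrow> qmap \<Rightarrow> bool" where
  "ideal_bob V Z d k \<Lambda>1 \<Lambda>2 \<longleftrightarrow>
     cptp \<Lambda>1 \<and> src \<Lambda>1 = card V \<and> trg \<Lambda>1 = card V * k \<and>
     cptp \<Lambda>2 \<and> src \<Lambda>2 = card Z * k \<and> trg \<Lambda>2 = d"

definition prob_dist :: "'a set \<Rightarrow> ('a \<Rightarrow> real) \<Rightarrow> bool" where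
  "prob_dist S p \<longleftrightarrow> (\<forall>x \<in> S. 0 \<le> p x) \<and> (\<Sum>x\<in>S. p x) = 1"

text \<open>
  The pure state \<open>\<Sum> sqrt (p (u, v)) |uv\<rangle>|u\<rangle>|v\<rangle>\<close>, with the reference register \<open>R\<close>, of dimension
  \<open>card U * card V\<close>, on the left: the two sums over \<open>U \<times> V\<close> are those of the ket and of the bra.
\<close>

definition purified_input :: "'u set \<Rightarrow> 'v set \<Rightarrow> ('u \<times> 'v \<Rightarrow> real) \<Rightarrow> complex mat" where
  "purified_input U V p =
     (let d = card U * card V in
      msum (d * d) ((U \<times> V) \<times> (U \<times> V))
        (\<lambda>(x, y). complex_of_real (sqrt (p x) * sqrt (p y)) \<cdot>\<^sub>m
           kron (ketbra d (pair_index U V x) (pair_index U V y))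
                (ketbra d (pair_index U V x) (pair_index U V y))))"

definition on_input ::
  "qmap \<Rightarrow> 'u set \<Rightarrow> 'v set \<Rightarrow> ('u \<times> 'v \<Rightarrow> real) \<Rightarrow> complex mat" where
  "on_input E U V p = app (tensor (id_map (card U * card V)) E) (purified_input U V p)"

definition correct ::
  "real \<Rightarrow> protocol \<Rightarrow> ('u \<Rightarrow> 'v \<Rightarrow> 'z) \<Rightarrow> 'u set \<Rightarrow> 'v set \<Rightarrow> 'z set \<Rightarrow> bool" where
  "correct \<epsilon> \<pi> f U V Z \<longleftrightarrow>
     (\<forall>p. prob_dist (U \<times> V) p \<longrightarrow>
        close \<epsilon> (on_input (execution \<pi> (alice \<pi>) (bob \<pi>)) U V p)
                (on_input (ideal_functionality f U V Z) U V p))"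

definition secure_against_bob ::
  "real \<Rightarrow> protocol \<Rightarrow> ('u \<Rightarrow> 'v \<Rightarrow> 'z) \<Rightarrow> 'u set \<Rightarrow> 'v set \<Rightarrow> 'z set \<Rightarrow> bool" where
  "secure_against_bob \<epsilon> \<pi> f U V Z \<longleftrightarrow>
     (\<forall>p B. prob_dist (U \<times> V) p \<and> bob_strategy \<pi> (card V) B \<longrightarrow>
        (\<exists>k \<Lambda>1 \<Lambda>2. ideal_bob V Z (mem B (rounds \<pi>)) k \<Lambda>1 \<Lambda>2 \<and>
           close \<epsilon> (on_input (execution \<pi> (alice \<pi>) B) U V p)
                   (on_input (ideal_with_bob f U V Z k \<Lambda>1 \<Lambda>2) U V p)))"

definition povm :: "nat \<Rightarrow> nat \<Rightarrow> (nat \<Rightarrow> complex mat) \<Rightarrow> bool" where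
  "povm d m M \<longleftrightarrow> (\<forall>w < m. psd d (M w)) \<and> msum d {..<m} M = 1\<^sub>m d"

text \<open>
  The probability that dishonest Alice \<open>A\<close>, who receives no input (her initial register has dimension
  1), obtains outcome \<open>w\<close> when she measures \<open>M\<close> on her final register after an execution with honest
  Bob on input \<open>|v\<rangle>\<close>; the identity acts on Bob's output register.
\<close>

definition outcome_prob ::
  "protocol \<Rightarrow> player \<Rightarrow> (nat \<Rightarrow> complex mat) \<Rightarrow> 'v set \<Rightarrow> 'v \<Rightarrow> nat \<Rightarrow> real" where
  "outcome_prob \<pi> A M V v w =
     Re (tr (kron (M w) (1\<^sub>m (mem (bob \<pi>) (rounds \<pi>))) *
             app (execution \<pi> A (bob \<pi>)) (kron (1\<^sub>m 1) (basis_state V v))))"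

end

theory Submission
  imports Defs
begin

text \<open>
  Let Bob cheat by running the purified honest strategy. On the uniform purified input, closeness of the
  outputs is equality of Choi states, so security gives an ideal adversary whose channel equals that of the
  execution. Both sides come with Kraus operators: \<open>G\<^sub>a\<close>, where \<open>a\<close> is the sequence of Kraus indices of
  honest Alice (the content of her environment register), and \<open>C\<^sub>c\<close>, where \<open>c\<close> contains the input \<open>w\<close> that
  the ideal Bob gives to the functionality. By the unitary freedom of Kraus representations,
  \<open>C\<^sub>c = \<Sum>\<^sub>a cnj Y\<^sub>a\<^sub>c G\<^sub>a\<close> with \<open>Y Y\<^sup>* \<le> 1\<close>; hence an Alice who runs the purified honest strategy on some
  fixed input \<open>u\<^sub>0\<close> can measure \<open>c\<close>, and in particular \<open>w\<close>, on her environment register. The distribution of \<open>w\<close>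
  depends on \<open>v\<close> only, and by correctness a possible \<open>w\<close> satisfies \<open>f u w = f u v\<close> for every \<open>u\<close>.
\<close>

section \<open>Adjoints and positive semidefinite matrices\<close>

text \<open>Security provides an ideal adversary for each input distribution separately, and these
  adversaries may have nothing to do with each other. The uniform distribution has full support and
  its purification is maximally entangled, so the one adversary obtained for it reproduces the
  execution on every pair of inputs. Bob is purified so that Alice's environment is the only one
  left: the Kraus operators of the execution are then indexed by her register alone, and the change
  of Kraus representation becomes a measurement that she can perform. Honest Bob differs from
  purified Bob only by discarding an environment, which does not affect her measurement. The
  adversary fixes \<open>w\<close> before the functionality answers, so its possible values cannot
  depend on \<open>u\<close>. The remainder \<open>1 - Y Y\<^sup>*\<close> of the measurement has
  probability 0, since the \<open>C\<^sub>c\<close> already exhaust the total weight. The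
  preparation of \<open>u\<^sub>0\<close> is absorbed into Alice's first operation; protocols
  without rounds therefore stand apart, as do empty input sets, and in these cases \<open>f\<close>
  does not depend on \<open>v\<close>.\<close>

abbreviation adj :: "complex mat \<Rightarrow> complex mat" where
  "adj \<equiv> mat_adjoint"

lemma adj_dim [simp]: "dim_row (adj A) = dim_col A" "dim_col (adj A) = dim_row A"
  by (simp_all add: mat_adjoint_def)

lemma adj_index [simp]: "i < dim_col A \<Longrightarrow> j < dim_row A \<Longrightarrow> adj A $$ (i, j) = cnj (A $$ (j, i))"
  by (simp add: mat_adjoint_def mat_of_rows_index conjugate_complex_def)

lemma adj_carrier [simp]: "A \<in> carrier_mat n m \<Longrightarrow> adj A \<in> carrier_mat m n"
  by (rule carrier_matI) auto

lemma adj_adj [simp]: "adj (adj A) = A"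
  by (rule eq_matI) auto

lemma adj_one [simp]: "adj (1\<^sub>m n) = 1\<^sub>m n"
  by (rule eq_matI) auto

lemma mult_mat_index: "i < dim_row A \<Longrightarrow> j < dim_col B \<Longrightarrow> dim_col A = dim_row B \<Longrightarrow>
  (A * B) $$ (i, j) = (\<Sum>k<dim_row B. A $$ (i, k) * B $$ (k, j))"
  by (simp add: scalar_prod_def atLeast0LessThan)

lemma adj_mult: "dim_col A = dim_row B \<Longrightarrow> adj (A * B) = adj B * adj A"
  by (rule eq_matI) (auto simp: mult_mat_index mult.commute simp del: index_mult_mat(1))

lemma adj_minus: "dim_row A = dim_row B \<Longrightarrow> dim_col A = dim_col B \<Longrightarrow> adj (A - B) = adj A - adj B"
  by (rule eq_matI) auto

lemma mat_mult_assoc: "dim_col A = dim_row B \<Longrightarrow> dim_col B = dim_row C \<Longrightarrow>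
  (A * B) * C = A * (B * (C :: complex mat))"
  by (rule assoc_mult_mat[of A "dim_row A" "dim_row B" B "dim_row C" C "dim_col C"]) auto

lemma mat_mult_minus: "dim_col A = dim_row B \<Longrightarrow> dim_row B = dim_row C \<Longrightarrow> dim_col B = dim_col C \<Longrightarrow>
  A * (B - C) = A * B - A * (C :: complex mat)"
  by (rule mult_minus_distrib_mat[of _ "dim_row A" "dim_row B" _ "dim_col C"]) auto

lemma mat_minus_mult: "dim_col A = dim_row C \<Longrightarrow> dim_row A = dim_row B \<Longrightarrow> dim_col A = dim_col B \<Longrightarrow>
  (A - B) * C = A * C - B * (C :: complex mat)"
  by (rule minus_mult_distrib_mat[of _ "dim_row A" "dim_row C" _ _ "dim_col C"]) auto

lemma tr_mult: "dim_col A = dim_row B \<Longrightarrow>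
  tr (A * B) = (\<Sum>i<dim_row A. \<Sum>k<dim_row B. A $$ (i, k) * B $$ (k, i))"
  if "dim_row A = dim_col B"
  using that unfolding tr_def by (auto intro!: sum.cong simp: mult_mat_index simp del: index_mult_mat(1))

lemma tr_comm: "dim_col A = dim_row B \<Longrightarrow> dim_row A = dim_col B \<Longrightarrow> tr (A * B) = tr (B * A)"
  by (simp add: tr_mult mult.commute) (rule sum.swap)

lemma tr_minus: "dim_row A = dim_row B \<Longrightarrow> dim_col A = dim_col B \<Longrightarrow> dim_row B = dim_col B \<Longrightarrow> tr (A - B) = tr A - tr B"
  by (auto simp: tr_def sum_subtractf)

lemma tr_adj_mult: "tr (adj A * A) = of_real (\<Sum>k<dim_row A. \<Sum>i<dim_col A. (cmod (A $$ (k, i)))\<^sup>2)"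
proof -
  have "tr (adj A * A) = (\<Sum>i<dim_col A. \<Sum>k<dim_row A. cnj (A $$ (k, i)) * A $$ (k, i))"
    by (simp add: tr_mult)
  also have "\<dots> = (\<Sum>i<dim_col A. \<Sum>k<dim_row A. of_real ((cmod (A $$ (k, i)))\<^sup>2))"
    by (intro sum.cong refl) (metis complex_norm_square mult.commute)
  finally show ?thesis by (subst (asm) sum.swap) simp
qed

text \<open>The trace is the squared Frobenius norm, so an upper bound on its real part already
  forces every entry to vanish. Equalities of matrices are later derived from trace estimates by
  applying this to a difference.\<close>

lemma tr_adj_mult_le_0:
  assumes "Re (tr (adj A * A)) \<le> 0"
  shows "A = 0\<^sub>m (dim_row A) (dim_col A)"
proof (rule eq_matI)
  fix i j assume "i < dim_row (0\<^sub>m (dim_row A) (dim_col A) :: complex mat)"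
    "j < dim_col (0\<^sub>m (dim_row A) (dim_col A) :: complex mat)"
  then have ij: "i < dim_row A" "j < dim_col A" by auto
  let ?S = "\<Sum>k<dim_row A. \<Sum>i<dim_col A. (cmod (A $$ (k, i)))\<^sup>2"
  have "?S \<le> 0" using assms by (simp add: tr_adj_mult)
  moreover have "0 \<le> ?S" by (intro sum_nonneg) auto
  ultimately have "?S = 0" by simp
  then have "\<forall>k<dim_row A. (\<Sum>i<dim_col A. (cmod (A $$ (k, i)))\<^sup>2) = 0"
    by (subst (asm) sum_nonneg_eq_0_iff) (auto intro: sum_nonneg)
  \<comment> \<open>\<open>i'\<close> names the fixed row \<open>i\<close>, which the summation
    index would otherwise capture.\<close>
  then have "(\<Sum>i<dim_col A. (cmod (A $$ (i', i)))\<^sup>2) = 0" if "i' = i" for i' using ij that by auto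
  then have "(cmod (A $$ (i, j)))\<^sup>2 = 0"
    using ij by (subst (asm) sum_nonneg_eq_0_iff) auto
  then show "A $$ (i, j) = 0\<^sub>m (dim_row A) (dim_col A) $$ (i, j)" using ij by simp
qed auto

lemma re_tr_adj_mult_nonneg: "0 \<le> Re (tr (adj A * A))"
  by (simp add: tr_adj_mult sum_nonneg)

lemma mat_vec_assoc: "dim_col A = dim_row B \<Longrightarrow> dim_col B = dim_vec x \<Longrightarrow>
  (A * B) *\<^sub>v x = A *\<^sub>v (B *\<^sub>v (x :: complex vec))"
  by (rule assoc_mult_mat_vec[of _ "dim_row A" "dim_row B" _ "dim_col B"]) (auto intro: carrier_vecI)

lemma mat_vec_carrier [simp]: "dim_row A = n \<Longrightarrow> A *\<^sub>v x \<in> carrier_vec n"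
  by (intro carrier_vecI) simp

lemma inner_mult_mat:
  assumes "A \<in> carrier_mat n m" "x \<in> carrier_vec m" "y \<in> carrier_vec n"
  shows "(A *\<^sub>v x) \<bullet>c y = x \<bullet>c (adj A *\<^sub>v y)"
proof -
  have "(A *\<^sub>v x) \<bullet>c y = (\<Sum>i<n. \<Sum>j<m. A $$ (i, j) * x $ j * cnj (y $ i))"
    using assms by (auto simp: scalar_prod_def atLeast0LessThan sum_distrib_right conjugate_complex_def
        intro!: sum.cong)
  also have "\<dots> = (\<Sum>j<m. \<Sum>i<n. A $$ (i, j) * x $ j * cnj (y $ i))" by (rule sum.swap)
  also have "\<dots> = x \<bullet>c (adj A *\<^sub>v y)"
    using assms by (auto simp: scalar_prod_def atLeast0LessThan sum_distrib_left conjugate_complex_def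
        mult_ac intro!: sum.cong)
  finally show ?thesis .
qed

lemma psd_mult_adj: "K \<in> carrier_mat d m \<Longrightarrow> psd d (K * adj K)"
  unfolding psd_def
proof (intro conjI ballI)
  assume K: "K \<in> carrier_mat d m"
  show "K * adj K \<in> carrier_mat d d" using K by auto
  show "adj (K * adj K) = K * adj K" by (simp add: adj_mult)
  fix x :: "complex vec" assume x: "x \<in> carrier_vec d"
  have "(K * adj K *\<^sub>v x) \<bullet>c x = (K *\<^sub>v (adj K *\<^sub>v x)) \<bullet>c x"
    using K x by (simp add: mat_vec_assoc)
  also have "\<dots> = (adj K *\<^sub>v x) \<bullet>c (adj K *\<^sub>v x)"
    by (rule inner_mult_mat) (use K x in auto)
  finally show "0 \<le> (K * adj K *\<^sub>v x) \<bullet>c x" by (simp add: conjugate_square_ge_0_vec)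
qed

lemma psd_congruence:
  assumes "psd n A" "K \<in> carrier_mat m n"
  shows "psd m (K * A * adj K)"
  unfolding psd_def
proof (intro conjI ballI)
  have A: "A \<in> carrier_mat n n" "adj A = A" and
    p: "\<And>x. x \<in> carrier_vec n \<Longrightarrow> 0 \<le> (A *\<^sub>v x) \<bullet>c x" using assms unfolding psd_def by auto
  note K = assms(2)
  show "K * A * adj K \<in> carrier_mat m m" using K A by auto
  show "adj (K * A * adj K) = K * A * adj K" using K A by (simp add: adj_mult mat_mult_assoc)
  fix x :: "complex vec" assume x: "x \<in> carrier_vec m"
  have "(K * A * adj K *\<^sub>v x) \<bullet>c x = (K *\<^sub>v (A *\<^sub>v (adj K *\<^sub>v x))) \<bullet>c x"
    using K A x by (simp add: mat_vec_assoc)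
  also have "\<dots> = (A *\<^sub>v (adj K *\<^sub>v x)) \<bullet>c (adj K *\<^sub>v x)"
    by (rule inner_mult_mat) (use K A x in auto)
  finally show "0 \<le> (K * A * adj K *\<^sub>v x) \<bullet>c x" using p K x by auto
qed

section \<open>Spectral theorem\<close>

abbreviation real_diag :: "nat \<Rightarrow> (nat \<Rightarrow> real) \<Rightarrow> complex mat" where
  "real_diag n d \<equiv> mat n n (\<lambda>(i, j). if i = j then complex_of_real (d i) else 0)"

definition unitary :: "nat \<Rightarrow> complex mat \<Rightarrow> bool" where
  "unitary n U \<longleftrightarrow> U \<in> carrier_mat n n \<and> adj U * U = 1\<^sub>m n \<and> U * adj U = 1\<^sub>m n"

lemma unitaryI: "U \<in> carrier_mat n n \<Longrightarrow> adj U * U = 1\<^sub>m n \<Longrightarrow> unitary n U"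
  unfolding unitary_def using mat_mult_left_right_inverse[of "adj U" n U] by auto

lemma unitary_cancel:
  assumes "unitary n U" "dim_row X = n"
  shows "adj U * (U * X) = X" "U * (adj U * X) = X"
proof -
  have "adj U * (U * X) = (adj U * U) * X" "U * (adj U * X) = (U * adj U) * X"
    using assms by (intro mat_mult_assoc[symmetric]; auto simp: unitary_def)+
  then show "adj U * (U * X) = X" "U * (adj U * X) = X"
    using assms by (auto simp: unitary_def)
qed

lemma unitary_mult: "unitary n U \<Longrightarrow> unitary n W \<Longrightarrow> unitary n (U * W)"
proof (rule unitaryI)
  assume U: "unitary n U" and W: "unitary n W"
  then have c: "U \<in> carrier_mat n n" "W \<in> carrier_mat n n" by (auto simp: unitary_def)
  then show "U * W \<in> carrier_mat n n" by auto
  have "adj (U * W) * (U * W) = adj W * (adj U * (U * W))"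
    using c by (simp add: adj_mult mat_mult_assoc)
  also have "\<dots> = 1\<^sub>m n" using U W c by (simp add: unitary_cancel) (simp add: unitary_def)
  finally show "adj (U * W) * (U * W) = 1\<^sub>m n" .
qed

text \<open>Gram-Schmidt on a basis that starts with \<open>v\<close> leaves \<open>v\<close> itself
  in place, and only the normalisation rescales it. Hence the first column is a multiple of
  \<open>v\<close>, which is enough when \<open>v\<close> is an eigenvector.\<close>

lemma unitary_with_first_column:
  assumes v: "v \<in> carrier_vec n" "v \<noteq> 0\<^sub>v n"
  obtains U c where "unitary n U" "col U 0 = c \<cdot>\<^sub>v v"
proof -
  interpret cof_vec_space n "TYPE(complex)" .
  define b where "b = basis_completion v"
  define ws where "ws = gram_schmidt n b"
  note bc = basis_completion[OF v, folded b_def]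
  have n: "n \<noteq> 0" using v by auto
  then obtain vs where bv: "b = v # vs" using bc(6,7) by (cases b) auto
  from gram_schmidt_result[OF bc(2,4,5) refl, folded ws_def]
  have ws: "set ws \<subseteq> carrier_vec n" "corthogonal ws" "length ws = n"
    using bc(6) by auto
  have "hd ws = v" unfolding ws_def bv using v by simp
  moreover have "ws \<noteq> []" using ws(3) n by auto
  ultimately have w0: "ws ! 0 = v" by (simp add: hd_conv_nth)
  define s where "s j = complex_of_real (sqrt (Re (ws ! j \<bullet>c ws ! j)))" for j
  define U where "U = mat n n (\<lambda>(i, j). (ws ! j) $ i / s j)"
  have w: "ws ! j \<in> carrier_vec n" if "j < n" for j using ws that by auto
  have s2: "s j * s j = ws ! j \<bullet>c ws ! j" and s0: "s j \<noteq> 0" and cs: "cnj (s j) = s j" if "j < n" for j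
  proof -
    have ge: "0 \<le> ws ! j \<bullet>c ws ! j" by (rule conjugate_square_ge_0_vec)
    then have r: "ws ! j \<bullet>c ws ! j = of_real (Re (ws ! j \<bullet>c ws ! j))"
      by (simp add: less_eq_complex_def complex_eq_iff)
    show "s j * s j = ws ! j \<bullet>c ws ! j"
      using ge unfolding s_def by (subst (3) r) (simp add: less_eq_complex_def flip: of_real_mult)
    moreover have "ws ! j \<bullet>c ws ! j \<noteq> 0"
      using corthogonalD[OF ws(2), of j j] ws(3) that by auto
    ultimately show "s j \<noteq> 0" by auto
    show "cnj (s j) = s j" by (simp add: s_def)
  qed
  have "adj U * U = 1\<^sub>m n"
  proof (rule eq_matI)
    fix i j assume "i < dim_row (1\<^sub>m n :: complex mat)" "j < dim_col (1\<^sub>m n :: complex mat)"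
    then have ij: "i < n" "j < n" by auto
    have "(adj U * U) $$ (i, j) = (\<Sum>k<n. cnj (ws ! i $ k / s i) * (ws ! j $ k / s j))"
      using ij by (subst mult_mat_index) (auto simp: U_def intro!: sum.cong)
    also have "\<dots> = (ws ! j \<bullet>c ws ! i) / (s i * s j)"
      using w[OF ij(1)] w[OF ij(2)] cs ij
      by (auto simp: scalar_prod_def atLeast0LessThan sum_divide_distrib conjugate_complex_def mult_ac
          intro!: sum.cong)
    also have "\<dots> = (if i = j then 1 else 0)"
      using corthogonalD[OF ws(2), of j i] ws(3) ij s2[of i] s0[of i] by auto
    finally show "(adj U * U) $$ (i, j) = 1\<^sub>m n $$ (i, j)" using ij by simp
  qed (auto simp: U_def)
  then have "unitary n U" by (intro unitaryI) (auto simp: U_def)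
  moreover have "col U 0 = (1 / s 0) \<cdot>\<^sub>v v"
    using n w0 v by (intro eq_vecI) (auto simp: U_def)
  ultimately show thesis using that by blast
qed

text \<open>Deflation: in a unitary basis whose first vector is an eigenvector, the first column of
  the matrix is \<open>e\<close> times a unit vector; hermiticity clears the first row as well and
  makes \<open>e\<close> real. The remaining block is Hermitian of size \<open>n\<close> and falls
  to the induction hypothesis.\<close>

lemma spectral_theorem:
  assumes "A \<in> carrier_mat n n" "adj A = A"
  shows "\<exists>U d. unitary n U \<and> A = U * real_diag n d * adj U"
  using assms
proof (induction n arbitrary: A)
  case 0
  then show ?case by (intro exI[of _ "1\<^sub>m 0"]) (auto simp: unitary_def intro!: eq_matI)
next
  case (Suc n)
  note A = Suc.prems
  \<comment> \<open>The complex characteristic polynomial splits, and its degree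
    \<open>Suc n\<close> guarantees a root.\<close>
  obtain as where as: "char_poly A = (\<Prod>a\<leftarrow>as. [:- a, 1:])" "length as = Suc n"
    using char_poly_factorized[OF A(1)] by auto
  then obtain e es where "as = e # es" by (cases as) auto
  then have "eigenvalue A e" using eigenvalue_root_char_poly[OF A(1)] as by simp
  then obtain v where v: "v \<in> carrier_vec (Suc n)" "v \<noteq> 0\<^sub>v (Suc n)" "A *\<^sub>v v = e \<cdot>\<^sub>v v"
    using A(1) unfolding eigenvalue_def eigenvector_def by auto
  obtain W c where W: "unitary (Suc n) W" "col W 0 = c \<cdot>\<^sub>v v"
    using unitary_with_first_column[OF v(1,2)] .
  have Wc: "W \<in> carrier_mat (Suc n) (Suc n)" using W by (simp add: unitary_def)
  define A' where "A' = adj W * A * W"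
  have A'c: "A' \<in> carrier_mat (Suc n) (Suc n)" using Wc A by (auto simp: A'_def)
  have herm: "adj A' = A'" using Wc A by (simp add: A'_def adj_mult mat_mult_assoc)
  have AW: "col (A * W) 0 = e \<cdot>\<^sub>v col W 0"
  proof -
    have "col (A * W) 0 = A *\<^sub>v (c \<cdot>\<^sub>v v)" using Wc A W(2) by (subst col_mult2[of _ "Suc n" "Suc n"]) auto
    also have "\<dots> = c \<cdot>\<^sub>v (e \<cdot>\<^sub>v v)" using A v by (subst mult_mat_vec[of _ "Suc n" "Suc n"]) auto
    also have "\<dots> = e \<cdot>\<^sub>v (c \<cdot>\<^sub>v v)" by (simp add: smult_smult_assoc mult.commute)
    finally show ?thesis using W by simp
  qed
  have col0: "A' $$ (i, 0) = (if i = 0 then e else 0)" if i: "i < Suc n" for i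
  proof -
    have "A' = adj W * (A * W)" using Wc A by (simp add: A'_def mat_mult_assoc)
    then have "A' $$ (i, 0) = row (adj W) i \<bullet> (e \<cdot>\<^sub>v col W 0)" using Wc A i AW by simp
    also have "\<dots> = e * (row (adj W) i \<bullet> col W 0)" using Wc i by simp
    also have "row (adj W) i \<bullet> col W 0 = (adj W * W) $$ (i, 0)" using Wc i by simp
    also have "\<dots> = (if i = 0 then 1 else 0)" using W(1) i by (simp add: unitary_def)
    finally show ?thesis by simp
  qed
  have row0: "A' $$ (0, i) = (if i = 0 then cnj e else 0)" if i: "i < Suc n" for i
    using arg_cong[OF herm, of "\<lambda>M. M $$ (0, i)"] A'c i col0[of i] by auto
  have e_real: "complex_of_real (Re e) = e"
    using col0[of 0] row0[of 0] by (simp add: complex_eq_iff)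
  define B where "B = mat n n (\<lambda>(i, j). A' $$ (Suc i, Suc j))"
  have "adj B = B"
  proof (rule eq_matI; simp add: B_def)
    fix i j assume "i < n" "j < n"
    then show "cnj (A' $$ (Suc j, Suc i)) = A' $$ (Suc i, Suc j)"
      using arg_cong[OF herm, of "\<lambda>M. M $$ (Suc i, Suc j)"] A'c by simp
  qed
  then obtain U d where U: "unitary n U"
    and B: "B = U * real_diag n d * adj U"
    using Suc.IH[of B] by (auto simp: B_def)
  have Uc: "U \<in> carrier_mat n n" using U by (simp add: unitary_def)
  let ?D = "real_diag n d"
  let ?O = "mat 1 1 (\<lambda>_. 1 :: complex)"
  define d' where "d' i = (case i of 0 \<Rightarrow> Re e | Suc i \<Rightarrow> d i)" for i
  let ?D' = "real_diag (Suc n) d'"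
  \<comment> \<open>The diagonalising basis of the block is extended by a fixed first vector, so
    that \<open>W * P\<close> diagonalises \<open>A\<close>.\<close>
  define P where "P = four_block_mat (1\<^sub>m 1) (0\<^sub>m 1 n) (0\<^sub>m n 1) U"
  have Pc: "P \<in> carrier_mat (Suc n) (Suc n)" using Uc by (auto simp: P_def)
  have adjP: "adj P = four_block_mat (1\<^sub>m 1) (0\<^sub>m 1 n) (0\<^sub>m n 1) (adj U)"
    by (rule eq_matI) (use Uc in \<open>auto simp: P_def\<close>)
  have D': "?D' = four_block_mat (mat 1 1 (\<lambda>_. e)) (0\<^sub>m 1 n) (0\<^sub>m n 1) ?D"
    by (rule eq_matI) (auto simp: d'_def e_real split: nat.splits)
  have e_cnj: "cnj e = e" using e_real by (metis complex_cnj_complex_of_real)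
  have A'b: "A' = four_block_mat (mat 1 1 (\<lambda>_. e)) (0\<^sub>m 1 n) (0\<^sub>m n 1) B"
    by (rule eq_matI) (use A'c col0 row0 e_cnj in \<open>auto simp: B_def\<close>)
  have "adj P * P = 1\<^sub>m (Suc n)"
    unfolding adjP using Uc U
    by (subst P_def, subst mult_four_block_mat[of _ 1 1 _ n _ n _ _ 1 _ n])
      (auto simp: unitary_def intro!: eq_matI)
  then have P: "unitary (Suc n) P" using Pc by (intro unitaryI)
  have zero_add: "0\<^sub>m n n + X = X" if "dim_row X = n" "dim_col X = n" for X :: "complex mat"
    using that by (intro eq_matI) auto
  have "P * ?D' * adj P = A'"
    unfolding adjP D' A'b using Uc
    apply (subst P_def)
    apply (subst mult_four_block_mat[of _ 1 1 _ n _ n _ _ 1 _ n]; simp)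
    apply (subst mult_four_block_mat[of _ 1 1 _ n _ n _ _ 1 _ n]; simp add: B)
    apply (subst zero_add; simp)
    done
  moreover have "A = W * A' * adj W"
  proof -
    have "W * A' * adj W = W * (adj W * (A * (W * adj W)))"
      using Wc A by (simp add: A'_def mat_mult_assoc)
    also have "\<dots> = A" using W Wc A by (simp add: unitary_cancel) (simp add: unitary_def)
    finally show ?thesis ..
  qed
  ultimately have "A = W * (P * ?D' * adj P) * adj W" by simp
  then have "A = (W * P) * ?D' * adj (W * P)"
    using Wc Pc by (simp add: adj_mult mat_mult_assoc)
  moreover have "unitary (Suc n) (W * P)" using W P by (intro unitary_mult)
  ultimately show ?case by blast
qed

section \<open>Functional calculus of Hermitian matrices\<close>

lemma unitary_diag_calculus:
  assumes U: "unitary n U"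
  shows "(U * mat n n (\<lambda>(i, j). if i = j then f i else 0) * adj U) *
         (U * mat n n (\<lambda>(i, j). if i = j then g i else 0) * adj U)
       = U * mat n n (\<lambda>(i, j). if i = j then f i * g i else 0) * adj U" (is "(U * ?F * _) * (U * ?G * _) = U * ?H * _")
    and "adj (U * real_diag n h * adj U)
       = U * real_diag n h * adj U" (is "adj (U * ?K * _) = _")
proof -
  have Uc: "U \<in> carrier_mat n n" using U by (simp add: unitary_def)
  have FG: "?F * ?G = ?H"
    by (rule eq_matI) (auto simp: mult_mat_index if_distrib sum.If_cases
        simp del: index_mult_mat(1) cong: if_cong)
  have "(U * ?F * adj U) * (U * ?G * adj U) = U * (?F * (adj U * (U * (?G * adj U))))"
    using Uc by (simp add: mat_mult_assoc)
  also have "\<dots> = U * ((?F * ?G) * adj U)" using U Uc by (simp add: unitary_cancel mat_mult_assoc)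
  finally show "(U * ?F * adj U) * (U * ?G * adj U) = U * ?H * adj U"
    using Uc unfolding FG by (simp add: mat_mult_assoc)
  have "adj ?K = ?K" by (rule eq_matI) auto
  then show "adj (U * ?K * adj U) = U * ?K * adj U" using Uc by (simp add: adj_mult mat_mult_assoc)
qed

text \<open>This is the Moore-Penrose inverse, obtained by inverting the eigenvalues; it shares its
  eigenbasis with \<open>A\<close>, which explains why the two commute.\<close>

lemma hermitian_pinv:
  assumes "A \<in> carrier_mat n n" "adj A = A"
  obtains R where "R \<in> carrier_mat n n" "adj R = R" "A * R * A = A" "R * A * R = R" "A * R = R * A"
proof -
  obtain U d where U: "unitary n U"
    and A: "A = U * real_diag n d * adj U"
    using spectral_theorem[OF assms] by auto
  have Uc: "U \<in> carrier_mat n n" using U by (simp add: unitary_def)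
  \<comment> \<open>\<open>1 / 0 = 0\<close> in HOL, so the eigenvalue 0 is sent to 0, as a
    pseudoinverse requires.\<close>
  define R where "R = U * real_diag n (\<lambda>i. 1 / d i) * adj U"
  have s: "complex_of_real x * complex_of_real (1 / x) * complex_of_real x = complex_of_real x"
    "complex_of_real (1 / x) * complex_of_real x * complex_of_real (1 / x) = complex_of_real (1 / x)"
    "complex_of_real x * complex_of_real (1 / x) * complex_of_real (1 / x) = complex_of_real (1 / x)"
    "complex_of_real (1 / x) * complex_of_real x = complex_of_real x * complex_of_real (1 / x)" for x
    by (cases "x = 0"; simp)+
  show thesis
    by (rule that[of R]) (use Uc in \<open>auto simp only: A R_def unitary_diag_calculus[OF U] s intro!: mult_carrier_mat mat_carrier adj_carrier\<close>)
qed

lemma psd_root: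
  assumes "psd n A"
  obtains B where "psd n B" "B * B = A"
proof -
  have Ac: "A \<in> carrier_mat n n" "adj A = A" using assms by (auto simp: psd_def)
  obtain U d where U: "unitary n U"
    and A: "A = U * real_diag n d * adj U" (is "A = U * ?D * adj U")
    using spectral_theorem[OF Ac] by auto
  have Uc: "U \<in> carrier_mat n n" using U by (simp add: unitary_def)
  \<comment> \<open>Conjugating back with \<open>U\<close> preserves positivity, and the diagonal
    entries are values of the quadratic form on unit vectors.\<close>
  have d: "0 \<le> d i" if i: "i < n" for i
  proof -
    have "adj U * A * U = adj U * (U * (?D * (adj U * U)))" using Uc by (simp add: A mat_mult_assoc)
    also have "\<dots> = ?D" using U Uc by (simp add: unitary_cancel) (simp add: unitary_def)
    finally have "psd n ?D" using psd_congruence[OF assms, of "adj U" n] Uc by simp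
    then have "0 \<le> (?D *\<^sub>v unit_vec n i) \<bullet>c unit_vec n i" by (simp add: psd_def)
    also have "\<dots> = complex_of_real (d i)"
      using i by (simp add: scalar_prod_def unit_vec_def if_distrib conjugate_complex_def cong: if_cong)
    finally show ?thesis by (simp add: less_eq_complex_def)
  qed
  define B where "B = U * real_diag n (\<lambda>i. sqrt (d i)) * adj U"
  \<comment> \<open>The fourth root exhibits \<open>B\<close> as \<open>C * adj C\<close>, hence as
    positive semidefinite.\<close>
  define C where "C = U * real_diag n (\<lambda>i. sqrt (sqrt (d i))) * adj U"
  have sq: "mat n n (\<lambda>(i, j). if i = j then complex_of_real (sqrt (f i)) * complex_of_real (sqrt (f i)) else 0)
    = real_diag n f" if "\<And>i. i < n \<Longrightarrow> 0 \<le> f i" for f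
    using that by (intro eq_matI) (auto simp flip: of_real_mult)
  have "B * B = A" unfolding B_def A unitary_diag_calculus[OF U] using d by (simp add: sq)
  moreover have "B = C * adj C"
    unfolding B_def C_def unitary_diag_calculus[OF U] using d by (simp add: sq)
  moreover have "C \<in> carrier_mat n n" using Uc by (auto simp: C_def)
  ultimately show thesis using that psd_mult_adj[of C n n] by auto
qed

section \<open>Square roots and states at distance zero\<close>

lemma msqrt:
  assumes "psd n A"
  shows "psd n (msqrt A)" "msqrt A * msqrt A = A"
proof -
  have "dim_row A = n" using assms by (auto simp: psd_def)
  moreover obtain B where "psd n B \<and> B * B = A" using psd_root[OF assms] by blast
  ultimately have "psd n (msqrt A) \<and> msqrt A * msqrt A = A"
    unfolding msqrt_def by (metis (mono_tags, lifting) someI_ex)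
  then show "psd n (msqrt A)" "msqrt A * msqrt A = A" by auto
qed

lemma psd_tr_nonneg:
  assumes "psd n A"
  shows "0 \<le> Re (tr A)"
proof -
  obtain B where B: "psd n B" "B * B = A" using psd_root[OF assms] .
  then have "A = adj B * B" by (simp add: psd_def)
  then show ?thesis by (simp add: re_tr_adj_mult_nonneg)
qed

text \<open>
  With \<open>A\<close>, \<open>B\<close> the roots of \<open>\<rho>\<close>, \<open>\<sigma>\<close> and \<open>S = |(A B)\<^sup>*|\<close>, the partial isometry \<open>W = (A B)\<^sup>* S\<^sup>+\<close> gives
  \<open>tr S = tr (A B W)\<close>. If \<open>tr S \<ge> 1\<close>, equality in Cauchy-Schwarz forces \<open>A = W\<^sup>* B\<close> and \<open>B = W W\<^sup>* B\<close>.
\<close>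

lemma close_0_imp_eq:
  assumes \<rho>: "psd n \<rho>" "tr \<rho> = 1" and \<sigma>: "psd n \<sigma>" "tr \<sigma> = 1" and "close 0 \<rho> \<sigma>"
  shows "\<rho> = \<sigma>"
proof -
  define A where "A = msqrt \<rho>"
  obtain B where B: "psd n B" "B * B = \<sigma>" using psd_root[OF \<sigma>(1)] .
  have A: "psd n A" "A * A = \<rho>" using msqrt[OF \<rho>(1)] by (auto simp: A_def)
  have c: "A \<in> carrier_mat n n" "B \<in> carrier_mat n n" and h: "adj A = A" "adj B = B"
    using A B by (auto simp: psd_def)
  define S where "S = msqrt (A * \<sigma> * A)"
  have "psd n (A * \<sigma> * A)" using psd_congruence[OF \<sigma>(1) c(1)] h by simp
  note S' = msqrt[OF this, folded S_def]
  have S: "S \<in> carrier_mat n n" "adj S = S" using S'(1) by (auto simp: psd_def)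
  have SS: "S * S = A * (B * (B * A))" using S'(2) c by (simp add: B(2)[symmetric] mat_mult_assoc)
  have F: "fidelity \<rho> \<sigma> = Re (tr S)" by (simp add: fidelity_def A_def S_def)
  \<comment> \<open>In HOL \<open>sqrt\<close> is strictly increasing on all reals, negative ones
    included, so \<open>close 0\<close> amounts to \<open>1 - F\<^sup>2 \<le> 0\<close> for the
    fidelity \<open>F\<close>.\<close>
  have "sqrt (1 - (Re (tr S))\<^sup>2) \<le> sqrt 0"
    using assms(5) by (simp add: close_def F)
  then have "1 \<le> (Re (tr S))\<^sup>2" by (subst (asm) real_sqrt_le_iff) simp
  moreover have "0 \<le> Re (tr S)" by (rule psd_tr_nonneg[OF S'(1)])
  ultimately have F1: "1 \<le> Re (tr S)"
    by (metis abs_of_nonneg abs_square_le_1 le_cases one_power2 power2_le_imp_le)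
  obtain R where R: "R \<in> carrier_mat n n" "adj R = R" "S * R * S = S" "R * S * R = R" "S * R = R * S"
    using hermitian_pinv[OF S] .
  define W where "W = B * A * R"
  have W: "W \<in> carrier_mat n n" using c R by (auto simp: W_def)
  have aW: "adj W = R * (A * B)" using c R h by (simp add: W_def adj_mult mat_mult_assoc)
  have SSR: "S * (S * R) = S"
    using R(3,5) S R(1) by (metis mat_mult_assoc carrier_matD)
  have RSS: "R * (S * S) = S"
    using R(3,5) S R(1) by (metis mat_mult_assoc carrier_matD)
  have ABW: "A * (B * W) = S"
  proof -
    have "A * (B * W) = (S * S) * R" unfolding SS using c R by (simp add: W_def mat_mult_assoc)
    then show ?thesis using SSR S R(1) by (simp add: mat_mult_assoc)
  qed
  have WBA: "adj W * (B * A) = S"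
    using arg_cong[OF ABW, of adj] c W h S by (simp add: adj_mult mat_mult_assoc)
  define Q where "Q = W * adj W"
  have Q: "Q \<in> carrier_mat n n" "adj Q = Q" using W by (auto simp: Q_def adj_mult)
  have RSSR: "R * (S * (S * (R * X))) = S * (R * X)" if "dim_row X = n" for X
  proof -
    have "R * (S * (S * (R * X))) = (R * (S * S)) * (R * X)"
      using S R(1) that by (simp add: mat_mult_assoc)
    then show ?thesis using RSS by simp
  qed
  have RSR: "R * (S * (R * X)) = R * X" if "dim_row X = n" for X
  proof -
    have "R * (S * (R * X)) = (R * S * R) * X" using S R(1) that by (simp add: mat_mult_assoc)
    then show ?thesis using R(4) by simp
  qed
  \<comment> \<open>\<open>W\<close> is a partial isometry and \<open>Q\<close> its range
    projection: the product \<open>A * B * B * A\<close> that appears between the pseudoinverses is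
    \<open>S * S\<close>, and they absorb it.\<close>
  have QQ: "Q * Q = Q"
  proof -
    have "Q * Q = B * (A * (R * (R * ((A * (B * (B * A))) * (R * (R * (A * B)))))))"
      using c R W by (simp add: Q_def aW) (simp add: W_def mat_mult_assoc)
    also have "\<dots> = B * (A * (R * (R * (S * (S * (R * (R * (A * B))))))))"
      unfolding SS[symmetric] using c R S by (simp add: mat_mult_assoc)
    also have "\<dots> = B * (A * (R * (R * (A * B))))" using c R S by (simp add: RSSR RSR)
    also have "\<dots> = Q" using c R by (simp add: Q_def aW) (simp add: W_def mat_mult_assoc)
    finally show ?thesis .
  qed
  \<comment> \<open>\<open>tr (adj X * X)\<close> and \<open>tr (adj Y * Y)\<close> contain
    \<open>tr (B * (Q * B))\<close> with opposite signs. Their sum is \<open>2 - 2 * tr S\<close>,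
    so both squared norms vanish as soon as \<open>tr S\<close> is at least 1.\<close>
  define X where "X = A - adj W * B"
  define Y where "Y = B - Q * B"
  have "adj X * X = A * A - B * (W * A) - (A * (adj W * B) - B * (Q * B))"
    using c W h by (simp add: X_def adj_minus adj_mult mat_mult_minus mat_minus_mult mat_mult_assoc Q_def)
  then have "tr (adj X * X) = tr (A * A) - tr (B * (W * A)) - (tr (A * (adj W * B)) - tr (B * (Q * B)))"
    using c W Q by (simp add: tr_minus)
  moreover have "tr (A * (adj W * B)) = tr S"
  proof -
    have "tr (A * (adj W * B)) = tr ((adj W * B) * A)" using c W by (intro tr_comm) auto
    then show ?thesis using WBA c W by (simp add: mat_mult_assoc)
  qed
  moreover have "tr (B * (W * A)) = tr S"
  proof -
    have "tr (B * (W * A)) = tr ((B * W) * A)" using c W by (simp add: mat_mult_assoc)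
    also have "\<dots> = tr (A * (B * W))" using c W by (intro tr_comm) auto
    finally show ?thesis using ABW by simp
  qed
  moreover have "adj Y * Y = B * B - B * (Q * B)"
  proof -
    have "adj Y * Y = B * B - B * (Q * B) - (B * (Q * B) - B * (Q * (Q * B)))"
      using c Q h by (simp add: Y_def adj_minus adj_mult mat_mult_minus mat_minus_mult mat_mult_assoc)
    moreover have "Q * (Q * B) = Q * B" using QQ c Q by (metis mat_mult_assoc carrier_matD)
    moreover have "B * B - B * (Q * B) - (B * (Q * B) - B * (Q * B)) = B * B - B * (Q * B)"
      using c Q by (intro eq_matI) auto
    ultimately show ?thesis by simp
  qed
  then have "tr (adj Y * Y) = tr (B * B) - tr (B * (Q * B))" using c Q by (simp add: tr_minus)
  moreover have "tr (A * A) = 1" "tr (B * B) = 1" using A B \<rho> \<sigma> by auto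
  ultimately have "Re (tr (adj X * X)) + Re (tr (adj Y * Y)) = 2 - 2 * Re (tr S)" by simp
  then have "Re (tr (adj X * X)) \<le> 0" "Re (tr (adj Y * Y)) \<le> 0"
    using F1 re_tr_adj_mult_nonneg[of X] re_tr_adj_mult_nonneg[of Y] by linarith+
  then have X0: "X = 0\<^sub>m n n" and Y0: "Y = 0\<^sub>m n n"
    using tr_adj_mult_le_0[of X] tr_adj_mult_le_0[of Y] c W Q by (auto simp: X_def Y_def)
  have eqI: "M = N" if "M - N = 0\<^sub>m n n" "M \<in> carrier_mat n n" "N \<in> carrier_mat n n" for M N :: "complex mat"
  proof (rule eq_matI)
    fix i j assume "i < dim_row N" "j < dim_col N"
    then have "M $$ (i, j) - N $$ (i, j) = (M - N) $$ (i, j)" by simp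
    also have "\<dots> = 0" using that(1,3) \<open>i < dim_row N\<close> \<open>j < dim_col N\<close> by simp
    finally show "M $$ (i, j) = N $$ (i, j)" by simp
  qed (use that in auto)
  have AWB: "A = adj W * B" by (rule eqI) (use X0 c W in \<open>auto simp: X_def\<close>)
  have BQB: "B = Q * B" by (rule eqI) (use Y0 c Q in \<open>auto simp: Y_def\<close>)
  have "A = B * W" using arg_cong[OF AWB, of adj] c W h by (simp add: adj_mult)
  \<comment> \<open>Hermiticity turns \<open>A = adj W * B\<close> around into
    \<open>A = B * W\<close>, so that in \<open>A * A\<close> the two copies of \<open>W\<close>
    meet in \<open>W * adj W = Q\<close>.\<close>
  then have "A * A = (B * W) * (adj W * B)" using AWB by simp
  also have "\<dots> = B * (Q * B)" using c W by (simp add: Q_def mat_mult_assoc)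
  also have "\<dots> = B * B" using BQB by simp
  finally show ?thesis using A B by simp
qed

section \<open>Kronecker products\<close>

lemma mult_add_less: "i < a \<Longrightarrow> j < b \<Longrightarrow> i * b + j < a * (b :: nat)"
  by (metis add.commute add_less_cancel_left mult_Suc less_le_trans Suc_leI mult_le_mono1)

lemma mult_add_eq_iff:
  "j < b \<Longrightarrow> l < b \<Longrightarrow> i * b + j = k * b + (l :: nat) \<longleftrightarrow> i = k \<and> j = l"
  by (metis add_right_cancel div_mult_self3 div_less less_nat_zero_code
        mod_less mod_mult_self3 add.right_neutral)

lemma mult_add_cases:
  assumes "x < a * (b :: nat)"
  obtains i j where "i < a" "j < b" "x = i * b + j"
proof -
  have "0 < b" using assms by (cases b) auto
  then show thesis
    using that[of "x div b" "x mod b"] assms by (simp add: less_mult_imp_div_less)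
qed

lemma sum_lessThan_mult:
  fixes g :: "nat \<Rightarrow> 'a :: comm_monoid_add"
  shows "(\<Sum>x<a * b. g x) = (\<Sum>i<a. \<Sum>j<b. g (i * b + j))"
proof -
  have "sum g {m * b..<m * b + b} = (\<Sum>j<b. g (m * b + j))" for m
    using sum.shift_bounds_nat_ivl[of g 0 "m * b" b] by (simp add: add.commute atLeast0LessThan)
  then show ?thesis using sum.nat_group[of g b a] by simp
qed

text \<open>Product coordinates for rows and columns keep \<open>div\<close> and \<open>mod\<close>
  out of the later comparisons of entries.\<close>

lemma eq_mat_prodI:
  assumes "A \<in> carrier_mat (a * b) (c * d)" "B \<in> carrier_mat (a * b) (c * d)"
    and "\<And>i j k l. i < a \<Longrightarrow> j < b \<Longrightarrow> k < c \<Longrightarrow> l < d \<Longrightarrow>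
      A $$ (i * b + j, k * d + l) = B $$ (i * b + j, k * d + l)"
  shows "A = B"
  by (rule eq_matI) (use assms in \<open>auto elim!: mult_add_cases\<close>)

lemma kron_dim [simp]:
  "dim_row (kron A B) = dim_row A * dim_row B" "dim_col (kron A B) = dim_col A * dim_col B"
  by (simp_all add: kron_def)

lemma kron_carrier: "A \<in> carrier_mat a c \<Longrightarrow> B \<in> carrier_mat b d \<Longrightarrow> kron A B \<in> carrier_mat (a * b) (c * d)"
  by (rule carrier_matI) auto

lemma kron_index:
  assumes "i < dim_row A" "j < dim_row B" "k < dim_col A" "l < dim_col B" "b = dim_row B" "d = dim_col B"
  shows "kron A B $$ (i * b + j, k * d + l) = A $$ (i, k) * B $$ (j, l)"
  using assms mult_add_less[of i "dim_row A" j "dim_row B"] mult_add_less[of k "dim_col A" l "dim_col B"]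
  by (auto simp: kron_def)

lemma kron_mult:
  assumes "dim_col A = dim_row C" "dim_col B = dim_row D"
  shows "kron A B * kron C D = kron (A * C) (B * D)"
proof (rule eq_mat_prodI[of _ "dim_row A" "dim_row B" "dim_col C" "dim_col D"])
  fix i j k l assume *: "i < dim_row A" "j < dim_row B" "k < dim_col C" "l < dim_col D"
  note lt = mult_add_less[OF *(1,2)] mult_add_less[OF *(3,4)]
  have "(kron A B * kron C D) $$ (i * dim_row B + j, k * dim_col D + l)
    = (\<Sum>x<dim_row C * dim_row D. kron A B $$ (i * dim_row B + j, x) * kron C D $$ (x, k * dim_col D + l))"
    using assms lt by (subst mult_mat_index) auto
  also have "\<dots> = (\<Sum>x<dim_row C. \<Sum>y<dim_row D. (A $$ (i, x) * B $$ (j, y)) * (C $$ (x, k) * D $$ (y, l)))"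
    unfolding sum_lessThan_mult using * assms
    by (intro sum.cong refl arg_cong2[of _ _ _ _ "(*)"] kron_index) auto
  also have "\<dots> = (\<Sum>x<dim_row C. A $$ (i, x) * C $$ (x, k)) * (\<Sum>y<dim_row D. B $$ (j, y) * D $$ (y, l))"
    by (simp add: sum_product mult_ac)
  also have "\<dots> = (A * C) $$ (i, k) * (B * D) $$ (j, l)"
    using * assms by (simp add: mult_mat_index del: index_mult_mat(1))
  also have "\<dots> = kron (A * C) (B * D) $$ (i * dim_row B + j, k * dim_col D + l)"
    using * by (subst kron_index) auto
  finally show "(kron A B * kron C D) $$ (i * dim_row B + j, k * dim_col D + l) = \<dots>" .
qed (auto intro: carrier_matI)

text \<open>Both bracketings encode a triple of indices as the same mixed radix number, so
  associativity is an equality of matrices without any reindexing.\<close>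

lemma kron_assoc: "kron (kron A B) C = kron A (kron B C)"
proof (rule eq_mat_prodI[of _ "dim_row A * dim_row B" "dim_row C" "dim_col A * dim_col B" "dim_col C"])
  fix i j k l assume *: "i < dim_row A * dim_row B" "j < dim_row C" "k < dim_col A * dim_col B" "l < dim_col C"
  obtain i1 i2 where i: "i1 < dim_row A" "i2 < dim_row B" "i = i1 * dim_row B + i2"
    using mult_add_cases[OF *(1)] .
  obtain k1 k2 where k: "k1 < dim_col A" "k2 < dim_col B" "k = k1 * dim_col B + k2"
    using mult_add_cases[OF *(3)] .
  have eq: "i * dim_row C + j = i1 * (dim_row B * dim_row C) + (i2 * dim_row C + j)"
    "k * dim_col C + l = k1 * (dim_col B * dim_col C) + (k2 * dim_col C + l)"
    using i k by (simp_all add: algebra_simps)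
  have "kron (kron A B) C $$ (i * dim_row C + j, k * dim_col C + l) = kron A B $$ (i, k) * C $$ (j, l)"
    using * by (intro kron_index) auto
  also have "\<dots> = A $$ (i1, k1) * B $$ (i2, k2) * C $$ (j, l)"
    unfolding i k using i k by (subst kron_index) auto
  also have "\<dots> = kron A (kron B C) $$ (i * dim_row C + j, k * dim_col C + l)"
    unfolding eq using i k * by (subst kron_index; (subst kron_index)?) (auto simp: mult_add_less)
  finally show "kron (kron A B) C $$ (i * dim_row C + j, k * dim_col C + l) = \<dots>" .
qed (auto intro!: carrier_matI simp: mult_ac)

lemma kron_one: "kron (1\<^sub>m a) (1\<^sub>m b) = 1\<^sub>m (a * b)"
proof (rule eq_mat_prodI[of _ a b a b])
  fix i j k l assume *: "i < a" "j < b" "k < a" "l < b"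
  note lt = mult_add_less[OF *(1,2)] mult_add_less[OF *(3,4)]
  show "kron (1\<^sub>m a) (1\<^sub>m b) $$ (i * b + j, k * b + l) = 1\<^sub>m (a * b) $$ (i * b + j, k * b + l)"
    using * lt by (subst kron_index) (auto simp: mult_add_eq_iff)
qed (auto intro: carrier_matI)

lemma kron_one_left [simp]: "kron (1\<^sub>m 1) A = A"
  by (rule eq_matI) (auto simp: kron_def)

lemma adj_kron: "adj (kron A B) = kron (adj A) (adj B)"
proof (rule eq_mat_prodI[of _ "dim_col A" "dim_col B" "dim_row A" "dim_row B"])
  fix i j k l assume *: "i < dim_col A" "j < dim_col B" "k < dim_row A" "l < dim_row B"
  note lt = mult_add_less[OF *(1,2)] mult_add_less[OF *(3,4)]
  show "adj (kron A B) $$ (i * dim_col B + j, k * dim_row B + l)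
    = kron (adj A) (adj B) $$ (i * dim_col B + j, k * dim_row B + l)"
    using * lt by (simp add: kron_index)
qed (auto intro: carrier_matI)

lemma tr_kron:
  assumes "dim_row A = dim_col A" "dim_row B = dim_col B"
  shows "tr (kron A B) = tr A * tr B"
proof -
  have "tr (kron A B) = (\<Sum>i<dim_row A. \<Sum>j<dim_row B. kron A B $$ (i * dim_row B + j, i * dim_row B + j))"
    by (simp add: tr_def sum_lessThan_mult)
  also have "\<dots> = (\<Sum>i<dim_row A. \<Sum>j<dim_row B. A $$ (i, i) * B $$ (j, j))"
    using assms by (intro sum.cong refl kron_index) auto
  also have "\<dots> = tr A * tr B" by (simp add: tr_def sum_product)
  finally show ?thesis .
qed

section \<open>Kraus representations\<close>

lemma ketbra_carrier [simp]: "ketbra d i j \<in> carrier_mat d d"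
  by (simp add: ketbra_def)

lemma ketbra_dim [simp]: "dim_row (ketbra d i j) = d" "dim_col (ketbra d i j) = d"
  by (simp_all add: ketbra_def)

lemma ketbra_index [simp]:
  "r < d \<Longrightarrow> c < d \<Longrightarrow> ketbra d i j $$ (r, c) = (if r = i \<and> c = j then 1 else 0)"
  by (simp add: ketbra_def)

lemma msum_dim [simp]: "dim_row (msum d I F) = d" "dim_col (msum d I F) = d"
  by (simp_all add: msum_def)

lemma msum_carrier [simp]: "msum d I F \<in> carrier_mat d d"
  by (simp add: msum_def)

lemma msum_index: "i < d \<Longrightarrow> j < d \<Longrightarrow> msum d I F $$ (i, j) = (\<Sum>k\<in>I. F k $$ (i, j))"
  by (simp add: msum_def)

lemma tr_msum:
  assumes "\<And>k. k \<in> I \<Longrightarrow> F k \<in> carrier_mat d d"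
  shows "tr (msum d I F) = (\<Sum>k\<in>I. tr (F k))"
proof -
  have "tr (msum d I F) = (\<Sum>k\<in>I. \<Sum>i<d. F k $$ (i, i))"
    by (subst sum.swap) (simp add: tr_def msum_index)
  also have "\<dots> = (\<Sum>k\<in>I. tr (F k))" using assms by (intro sum.cong) (auto simp: tr_def)
  finally show ?thesis .
qed

lemma conj_index:
  assumes "K \<in> carrier_mat t s" "\<rho> \<in> carrier_mat s s" "r < t" "c < t"
  shows "(K * \<rho> * adj K) $$ (r, c) = (\<Sum>i<s. \<Sum>j<s. K $$ (r, i) * \<rho> $$ (i, j) * cnj (K $$ (c, j)))"
proof -
  have "(K * \<rho> * adj K) $$ (r, c) = (\<Sum>j<s. (\<Sum>i<s. K $$ (r, i) * \<rho> $$ (i, j)) * cnj (K $$ (c, j)))"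
    using assms by (auto simp: mult_mat_index simp del: index_mult_mat(1))
  also have "\<dots> = (\<Sum>j<s. \<Sum>i<s. K $$ (r, i) * \<rho> $$ (i, j) * cnj (K $$ (c, j)))"
    by (simp add: sum_distrib_right)
  finally show ?thesis by (subst (asm) sum.swap)
qed

lemma sum_delta2:
  fixes F G :: "nat \<Rightarrow> nat \<Rightarrow> complex"
  assumes "i < s" "j < t"
  shows "(\<Sum>i'<s. \<Sum>j'<t. F i' j' * (if i' = i \<and> j' = j then 1 else 0) * G i' j') = F i j * G i j"
proof -
  have "(\<Sum>j'<t. F i' j' * (if i' = i \<and> j' = j then 1 else 0) * G i' j') = (if i' = i then F i j * G i j else 0)" for i'
  proof -
    have "(\<Sum>j'<t. F i' j' * (if i' = i \<and> j' = j then 1 else 0) * G i' j')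
      = (\<Sum>j'<t. if j' = j then (if i' = i then F i j * G i j else 0) else 0)"
      by (rule sum.cong[OF refl]) auto
    then show ?thesis using assms by simp
  qed
  then show ?thesis using assms by simp
qed

lemma conj_ketbra_index:
  assumes "K \<in> carrier_mat t s" "r < t" "c < t" "i < s" "j < s"
  shows "(K * ketbra s i j * adj K) $$ (r, c) = K $$ (r, i) * cnj (K $$ (c, j))"
proof -
  have "(K * ketbra s i j * adj K) $$ (r, c)
    = (\<Sum>i'<s. \<Sum>j'<s. K $$ (r, i') * (if i' = i \<and> j' = j then 1 else 0) * cnj (K $$ (c, j')))"
    using assms by (simp add: conj_index del: index_mult_mat(1))
  then show ?thesis using assms by (simp add: sum_delta2 del: index_mult_mat(1))
qed

text \<open>The index set is arbitrary because composition and tensor product of maps produce pairs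
  of indices. The completeness relation is kept apart as \<open>isometric\<close>.\<close>

definition kraus :: "qmap \<Rightarrow> 'i set \<Rightarrow> ('i \<Rightarrow> complex mat) \<Rightarrow> bool" where
  "kraus E I K \<longleftrightarrow> finite I \<and> (\<forall>k\<in>I. K k \<in> carrier_mat (trg E) (src E)) \<and>
     (\<forall>\<rho> \<in> carrier_mat (src E) (src E). app E \<rho> = msum (trg E) I (\<lambda>k. K k * \<rho> * adj (K k)))"

lemma kraus_index:
  assumes "kraus E I K" "\<rho> \<in> carrier_mat (src E) (src E)" "r < trg E" "c < trg E"
  shows "app E \<rho> $$ (r, c) =
    (\<Sum>k\<in>I. \<Sum>i<src E. \<Sum>j<src E. K k $$ (r, i) * \<rho> $$ (i, j) * cnj (K k $$ (c, j)))"
  using assms by (auto simp: kraus_def msum_index intro!: sum.cong conj_index[of _ "trg E"])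

lemma kraus_ketbra:
  assumes "kraus E I K" "i < src E" "j < src E" "r < trg E" "c < trg E"
  shows "app E (ketbra (src E) i j) $$ (r, c) = (\<Sum>k\<in>I. K k $$ (r, i) * cnj (K k $$ (c, j)))"
  using assms by (auto simp: kraus_def msum_index intro!: sum.cong conj_ketbra_index[of _ "trg E"])

lemma kraus_imp_linear:
  assumes "kraus E I K"
  shows "linear_qmap E"
  unfolding linear_qmap_def
proof (intro conjI ballI allI)
  have c: "app E \<rho> \<in> carrier_mat (trg E) (trg E)" if "\<rho> \<in> carrier_mat (src E) (src E)" for \<rho>
    using assms that by (simp add: kraus_def)
  then show "app E \<rho> \<in> carrier_mat (trg E) (trg E)" if "\<rho> \<in> carrier_mat (src E) (src E)" for \<rho>
    using that .
  show "app E (\<rho> + \<sigma>) = app E \<rho> + app E \<sigma>"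
    if a: "\<rho> \<in> carrier_mat (src E) (src E)" "\<sigma> \<in> carrier_mat (src E) (src E)" for \<rho> \<sigma>
  proof (rule eq_matI)
    fix r c' assume "r < dim_row (app E \<rho> + app E \<sigma>)" "c' < dim_col (app E \<rho> + app E \<sigma>)"
    then have rc: "r < trg E" "c' < trg E" using c[OF a(2)] by auto
    have "\<rho> + \<sigma> \<in> carrier_mat (src E) (src E)" using a by auto
    then show "app E (\<rho> + \<sigma>) $$ (r, c') = (app E \<rho> + app E \<sigma>) $$ (r, c')"
      using rc a c[OF a(1)] c[OF a(2)]
      by (auto simp: kraus_index[OF assms] distrib_left distrib_right sum.distrib)
  qed (use c[OF a(1)] c[OF a(2)] c[of "\<rho> + \<sigma>"] a in auto)
  show "app E (a \<cdot>\<^sub>m \<rho>) = a \<cdot>\<^sub>m app E \<rho>" if \<rho>: "\<rho> \<in> carrier_mat (src E) (src E)" for a \<rho>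
  proof (rule eq_matI)
    have a\<rho>: "a \<cdot>\<^sub>m \<rho> \<in> carrier_mat (src E) (src E)" using \<rho> by auto
    fix r c' assume "r < dim_row (a \<cdot>\<^sub>m app E \<rho>)" "c' < dim_col (a \<cdot>\<^sub>m app E \<rho>)"
    then have rc: "r < trg E" "c' < trg E" using c[OF \<rho>] by auto
    then show "app E (a \<cdot>\<^sub>m \<rho>) $$ (r, c') = (a \<cdot>\<^sub>m app E \<rho>) $$ (r, c')"
      using \<rho> a\<rho> c[OF \<rho>] by (auto simp: kraus_index[OF assms] sum_distrib_left mult_ac intro!: sum.cong)
  qed (use c[OF \<rho>] c[of "a \<cdot>\<^sub>m \<rho>"] \<rho> in auto)
qed

lemma linear_qmap_carrier: "linear_qmap E \<Longrightarrow> \<rho> \<in> carrier_mat (src E) (src E) \<Longrightarrow> app E \<rho> \<in> carrier_mat (trg E) (trg E)"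
  by (simp add: linear_qmap_def)

text \<open>Matrix units span the operators, so a linear map is known from its values on them. The
  sum is built up one position at a time because \<open>linear_qmap\<close> speaks of binary
  sums.\<close>

lemma linear_qmap_expand:
  assumes E: "linear_qmap E" and \<rho>: "\<rho> \<in> carrier_mat (src E) (src E)" and rc: "r < trg E" "c < trg E"
  shows "app E \<rho> $$ (r, c) = (\<Sum>i<src E. \<Sum>j<src E. \<rho> $$ (i, j) * app E (ketbra (src E) i j) $$ (r, c))"
proof -
  let ?s = "src E"
  let ?R = "\<lambda>S. mat ?s ?s (\<lambda>x. if x \<in> S then \<rho> $$ x else 0)"
  have car: "app E \<sigma> \<in> carrier_mat (trg E) (trg E)" if "\<sigma> \<in> carrier_mat ?s ?s" for \<sigma>
    using E that by (simp add: linear_qmap_def)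
  have add: "app E (\<sigma> + \<tau>) $$ (r, c) = app E \<sigma> $$ (r, c) + app E \<tau> $$ (r, c)"
    if "\<sigma> \<in> carrier_mat ?s ?s" "\<tau> \<in> carrier_mat ?s ?s" for \<sigma> \<tau>
  proof -
    have "app E (\<sigma> + \<tau>) = app E \<sigma> + app E \<tau>" using E that by (simp add: linear_qmap_def)
    then show ?thesis using rc car[OF that(2)] by simp
  qed
  have scale: "app E (a \<cdot>\<^sub>m \<sigma>) $$ (r, c) = a * app E \<sigma> $$ (r, c)" if "\<sigma> \<in> carrier_mat ?s ?s" for a \<sigma>
  proof -
    have "app E (a \<cdot>\<^sub>m \<sigma>) = a \<cdot>\<^sub>m app E \<sigma>" using E that by (simp add: linear_qmap_def)
    then show ?thesis using rc car[OF that] by simp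
  qed
  have "app E (?R S) $$ (r, c) = (\<Sum>(i, j)\<in>S. \<rho> $$ (i, j) * app E (ketbra ?s i j) $$ (r, c))"
    if "finite S" "S \<subseteq> {..<?s} \<times> {..<?s}" for S
    using that
  proof (induction S)
    case empty
    \<comment> \<open>Linearity is available through sums and scalar multiples, so the zero matrix
      enters as a multiple by 0.\<close>
    have "?R {} = 0 \<cdot>\<^sub>m 0\<^sub>m ?s ?s" by (rule eq_matI) auto
    then show ?case using scale[of "0\<^sub>m ?s ?s" 0] by simp
  next
    case (insert x S)
    obtain i j where x: "x = (i, j)" by force
    have "?R (insert x S) = \<rho> $$ (i, j) \<cdot>\<^sub>m ketbra ?s i j + ?R S"
      by (rule eq_matI) (use insert.hyps in \<open>auto simp: x\<close>)
    then have "app E (?R (insert x S)) $$ (r, c) = \<rho> $$ (i, j) * app E (ketbra ?s i j) $$ (r, c) + app E (?R S) $$ (r, c)"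
      by (simp add: add scale)
    then show ?case using insert by (simp add: x)
  qed
  from this[of "{..<?s} \<times> {..<?s}"] have "app E (?R ({..<?s} \<times> {..<?s})) $$ (r, c) =
      (\<Sum>i<?s. \<Sum>j<?s. \<rho> $$ (i, j) * app E (ketbra ?s i j) $$ (r, c))"
    by (simp add: sum.cartesian_product)
  moreover have "?R ({..<?s} \<times> {..<?s}) = \<rho>" by (rule eq_matI) (use \<rho> in auto)
  ultimately show ?thesis by simp
qed

lemma krausI:
  assumes E: "linear_qmap E" and I: "finite I" "\<And>k. k \<in> I \<Longrightarrow> K k \<in> carrier_mat (trg E) (src E)"
    and K: "\<And>i j r c. i < src E \<Longrightarrow> j < src E \<Longrightarrow> r < trg E \<Longrightarrow> c < trg E \<Longrightarrow>
      app E (ketbra (src E) i j) $$ (r, c) = (\<Sum>k\<in>I. K k $$ (r, i) * cnj (K k $$ (c, j)))"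
  shows "kraus E I K"
  unfolding kraus_def
proof (intro conjI ballI)
  fix \<rho> :: "complex mat" assume \<rho>: "\<rho> \<in> carrier_mat (src E) (src E)"
  show "app E \<rho> = msum (trg E) I (\<lambda>k. K k * \<rho> * adj (K k))"
  proof (rule eq_matI)
    fix r c assume "r < dim_row (msum (trg E) I (\<lambda>k. K k * \<rho> * adj (K k)))"
      "c < dim_col (msum (trg E) I (\<lambda>k. K k * \<rho> * adj (K k)))"
    then have rc: "r < trg E" "c < trg E" by auto
    have "app E \<rho> $$ (r, c) = (\<Sum>i<src E. \<Sum>j<src E. \<Sum>k\<in>I. K k $$ (r, i) * \<rho> $$ (i, j) * cnj (K k $$ (c, j)))"
      unfolding linear_qmap_expand[OF E \<rho> rc] using rc
      by (intro sum.cong refl) (auto simp: K sum_distrib_left mult_ac intro!: sum.cong)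
    also have "\<dots> = (\<Sum>i<src E. \<Sum>k\<in>I. \<Sum>j<src E. K k $$ (r, i) * \<rho> $$ (i, j) * cnj (K k $$ (c, j)))"
      by (intro sum.cong refl sum.swap)
    also have "\<dots> = (\<Sum>k\<in>I. \<Sum>i<src E. \<Sum>j<src E. K k $$ (r, i) * \<rho> $$ (i, j) * cnj (K k $$ (c, j)))"
      by (rule sum.swap)
    also have "\<dots> = msum (trg E) I (\<lambda>k. K k * \<rho> * adj (K k)) $$ (r, c)"
      using rc \<rho> I by (auto simp: msum_index intro!: sum.cong conj_index[of _ "trg E", symmetric])
    finally show "app E \<rho> $$ (r, c) = msum (trg E) I (\<lambda>k. K k * \<rho> * adj (K k)) $$ (r, c)" .
  qed (use E \<rho> in \<open>auto simp: linear_qmap_def\<close>)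
qed (use I in auto)

lemma kraus_id: "kraus (id_map d) {()} (\<lambda>_. 1\<^sub>m d)"
  unfolding kraus_def by (auto simp: id_map_def msum_def intro!: eq_matI)

lemma linear_comp_map:
  "linear_qmap E \<Longrightarrow> linear_qmap G \<Longrightarrow> src G = trg E \<Longrightarrow> linear_qmap (comp_map G E)"
  by (auto simp: linear_qmap_def comp_map_def)

lemma kraus_comp:
  assumes E: "kraus E I K" and G: "kraus G J L" and eq: "src G = trg E"
  shows "kraus (comp_map G E) (J \<times> I) (\<lambda>(l, k). L l * K k)"
proof (rule krausI)
  have K: "K k \<in> carrier_mat (trg E) (src E)" if "k \<in> I" for k using E that by (simp add: kraus_def)
  have L: "L l \<in> carrier_mat (trg G) (trg E)" if "l \<in> J" for l using G eq that by (simp add: kraus_def)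
  note lin = kraus_imp_linear[OF E] kraus_imp_linear[OF G]
  show "linear_qmap (comp_map G E)" using linear_comp_map[OF lin eq] .
  show "finite (J \<times> I)" using E G by (auto simp: kraus_def)
  show "(case x of (l, k) \<Rightarrow> L l * K k) \<in> carrier_mat (trg (comp_map G E)) (src (comp_map G E))"
    if "x \<in> J \<times> I" for x
    using that by (auto simp: comp_map_def intro!: mult_carrier_mat K L)
  fix i j r c assume "i < src (comp_map G E)" "j < src (comp_map G E)"
    "r < trg (comp_map G E)" "c < trg (comp_map G E)"
  then have a: "i < src E" "j < src E" "r < trg G" "c < trg G" by (auto simp: comp_map_def)
  have "app E (ketbra (src E) i j) \<in> carrier_mat (src G) (src G)"
    using linear_qmap_carrier[OF lin(1)] eq by simp
  then have "app (comp_map G E) (ketbra (src E) i j) $$ (r, c) = (\<Sum>l\<in>J. \<Sum>p<trg E. \<Sum>q<trg E.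
      L l $$ (r, p) * (\<Sum>k\<in>I. K k $$ (p, i) * cnj (K k $$ (q, j))) * cnj (L l $$ (c, q)))"
    using a eq by (simp add: comp_map_def kraus_index[OF G] kraus_ketbra[OF E])
  also have "\<dots> = (\<Sum>l\<in>J. \<Sum>p<trg E. \<Sum>q<trg E. \<Sum>k\<in>I.
      (L l $$ (r, p) * K k $$ (p, i)) * cnj (L l $$ (c, q) * K k $$ (q, j)))"
    by (simp add: sum_distrib_left sum_distrib_right mult_ac)
  also have "\<dots> = (\<Sum>l\<in>J. \<Sum>p<trg E. \<Sum>k\<in>I. \<Sum>q<trg E.
      (L l $$ (r, p) * K k $$ (p, i)) * cnj (L l $$ (c, q) * K k $$ (q, j)))"
    by (intro sum.cong refl sum.swap)
  also have "\<dots> = (\<Sum>l\<in>J. \<Sum>k\<in>I. \<Sum>p<trg E. \<Sum>q<trg E.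
      (L l $$ (r, p) * K k $$ (p, i)) * cnj (L l $$ (c, q) * K k $$ (q, j)))"
    by (intro sum.cong refl sum.swap)
  also have "\<dots> = (\<Sum>l\<in>J. \<Sum>k\<in>I. (L l * K k) $$ (r, i) * cnj ((L l * K k) $$ (c, j)))"
  proof (intro sum.cong refl)
    fix l k assume "l \<in> J" "k \<in> I"
    then have "(L l * K k) $$ (x, y) = (\<Sum>p<trg E. L l $$ (x, p) * K k $$ (p, y))"
      if "x < trg G" "y < src E" for x y
      using K[of k] L[of l] that by (subst mult_mat_index) auto
    then show "(\<Sum>p<trg E. \<Sum>q<trg E. (L l $$ (r, p) * K k $$ (p, i)) * cnj (L l $$ (c, q) * K k $$ (q, j)))
      = (L l * K k) $$ (r, i) * cnj ((L l * K k) $$ (c, j))"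
      using a by (simp add: sum_product del: index_mult_mat(1))
  qed
  finally show "app (comp_map G E) (ketbra (src (comp_map G E)) i j) $$ (r, c) = (\<Sum>x\<in>J \<times> I.
      (case x of (l, k) \<Rightarrow> L l * K k) $$ (r, i) * cnj ((case x of (l, k) \<Rightarrow> L l * K k) $$ (c, j)))"
    by (simp add: comp_map_def sum.cartesian_product' del: index_mult_mat(1))
qed

section \<open>Tensor products and exchange of registers\<close>

lemma tensor_src_trg [simp]: "src (tensor E F) = src E * src F" "trg (tensor E F) = trg E * trg F"
  by (simp_all add: tensor_def)

lemma comp_map_src_trg [simp]: "src (comp_map G E) = src E" "trg (comp_map G E) = trg G"
  by (simp_all add: comp_map_def)

lemma id_map_simps [simp]: "src (id_map d) = d" "trg (id_map d) = d" "app (id_map d) \<rho> = \<rho>"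
  by (simp_all add: id_map_def)

lemma swap_map_src_trg [simp]: "src (swap_map m n) = m * n" "trg (swap_map m n) = n * m"
  by (simp_all add: swap_map_def)

lemma tensor_index:
  assumes "linear_qmap E" "linear_qmap F"
    and "r1 < trg E" "r2 < trg F" "c1 < trg E" "c2 < trg F"
  shows "app (tensor E F) \<rho> $$ (r1 * trg F + r2, c1 * trg F + c2) =
    (\<Sum>i<src E. \<Sum>j<src E. \<Sum>k<src F. \<Sum>l<src F. \<rho> $$ (i * src F + k, j * src F + l) *
      (app E (ketbra (src E) i j) $$ (r1, c1) * app F (ketbra (src F) k l) $$ (r2, c2)))"
proof -
  have c: "app E (ketbra (src E) i j) \<in> carrier_mat (trg E) (trg E)"
    "app F (ketbra (src F) i j) \<in> carrier_mat (trg F) (trg F)" for i j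
    using assms(1,2) by (auto intro!: linear_qmap_carrier)
  have "app (tensor E F) \<rho> $$ (r1 * trg F + r2, c1 * trg F + c2) =
    (\<Sum>x\<in>(({..<src E} \<times> {..<src E}) \<times> ({..<src F} \<times> {..<src F})). case x of ((i, j), (k, l)) \<Rightarrow>
       \<rho> $$ (i * src F + k, j * src F + l) *
      (app E (ketbra (src E) i j) $$ (r1, c1) * app F (ketbra (src F) k l) $$ (r2, c2)))"
    unfolding tensor_def using assms c[THEN carrier_matD(1)] c[THEN carrier_matD(2)]
    by (auto simp: msum_index mult_add_less kron_index intro!: sum.cong)
  then show ?thesis by (simp add: sum.cartesian_product')
qed

lemma tensor_index_ketbra:
  assumes "linear_qmap E" "linear_qmap F"
    and "r1 < trg E" "r2 < trg F" "c1 < trg E" "c2 < trg F"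
    and "i < src E" "j < src E" "k < src F" "l < src F"
  shows "app (tensor E F) (ketbra (src E * src F) (i * src F + k) (j * src F + l)) $$ (r1 * trg F + r2, c1 * trg F + c2)
    = app E (ketbra (src E) i j) $$ (r1, c1) * app F (ketbra (src F) k l) $$ (r2, c2)"
    (is "_ = ?R i j k l")
proof -
  have delta: "(\<Sum>x<m. if P \<and> x = y then R else 0) = (if P then R else (0 :: complex))" if "y < m" for P R and y m :: nat
    using that by (cases P) auto
  \<comment> \<open>The leading \<open>True\<close> gives all four nested conditions the shape
    \<open>P \<and> x = y\<close>, so that \<open>delta\<close> removes the sums from the innermost
    outwards.\<close>
  have "app (tensor E F) (ketbra (src E * src F) (i * src F + k) (j * src F + l)) $$ (r1 * trg F + r2, c1 * trg F + c2)
    = (\<Sum>i'<src E. \<Sum>j'<src E. \<Sum>k'<src F. \<Sum>l'<src F.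
        if (((True \<and> i' = i) \<and> j' = j) \<and> k' = k) \<and> l' = l then ?R i j k l else 0)"
    unfolding tensor_index[OF assms(1-6)]
    using assms by (intro sum.cong refl) (auto simp: mult_add_less mult_add_eq_iff)
  also have "\<dots> = ?R i j k l"
    using assms(7-) by (simp only: delta) simp
  finally show ?thesis .
qed

lemma linear_tensor:
  assumes "linear_qmap E" "linear_qmap F"
  shows "linear_qmap (tensor E F)"
  unfolding linear_qmap_def
proof (intro conjI ballI allI)
  have car: "app (tensor E F) \<rho> \<in> carrier_mat (trg (tensor E F)) (trg (tensor E F))" for \<rho>
    by (simp add: tensor_def)
  then show "app (tensor E F) \<rho> \<in> carrier_mat (trg (tensor E F)) (trg (tensor E F))" for \<rho> .
  fix \<rho> :: "complex mat" assume \<rho>: "\<rho> \<in> carrier_mat (src (tensor E F)) (src (tensor E F))"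
  note dims = car[THEN carrier_matD(1)] car[THEN carrier_matD(2)]
  { fix \<sigma> :: "complex mat" assume \<sigma>: "\<sigma> \<in> carrier_mat (src (tensor E F)) (src (tensor E F))"
    show "app (tensor E F) (\<rho> + \<sigma>) = app (tensor E F) \<rho> + app (tensor E F) \<sigma>"
      by (rule eq_mat_prodI[of _ "trg E" "trg F" "trg E" "trg F"])
        (use \<rho> \<sigma> car in \<open>auto simp: tensor_index[OF assms] dims mult_add_less distrib_right sum.distrib\<close>) }
  show "app (tensor E F) (a \<cdot>\<^sub>m \<rho>) = a \<cdot>\<^sub>m app (tensor E F) \<rho>" for a
    by (rule eq_mat_prodI[of _ "trg E" "trg F" "trg E" "trg F"])
      (use \<rho> car in \<open>auto simp: tensor_index[OF assms] dims mult_add_less sum_distrib_left mult_ac\<close>)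
qed

lemma kraus_tensor:
  assumes E: "kraus E I K" and F: "kraus F J L"
  shows "kraus (tensor E F) (I \<times> J) (\<lambda>(k, l). kron (K k) (L l))"
proof (rule krausI)
  note lin = kraus_imp_linear[OF E] kraus_imp_linear[OF F]
  show "linear_qmap (tensor E F)" using linear_tensor lin .
  show "finite (I \<times> J)" using E F by (simp add: kraus_def)
  show "(\<lambda>(k, l). kron (K k) (L l)) x \<in> carrier_mat (trg (tensor E F)) (src (tensor E F))" if "x \<in> I \<times> J" for x
    using E F that by (auto simp: kraus_def intro!: kron_carrier)
  fix i j r c assume a: "i < src (tensor E F)" "j < src (tensor E F)" "r < trg (tensor E F)" "c < trg (tensor E F)"
  obtain i1 i2 where i: "i1 < src E" "i2 < src F" "i = i1 * src F + i2"
    using a by (auto elim: mult_add_cases)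
  obtain j1 j2 where j: "j1 < src E" "j2 < src F" "j = j1 * src F + j2"
    using a by (auto elim: mult_add_cases)
  obtain r1 r2 where r: "r1 < trg E" "r2 < trg F" "r = r1 * trg F + r2"
    using a by (auto elim: mult_add_cases)
  obtain c1 c2 where c: "c1 < trg E" "c2 < trg F" "c = c1 * trg F + c2"
    using a by (auto elim: mult_add_cases)
  have "app (tensor E F) (ketbra (src (tensor E F)) i j) $$ (r, c)
    = (\<Sum>k\<in>I. K k $$ (r1, i1) * cnj (K k $$ (c1, j1))) * (\<Sum>l\<in>J. L l $$ (r2, i2) * cnj (L l $$ (c2, j2)))"
    using i j r c by (simp add: tensor_index_ketbra[OF lin] kraus_ketbra[OF E] kraus_ketbra[OF F])
  also have "\<dots> = (\<Sum>(k, l)\<in>I \<times> J. kron (K k) (L l) $$ (r, i) * cnj (kron (K k) (L l) $$ (c, j)))"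
    unfolding sum_product sum.cartesian_product
  proof (rule sum.cong[OF refl], clarify)
    fix k l assume "k \<in> I" "l \<in> J"
    then have "K k \<in> carrier_mat (trg E) (src E)" "L l \<in> carrier_mat (trg F) (src F)"
      using E F by (auto simp: kraus_def)
    then show "K k $$ (r1, i1) * cnj (K k $$ (c1, j1)) * (L l $$ (r2, i2) * cnj (L l $$ (c2, j2)))
      = kron (K k) (L l) $$ (r, i) * cnj (kron (K k) (L l) $$ (c, j))"
      using i j r c by (simp add: kron_index)
  qed
  finally show "app (tensor E F) (ketbra (src (tensor E F)) i j) $$ (r, c)
    = (\<Sum>k\<in>I \<times> J. (case k of (k, l) \<Rightarrow> kron (K k) (L l)) $$ (r, i) * cnj ((case k of (k, l) \<Rightarrow> kron (K k) (L l)) $$ (c, j)))"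
    by (simp add: split_def)
qed

definition swap_mat :: "nat \<Rightarrow> nat \<Rightarrow> complex mat" where
  "swap_mat m n = mat (n * m) (m * n) (\<lambda>(r, c). if c = (r mod m) * n + r div m then 1 else 0)"

lemma swap_mat_carrier [simp]: "swap_mat m n \<in> carrier_mat (n * m) (m * n)"
  by (simp add: swap_mat_def)

lemma swap_index_less:
  assumes "r < n * m"
  shows "(r mod m) * n + r div m < m * (n :: nat)"
proof (rule mult_add_less)
  have "0 < m" using assms by (cases m) auto
  then show "r mod m < m" by simp
  show "r div m < n" using assms by (rule less_mult_imp_div_less)
qed

lemma kraus_swap: "kraus (swap_map m n) {()} (\<lambda>_. swap_mat m n)"
  unfolding kraus_def
proof (intro conjI ballI)
  fix \<rho> :: "complex mat" assume \<rho>: "\<rho> \<in> carrier_mat (src (swap_map m n)) (src (swap_map m n))"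
  show "app (swap_map m n) \<rho> = msum (trg (swap_map m n)) {()} (\<lambda>k. swap_mat m n * \<rho> * adj (swap_mat m n))"
    (is "_ = ?R")
  proof (rule eq_matI)
    fix r c assume "r < dim_row ?R" "c < dim_col ?R"
    then have rc: "r < n * m" "c < n * m" by auto
    let ?p = "\<lambda>r. (r mod m) * n + r div m"
    have "?R $$ (r, c) = (\<Sum>i<m * n. \<Sum>j<m * n. swap_mat m n $$ (r, i) * \<rho> $$ (i, j) * cnj (swap_mat m n $$ (c, j)))"
      using rc \<rho> by (simp add: msum_index conj_index[of _ "n * m" "m * n"] del: index_mult_mat(1))
    also have "\<dots> = (\<Sum>i<m * n. \<Sum>j<m * n. \<rho> $$ (i, j) * (if i = ?p r \<and> j = ?p c then 1 else 0) * 1)"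
      using rc by (intro sum.cong refl) (auto simp: swap_mat_def)
    also have "\<dots> = \<rho> $$ (?p r, ?p c)"
      using swap_index_less[OF rc(1)] swap_index_less[OF rc(2)]
      by (subst sum_delta2) auto
    also have "\<dots> = app (swap_map m n) \<rho> $$ (r, c)" using rc by (simp add: swap_map_def)
    finally show "app (swap_map m n) \<rho> $$ (r, c) = ?R $$ (r, c)" by simp
  qed (auto simp: swap_map_def)
qed auto

section \<open>Complete positivity and Choi matrices\<close>

lemma psd_msum:
  assumes "\<And>k. k \<in> I \<Longrightarrow> psd d (F k)"
  shows "psd d (msum d I F)"
  unfolding psd_def
proof (intro conjI ballI)
  have F: "F k \<in> carrier_mat d d" "adj (F k) = F k" "\<And>x. x \<in> carrier_vec d \<Longrightarrow> 0 \<le> (F k *\<^sub>v x) \<bullet>c x"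
    if "k \<in> I" for k
    using assms[OF that] by (auto simp: psd_def)
  show "msum d I F \<in> carrier_mat d d" by simp
  show "adj (msum d I F) = msum d I F"
  proof (rule eq_matI)
    fix i j assume "i < dim_row (msum d I F)" "j < dim_col (msum d I F)"
    then have ij: "i < d" "j < d" by auto
    have "cnj (F k $$ (j, i)) = F k $$ (i, j)" if "k \<in> I" for k
      using arg_cong[OF F(2)[OF that], of "\<lambda>M. M $$ (i, j)"] F(1)[OF that] ij by auto
    then show "adj (msum d I F) $$ (i, j) = msum d I F $$ (i, j)"
      using ij by (simp add: msum_index)
  qed auto
  fix x :: "complex vec" assume x: "x \<in> carrier_vec d"
  have form: "(M *\<^sub>v x) \<bullet>c x = (\<Sum>i<d. \<Sum>j<d. M $$ (i, j) * x $ j * cnj (x $ i))" if "M \<in> carrier_mat d d" for M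
    using that x by (simp add: scalar_prod_def atLeast0LessThan sum_distrib_right conjugate_complex_def)
  have "(msum d I F *\<^sub>v x) \<bullet>c x = (\<Sum>i<d. \<Sum>j<d. \<Sum>k\<in>I. F k $$ (i, j) * x $ j * cnj (x $ i))"
    by (simp add: form msum_index sum_distrib_right)
  also have "\<dots> = (\<Sum>i<d. \<Sum>k\<in>I. \<Sum>j<d. F k $$ (i, j) * x $ j * cnj (x $ i))"
    by (intro sum.cong refl sum.swap)
  also have "\<dots> = (\<Sum>k\<in>I. (F k *\<^sub>v x) \<bullet>c x)"
    by (subst sum.swap) (simp add: form F)
  also have "0 \<le> \<dots>" using F(3)[OF _ x] by (rule sum_nonneg)
  finally show "0 \<le> (msum d I F *\<^sub>v x) \<bullet>c x" .
qed

lemma kraus_psd: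
  assumes "kraus E I K" "psd (src E) \<rho>"
  shows "psd (trg E) (app E \<rho>)"
proof -
  have "\<rho> \<in> carrier_mat (src E) (src E)" using assms(2) by (simp add: psd_def)
  then have "app E \<rho> = msum (trg E) I (\<lambda>k. K k * \<rho> * adj (K k))" using assms(1) by (simp add: kraus_def)
  moreover have "psd (trg E) (K k * \<rho> * adj (K k))" if "k \<in> I" for k
    using assms that by (intro psd_congruence) (auto simp: kraus_def)
  ultimately show ?thesis using psd_msum[of I "trg E" "\<lambda>k. K k * \<rho> * adj (K k)"] by simp
qed

text \<open>Tensoring with the identity keeps a Kraus form, and every map in Kraus form preserves
  positivity.\<close>

lemma kraus_imp_cp:
  assumes "kraus E I K"
  shows "completely_positive E"
  unfolding completely_positive_def
proof (intro allI impI)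
  fix k \<rho> assume "psd (k * src E) \<rho>"
  then show "psd (k * trg E) (app (tensor (id_map k) E) \<rho>)"
    using kraus_psd[OF kraus_tensor[OF kraus_id[of k] assms], of \<rho>] by simp
qed

text \<open>The hypothesis describes \<open>q\<close> times the unnormalised maximally entangled
  state, so the output is \<open>q\<close> times the Choi matrix. The factor is 1 in the proof of
  Choi's theorem and \<open>1 / d\<close> for the uniform purified input.\<close>

lemma choi_index:
  assumes E: "linear_qmap E"
    and \<rho>: "\<And>i j k l. i < src E \<Longrightarrow> k < src E \<Longrightarrow> j < src E \<Longrightarrow> l < src E \<Longrightarrow>
      \<rho> $$ (i * src E + k, j * src E + l) = q * (if k = i \<and> l = j then 1 else 0)"
    and a: "i < src E" "j < src E" "r < trg E" "c < trg E"
  shows "app (tensor (id_map (src E)) E) \<rho> $$ (i * trg E + r, j * trg E + c)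
    = q * app E (ketbra (src E) i j) $$ (r, c)"
proof -
  let ?s = "src E"
  have lin_id: "linear_qmap (id_map ?s)" by (rule kraus_imp_linear[OF kraus_id])
  have "app (tensor (id_map ?s) E) \<rho> $$ (i * trg E + r, j * trg E + c) =
    (\<Sum>i'<?s. \<Sum>j'<?s. \<Sum>k<?s. \<Sum>l<?s. \<rho> $$ (i' * ?s + k, j' * ?s + l) *
      (ketbra ?s i' j' $$ (i, j) * app E (ketbra ?s k l) $$ (r, c)))"
    using tensor_index[OF lin_id E, of i r j c] a by simp
  also have "\<dots> = (\<Sum>i'<?s. \<Sum>j'<?s. q * (if i' = i \<and> j' = j then 1 else 0) * app E (ketbra ?s i' j') $$ (r, c))"
  proof (intro sum.cong refl)
    fix i' j' assume ij: "i' \<in> {..<?s}" "j' \<in> {..<?s}"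
    have "(\<Sum>k<?s. \<Sum>l<?s. \<rho> $$ (i' * ?s + k, j' * ?s + l) * (ketbra ?s i' j' $$ (i, j) * app E (ketbra ?s k l) $$ (r, c)))
      = (\<Sum>k<?s. \<Sum>l<?s. q * ketbra ?s i' j' $$ (i, j) * (if k = i' \<and> l = j' then 1 else 0) * app E (ketbra ?s k l) $$ (r, c))"
      using ij by (intro sum.cong refl) (simp add: \<rho>)
    also have "\<dots> = q * ketbra ?s i' j' $$ (i, j) * app E (ketbra ?s i' j') $$ (r, c)"
      using ij by (subst sum_delta2) auto
    finally show "(\<Sum>k<?s. \<Sum>l<?s. \<rho> $$ (i' * ?s + k, j' * ?s + l) * (ketbra ?s i' j' $$ (i, j) * app E (ketbra ?s k l) $$ (r, c)))
      = q * (if i' = i \<and> j' = j then 1 else 0) * app E (ketbra ?s i' j') $$ (r, c)"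
      using a by auto
  qed
  also have "\<dots> = q * app E (ketbra ?s i j) $$ (r, c)" using a by (subst sum_delta2) auto
  finally show ?thesis .
qed

text \<open>Choi's theorem: complete positivity makes the Choi matrix \<open>J\<close> positive
  semidefinite, and each column of its square root, reshaped into a \<open>trg E\<close> by
  \<open>src E\<close> matrix, is a Kraus operator.\<close>

lemma cp_imp_kraus:
  assumes "linear_qmap E" "completely_positive E"
  obtains K :: "nat \<Rightarrow> complex mat" and N where "kraus E {..<N} K"
proof -
  let ?s = "src E" and ?t = "trg E"
  define v where "v = mat (?s * ?s) 1 (\<lambda>(x, y). if x div ?s = x mod ?s then 1 else 0 :: complex)"
  have v: "v $$ (i * ?s + k, 0) = (if i = k then 1 else 0)" if "i < ?s" "k < ?s" for i k
    using that by (simp add: v_def mult_add_less)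
  define \<Omega> where "\<Omega> = v * adj v"
  have vc: "v \<in> carrier_mat (?s * ?s) 1" by (simp add: v_def)
  have psd: "psd (?s * ?s) \<Omega>" unfolding \<Omega>_def by (rule psd_mult_adj) (rule vc)
  have \<Omega>: "\<Omega> $$ (i * ?s + k, j * ?s + l) = (if k = i \<and> l = j then 1 else 0)"
    if "i < ?s" "k < ?s" "j < ?s" "l < ?s" for i j k l
    using vc that unfolding \<Omega>_def
    by (subst mult_mat_index) (auto simp: mult_add_less v)
  define J where "J = app (tensor (id_map ?s) E) \<Omega>"
  have "psd (?s * ?t) J" using assms(2) psd by (simp add: completely_positive_def J_def)
  then obtain B where B: "psd (?s * ?t) B" "B * B = J" using psd_root by blast
  have Bc: "B \<in> carrier_mat (?s * ?t) (?s * ?t)" "adj B = B" using B(1) by (auto simp: psd_def)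
  define K where "K k = mat ?t ?s (\<lambda>(r, i). B $$ (i * ?t + r, k))" for k
  have "kraus E {..<?s * ?t} K"
  proof (rule krausI[OF assms(1)])
    fix i j r c assume a: "i < ?s" "j < ?s" "r < ?t" "c < ?t"
    have 1: "app E (ketbra ?s i j) $$ (r, c) = J $$ (i * ?t + r, j * ?t + c)"
      unfolding J_def using choi_index[OF assms(1), where \<rho> = \<Omega> and q = 1] \<Omega> a by simp
    have "J $$ (i * ?t + r, j * ?t + c) = (\<Sum>k<?s * ?t. B $$ (i * ?t + r, k) * B $$ (k, j * ?t + c))"
      using Bc a unfolding B(2)[symmetric] by (subst mult_mat_index) (auto simp: mult_add_less)
    also have "\<dots> = (\<Sum>k<?s * ?t. K k $$ (r, i) * cnj (K k $$ (c, j)))"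
    proof (intro sum.cong refl)
      fix k assume "k \<in> {..<?s * ?t}"
      then show "B $$ (i * ?t + r, k) * B $$ (k, j * ?t + c) = K k $$ (r, i) * cnj (K k $$ (c, j))"
        using Bc(1) a arg_cong[OF Bc(2), of "\<lambda>M. M $$ (k, j * ?t + c)"] by (simp add: K_def mult_add_less)
    qed
    finally show "app E (ketbra ?s i j) $$ (r, c) = (\<Sum>k<?s * ?t. K k $$ (r, i) * cnj (K k $$ (c, j)))"
      using 1 by simp
  qed (auto simp: K_def)
  then show thesis using that by blast
qed

section \<open>Trace preservation in Kraus form\<close>

lemma tr_ketbra: "i < d \<Longrightarrow> j < d \<Longrightarrow> tr (ketbra d i j) = (if i = j then 1 else 0)"
  by (auto simp: tr_def ketbra_def)

text \<open>This is the completeness relation of a trace-preserving map; equivalently, the operators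
  stacked on top of each other form an isometry.\<close>

definition isometric :: "nat \<Rightarrow> 'i set \<Rightarrow> ('i \<Rightarrow> complex mat) \<Rightarrow> bool" where
  "isometric s I K \<longleftrightarrow> (\<forall>i<s. \<forall>j<s. (\<Sum>k\<in>I. (adj (K k) * K k) $$ (i, j)) = (if i = j then 1 else 0))"

lemma kraus_trace:
  assumes "kraus E I K" "i < src E" "j < src E"
  shows "tr (app E (ketbra (src E) i j)) = (\<Sum>k\<in>I. (adj (K k) * K k) $$ (j, i))"
proof -
  have K: "K k \<in> carrier_mat (trg E) (src E)" if "k \<in> I" for k using assms that by (simp add: kraus_def)
  have "tr (app E (ketbra (src E) i j)) = (\<Sum>r<trg E. app E (ketbra (src E) i j) $$ (r, r))"
    using linear_qmap_carrier[OF kraus_imp_linear[OF assms(1)], of "ketbra (src E) i j"] by (simp add: tr_def)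
  also have "\<dots> = (\<Sum>k\<in>I. \<Sum>r<trg E. cnj (K k $$ (r, j)) * K k $$ (r, i))"
    using assms by (subst sum.swap) (simp add: kraus_ketbra mult.commute)
  also have "\<dots> = (\<Sum>k\<in>I. (adj (K k) * K k) $$ (j, i))"
  proof (rule sum.cong[OF refl])
    fix k assume "k \<in> I"
    then show "(\<Sum>r<trg E. cnj (K k $$ (r, j)) * K k $$ (r, i)) = (adj (K k) * K k) $$ (j, i)"
      using K[of k] assms by (subst mult_mat_index) auto
  qed
  finally show ?thesis .
qed

lemma kraus_isometric:
  assumes "kraus E I K" "trace_preserving E"
  shows "isometric (src E) I K"
  unfolding isometric_def
  using assms by (auto simp: kraus_trace[symmetric] trace_preserving_def tr_ketbra)

lemma tr_expand:
  assumes "linear_qmap E" "\<rho> \<in> carrier_mat (src E) (src E)"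
  shows "tr (app E \<rho>) = (\<Sum>i<src E. \<Sum>j<src E. \<rho> $$ (i, j) * tr (app E (ketbra (src E) i j)))"
proof -
  have c: "dim_row (app E (ketbra (src E) i j)) = trg E" for i j
    using linear_qmap_carrier[OF assms(1), of "ketbra (src E) i j"] by simp
  have "tr (app E \<rho>) = (\<Sum>r<trg E. \<Sum>i<src E. \<Sum>j<src E. \<rho> $$ (i, j) * app E (ketbra (src E) i j) $$ (r, r))"
    using linear_qmap_carrier[OF assms] by (simp add: tr_def linear_qmap_expand[OF assms])
  then show ?thesis
    by (simp add: tr_def c sum_distrib_left sum.swap[of _ _ "{..<trg E}"])
qed

lemma trace_preservingI:
  assumes "linear_qmap E"
    and "\<And>i j. i < src E \<Longrightarrow> j < src E \<Longrightarrow> tr (app E (ketbra (src E) i j)) = (if i = j then 1 else 0)"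
  shows "trace_preserving E"
  unfolding trace_preserving_def
proof
  fix \<rho> :: "complex mat" assume \<rho>: "\<rho> \<in> carrier_mat (src E) (src E)"
  have "tr (app E \<rho>) = (\<Sum>i<src E. \<Sum>j<src E. \<rho> $$ (i, j) * (if i = j then 1 else 0))"
    unfolding tr_expand[OF assms(1) \<rho>] using assms(2) by (intro sum.cong) auto
  also have "\<dots> = (\<Sum>i<src E. \<rho> $$ (i, i))"
    by (intro sum.cong refl) (simp add: if_distrib cong: if_cong)
  finally show "tr (app E \<rho>) = tr \<rho>" using \<rho> by (simp add: tr_def)
qed

lemma isometric_imp_cptp:
  assumes "kraus E I K" "isometric (src E) I K"
  shows "cptp E"
  unfolding cptp_def
  using assms kraus_imp_linear[OF assms(1)] kraus_imp_cp[OF assms(1)]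
  by (auto intro!: trace_preservingI simp: kraus_trace isometric_def)

lemma trace_preserving_comp:
  assumes "linear_qmap E" "trace_preserving E" "trace_preserving G" "src G = trg E"
  shows "trace_preserving (comp_map G E)"
  using assms linear_qmap_carrier[OF assms(1)] by (simp add: trace_preserving_def comp_map_def)

lemma trace_preserving_tensor:
  assumes E: "linear_qmap E" "trace_preserving E" and F: "linear_qmap F" "trace_preserving F"
  shows "trace_preserving (tensor E F)"
proof (rule trace_preservingI)
  show lin: "linear_qmap (tensor E F)" using linear_tensor E F by blast
  fix x y assume a: "x < src (tensor E F)" "y < src (tensor E F)"
  obtain i k where x: "i < src E" "k < src F" "x = i * src F + k"
    using a by (auto elim: mult_add_cases)
  obtain j l where y: "j < src E" "l < src F" "y = j * src F + l"
    using a by (auto elim: mult_add_cases)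
  have c: "app E (ketbra (src E) i j) \<in> carrier_mat (trg E) (trg E)"
    "app F (ketbra (src F) k l) \<in> carrier_mat (trg F) (trg F)"
    using E F by (auto intro!: linear_qmap_carrier)
  have "app (tensor E F) (ketbra (src (tensor E F)) x y) = kron (app E (ketbra (src E) i j)) (app F (ketbra (src F) k l))"
    using linear_qmap_carrier[OF lin, of "ketbra (src (tensor E F)) x y"] c x y
    by (intro eq_mat_prodI[of _ "trg E" "trg F" "trg E" "trg F"])
      (auto simp: tensor_index_ketbra[OF E(1) F(1)] kron_index intro: kron_carrier)
  then have "tr (app (tensor E F) (ketbra (src (tensor E F)) x y)) = tr (ketbra (src E) i j) * tr (ketbra (src F) k l)"
    using c E F by (simp add: tr_kron trace_preserving_def)
  moreover have "x = y \<longleftrightarrow> i = j \<and> k = l" using x y by (simp add: mult_add_eq_iff)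
  ultimately show "tr (app (tensor E F) (ketbra (src (tensor E F)) x y)) = (if x = y then 1 else 0)"
    using x y by (simp add: tr_ketbra)
qed

lemma trace_preserving_id: "trace_preserving (id_map d)"
  by (simp add: trace_preserving_def)

lemma trace_preserving_swap: "trace_preserving (swap_map m n)"
  unfolding trace_preserving_def
proof
  fix \<rho> :: "complex mat" assume \<rho>: "\<rho> \<in> carrier_mat (src (swap_map m n)) (src (swap_map m n))"
  have "tr (app (swap_map m n) \<rho>) = (\<Sum>j<n. \<Sum>i<m. \<rho> $$ (i * n + j, i * n + j))"
    by (simp add: tr_def swap_map_def sum_lessThan_mult mult_add_less)
  also have "\<dots> = tr \<rho>"
    using \<rho> by (subst sum.swap) (simp add: tr_def sum_lessThan_mult)
  finally show "tr (app (swap_map m n) \<rho>) = tr \<rho>" .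
qed

section \<open>Bras and stacked matrices\<close>

definition bra :: "nat \<Rightarrow> nat \<Rightarrow> complex mat" where
  "bra d j = mat 1 d (\<lambda>(r, c). if c = j then 1 else 0)"

definition ket :: "nat \<Rightarrow> nat \<Rightarrow> complex mat" where
  "ket d j = mat d 1 (\<lambda>(r, c). if r = j then 1 else 0)"

lemmas kron_Suc_0_left [simp] = kron_one_left[unfolded One_nat_def]

lemma kron_one_right [simp]: "kron A (1\<^sub>m 1) = A"
  by (rule eq_matI) (auto simp: kron_def)

lemmas kron_Suc_0_right [simp] = kron_one_right[unfolded One_nat_def]

lemma bra_carrier [simp]: "bra d j \<in> carrier_mat 1 d" by (simp add: bra_def)
lemma ket_carrier [simp]: "ket d j \<in> carrier_mat d 1" by (simp add: ket_def)
lemma bra_dim [simp]: "dim_row (bra d j) = 1" "dim_col (bra d j) = d" by (simp_all add: bra_def)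
lemma ket_dim [simp]: "dim_row (ket d j) = d" "dim_col (ket d j) = 1" by (simp_all add: ket_def)

lemma kron_bra:
  assumes "j < n"
  shows "kron (bra m i) (bra n j) = bra (m * n) (i * n + j)"
proof (rule eq_mat_prodI[of _ 1 1 m n])
  fix r s k l assume *: "r < (1::nat)" "s < (1::nat)" "k < m" "l < n"
  have "kron (bra m i) (bra n j) $$ (r * 1 + s, k * n + l) = bra m i $$ (r, k) * bra n j $$ (s, l)"
    using * by (intro kron_index) auto
  then show "kron (bra m i) (bra n j) $$ (r * 1 + s, k * n + l) = bra (m * n) (i * n + j) $$ (r * 1 + s, k * n + l)"
    using * assms by (auto simp: bra_def mult_add_less mult_add_eq_iff)
qed (auto simp: bra_def kron_def)

lemma bra_left_index:
  assumes "M \<in> carrier_mat (e * D) m" "a < e" "r < D" "c < m"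
  shows "(kron (bra e a) (1\<^sub>m D) * M) $$ (r, c) = M $$ (a * D + r, c)"
proof -
  have "(kron (bra e a) (1\<^sub>m D) * M) $$ (r, c)
    = (\<Sum>x<e. \<Sum>y<D. kron (bra e a) (1\<^sub>m D) $$ (0 * D + r, x * D + y) * M $$ (x * D + y, c))"
    using assms by (subst mult_mat_index) (auto simp: sum_lessThan_mult)
  also have "\<dots> = (\<Sum>x<e. \<Sum>y<D. 1 * (if x = a \<and> y = r then 1 else 0) * M $$ (x * D + y, c))"
    using assms by (intro sum.cong refl) (subst kron_index, auto simp: bra_def)
  also have "\<dots> = M $$ (a * D + r, c)" using assms by (subst sum_delta2) auto
  finally show ?thesis .
qed

lemma bra_right_index:
  assumes "M \<in> carrier_mat (D * e) m" "b < e" "r < D" "c < m"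
  shows "(kron (1\<^sub>m D) (bra e b) * M) $$ (r, c) = M $$ (r * e + b, c)"
proof -
  have "(kron (1\<^sub>m D) (bra e b) * M) $$ (r, c)
    = (\<Sum>x<D. \<Sum>y<e. kron (1\<^sub>m D) (bra e b) $$ (r * 1 + 0, x * e + y) * M $$ (x * e + y, c))"
    using assms by (subst mult_mat_index) (auto simp: sum_lessThan_mult)
  also have "\<dots> = (\<Sum>x<D. \<Sum>y<e. 1 * (if x = r \<and> y = b then 1 else 0) * M $$ (x * e + y, c))"
    using assms by (intro sum.cong refl) (subst kron_index, auto simp: bra_def)
  also have "\<dots> = M $$ (r * e + b, c)" using assms by (subst sum_delta2) auto
  finally show ?thesis .
qed

text \<open>The Stinespring isometry of the family \<open>K\<close>, with the environment as the
  left factor of the output; in \<open>stack_right\<close> it is the right factor.\<close>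

definition stack_left :: "nat \<Rightarrow> nat \<Rightarrow> nat \<Rightarrow> (nat \<Rightarrow> complex mat) \<Rightarrow> complex mat" where
  "stack_left n t s K = mat (n * t) s (\<lambda>(r, c). K (r div t) $$ (r mod t, c))"

definition stack_right :: "nat \<Rightarrow> nat \<Rightarrow> nat \<Rightarrow> (nat \<Rightarrow> complex mat) \<Rightarrow> complex mat" where
  "stack_right n t s K = mat (t * n) s (\<lambda>(r, c). K (r mod n) $$ (r div n, c))"

lemma stack_dim [simp]:
  "dim_row (stack_left n t s K) = n * t" "dim_col (stack_left n t s K) = s"
  "dim_row (stack_right n t s K) = t * n" "dim_col (stack_right n t s K) = s"
  by (simp_all add: stack_left_def stack_right_def)

lemma stack_left_index:
  "k < n \<Longrightarrow> r < t \<Longrightarrow> c < s \<Longrightarrow> stack_left n t s K $$ (k * t + r, c) = K k $$ (r, c)"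
  by (simp add: stack_left_def mult_add_less)

lemma stack_right_index:
  "k < n \<Longrightarrow> r < t \<Longrightarrow> c < s \<Longrightarrow> stack_right n t s K $$ (r * n + k, c) = K k $$ (r, c)"
  by (simp add: stack_right_def mult_add_less)

lemma bra_stack_left:
  assumes "K k \<in> carrier_mat t s" "k < n"
  shows "kron (bra n k) (1\<^sub>m t) * stack_left n t s K = K k"
proof (rule eq_matI)
  fix r c assume "r < dim_row (K k)" "c < dim_col (K k)"
  then have "r < t" "c < s" using assms by auto
  then show "(kron (bra n k) (1\<^sub>m t) * stack_left n t s K) $$ (r, c) = K k $$ (r, c)"
    using assms by (subst bra_left_index[of _ n t s]) (auto simp: stack_left_index intro: carrier_matI)
qed (use assms in auto)

lemma bra_stack_right:
  assumes "K k \<in> carrier_mat t s" "k < n"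
  shows "kron (1\<^sub>m t) (bra n k) * stack_right n t s K = K k"
proof (rule eq_matI)
  fix r c assume "r < dim_row (K k)" "c < dim_col (K k)"
  then have "r < t" "c < s" using assms by auto
  then show "(kron (1\<^sub>m t) (bra n k) * stack_right n t s K) $$ (r, c) = K k $$ (r, c)"
    using assms by (subst bra_right_index[of _ t n s]) (auto simp: stack_right_index intro: carrier_matI)
qed (use assms in auto)

lemma isometric_index:
  assumes "isometric s I K" "\<And>k. k \<in> I \<Longrightarrow> K k \<in> carrier_mat t s" "i < s" "j < s"
  shows "(\<Sum>k\<in>I. \<Sum>r<t. cnj (K k $$ (r, i)) * K k $$ (r, j)) = (if i = j then 1 else 0)"
proof -
  have "(\<Sum>k\<in>I. (adj (K k) * K k) $$ (i, j)) = (\<Sum>k\<in>I. \<Sum>r<t. cnj (K k $$ (r, i)) * K k $$ (r, j))"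
  proof (rule sum.cong[OF refl])
    fix k assume "k \<in> I"
    then show "(adj (K k) * K k) $$ (i, j) = (\<Sum>r<t. cnj (K k $$ (r, i)) * K k $$ (r, j))"
      using assms(2)[of k] assms(3,4) by (subst mult_mat_index) auto
  qed
  then show ?thesis using assms by (simp add: isometric_def)
qed

text \<open>For a stacked matrix \<open>V\<close>, the product \<open>adj V * V\<close> is the sum
  of all \<open>adj (K k) * K k\<close>, whichever side the environment is on; only the order of
  summation differs.\<close>

lemma stack_isometry:
  assumes "isometric s {..<n} K" "\<And>k. k < n \<Longrightarrow> K k \<in> carrier_mat t s"
  shows "adj (stack_left n t s K) * stack_left n t s K = 1\<^sub>m s" (is "?L")
    and "adj (stack_right n t s K) * stack_right n t s K = 1\<^sub>m s" (is "?R")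
proof -
  have eq: "(\<Sum>k<n. \<Sum>r<t. cnj (K k $$ (r, i)) * K k $$ (r, j)) = 1\<^sub>m s $$ (i, j)" if "i < s" "j < s" for i j
    using isometric_index[OF assms(1), of t i j] assms(2) that by simp
  show ?L
  proof (rule eq_matI)
    fix i j assume "i < dim_row (1\<^sub>m s :: complex mat)" "j < dim_col (1\<^sub>m s :: complex mat)"
    then show "(adj (stack_left n t s K) * stack_left n t s K) $$ (i, j) = 1\<^sub>m s $$ (i, j)"
      by (subst mult_mat_index) (auto simp: sum_lessThan_mult stack_left_index mult_add_less eq
          simp del: index_one_mat(1))
  qed auto
  show ?R
  proof (rule eq_matI)
    fix i j assume *: "i < dim_row (1\<^sub>m s :: complex mat)" "j < dim_col (1\<^sub>m s :: complex mat)"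
    then have "(adj (stack_right n t s K) * stack_right n t s K) $$ (i, j)
      = (\<Sum>r<t. \<Sum>k<n. cnj (K k $$ (r, i)) * K k $$ (r, j))"
      by (subst mult_mat_index) (auto simp: sum_lessThan_mult stack_right_index mult_add_less)
    then show "(adj (stack_right n t s K) * stack_right n t s K) $$ (i, j) = 1\<^sub>m s $$ (i, j)"
      using eq[of i j] * by (subst (asm) sum.swap) simp
  qed auto
qed

section \<open>Trajectories of an execution\<close>

definition conj_map :: "complex mat \<Rightarrow> qmap" where
  "conj_map W = \<lparr>src = dim_col W, trg = dim_row W, app = (\<lambda>\<rho>. W * \<rho> * adj W)\<rparr>"

lemma conj_map_src_trg [simp]: "src (conj_map W) = dim_col W" "trg (conj_map W) = dim_row W"
  by (simp_all add: conj_map_def)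

text \<open>A one-element set of naturals is the index set because players' Kraus indices are
  naturals below a bound per round. A player with isometric operations then has the constant bound
  \<open>Suc 0\<close> and the single index sequence 0.\<close>

lemma kraus_conj_map: "kraus (conj_map W) {..<Suc 0} (\<lambda>_. W)"
  unfolding kraus_def
  by (auto simp: conj_map_def msum_def intro!: carrier_matI eq_matI simp del: index_mult_mat(1))

lemma cptp_conj_map:
  assumes "adj W * W = 1\<^sub>m (dim_col W)"
  shows "cptp (conj_map W)"
  by (rule isometric_imp_cptp[OF kraus_conj_map]) (simp add: isometric_def assms del: index_mult_mat(1))

lemma kraus_reindex:
  assumes "kraus E I K" "bij_betw g J I" "\<And>j. j \<in> J \<Longrightarrow> L j = K (g j)"
  shows "kraus E J L"
  unfolding kraus_def
proof (intro conjI ballI)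
  have g: "g j \<in> I" if "j \<in> J" for j using assms(2) that by (auto simp: bij_betw_def)
  show "finite J" using assms(1,2) bij_betw_finite by (auto simp: kraus_def)
  show "L j \<in> carrier_mat (trg E) (src E)" if "j \<in> J" for j
    using assms(1) assms(3)[OF that] g[OF that] by (simp add: kraus_def)
  fix \<rho> :: "complex mat" assume "\<rho> \<in> carrier_mat (src E) (src E)"
  then have "app E \<rho> = msum (trg E) I (\<lambda>k. K k * \<rho> * adj (K k))" using assms(1) by (simp add: kraus_def)
  also have "\<dots> = msum (trg E) J (\<lambda>j. L j * \<rho> * adj (L j))"
    unfolding msum_def using assms(3)
    by (simp add: sum.reindex_bij_betw[OF assms(2), symmetric])
  finally show "app E \<rho> = msum (trg E) J (\<lambda>j. L j * \<rho> * adj (L j))" .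
qed

text \<open>This is the number of sequences of Kraus indices for the rounds before \<open>i\<close>,
  and at the same time the dimension of the environment that a purified player has collected by
  then.\<close>

definition env_dim :: "(nat \<Rightarrow> nat) \<Rightarrow> nat \<Rightarrow> nat" where
  "env_dim n i = (\<Prod>j<i. n j)"

lemma env_dim_simps [simp]: "env_dim n 0 = 1" "env_dim n (Suc i) = env_dim n i * n i"
  by (simp_all add: env_dim_def)

lemma trajectory_digits:
  assumes "a < env_dim nA (Suc i)" "b < env_dim nB (Suc i)"
  shows "a div nA i < env_dim nA i" "a mod nA i < nA i"
    "b mod env_dim nB i < env_dim nB i" "b div env_dim nB i < nB i"
proof -
  have lt: "a < env_dim nA i * nA i" "b < nB i * env_dim nB i" using assms by (simp_all add: mult.commute)
  then show "a div nA i < env_dim nA i" "b div env_dim nB i < nB i" by (simp_all add: less_mult_imp_div_less)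
  have "0 < nA i" "0 < env_dim nB i" using lt by (auto intro: Nat.gr0I)
  then show "a mod nA i < nA i" "b mod env_dim nB i < env_dim nB i" by simp_all
qed

definition exchange :: "protocol \<Rightarrow> player \<Rightarrow> player \<Rightarrow> nat \<Rightarrow> complex mat" where
  "exchange \<pi> A B i = kron (1\<^sub>m (mem A i)) (kron (swap_mat (to_bob \<pi> i) (to_alice \<pi> i)) (1\<^sub>m (mem B i)))"

text \<open>
  Given Kraus operators \<open>KA i k\<close>, \<open>k < nA i\<close>, and \<open>KB i l\<close>, \<open>l < nB i\<close>, of the players' operations,
  \<open>traj\<close> is the Kraus operator of the execution that belongs to the sequences \<open>a\<close> and \<open>b\<close> of Kraus
  indices, encoded as mixed radix numerals; the newest digit is the least significant digit
  of \<open>a\<close> and the most significant digit of \<open>b\<close>.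
\<close>

primrec traj :: "protocol \<Rightarrow> player \<Rightarrow> (nat \<Rightarrow> nat) \<Rightarrow> (nat \<Rightarrow> nat \<Rightarrow> complex mat) \<Rightarrow>
    player \<Rightarrow> (nat \<Rightarrow> nat) \<Rightarrow> (nat \<Rightarrow> nat \<Rightarrow> complex mat) \<Rightarrow> nat \<Rightarrow> nat \<Rightarrow> nat \<Rightarrow> complex mat" where
  "traj \<pi> A nA KA B nB KB 0 a b = 1\<^sub>m (mem A 0 * mem B 0)"
| "traj \<pi> A nA KA B nB KB (Suc i) a b =
     exchange \<pi> A B (Suc i) * (kron (KA i (a mod nA i)) (KB i (b div env_dim nB i)) *
       traj \<pi> A nA KA B nB KB i (a div nA i) (b mod env_dim nB i))"

text \<open>Fixes a Kraus family for every operation of a strategy, so that trajectories can be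
  formed.\<close>

definition alice_kraus :: "protocol \<Rightarrow> player \<Rightarrow> (nat \<Rightarrow> nat) \<Rightarrow> (nat \<Rightarrow> nat \<Rightarrow> complex mat) \<Rightarrow> bool" where
  "alice_kraus \<pi> A n K \<longleftrightarrow> (\<forall>i<rounds \<pi>. kraus (act A i) {..<n i} (K i) \<and>
     isometric (src (act A i)) {..<n i} (K i) \<and>
     src (act A i) = mem A i * to_alice \<pi> i \<and> trg (act A i) = mem A (Suc i) * to_bob \<pi> (Suc i))"

definition bob_kraus :: "protocol \<Rightarrow> player \<Rightarrow> (nat \<Rightarrow> nat) \<Rightarrow> (nat \<Rightarrow> nat \<Rightarrow> complex mat) \<Rightarrow> bool" where
  "bob_kraus \<pi> B n K \<longleftrightarrow> (\<forall>i<rounds \<pi>. kraus (act B i) {..<n i} (K i) \<and>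
     isometric (src (act B i)) {..<n i} (K i) \<and>
     src (act B i) = to_bob \<pi> i * mem B i \<and> trg (act B i) = to_alice \<pi> (Suc i) * mem B (Suc i))"

lemma cptp_kraus:
  assumes "cptp E"
  shows "\<exists>(N :: nat) K. kraus E {..<N} K \<and> isometric (src E) {..<N} K"
  using assms cp_imp_kraus[of E] kraus_isometric unfolding cptp_def by metis

lemma cptp_kraus_choice:
  assumes "\<forall>i<n. cptp (E i)"
  shows "\<exists>(N :: nat \<Rightarrow> nat) K. \<forall>i<n. kraus (E i) {..<N i} (K i) \<and> isometric (src (E i)) {..<N i} (K i)"
proof -
  have "\<forall>i. \<exists>p. i < n \<longrightarrow> kraus (E i) {..<fst p :: nat} (snd p) \<and> isometric (src (E i)) {..<fst p} (snd p)"
    using assms cptp_kraus by fastforce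
  then obtain p where "\<forall>i<n. kraus (E i) {..<fst (p i) :: nat} (snd (p i)) \<and> isometric (src (E i)) {..<fst (p i)} (snd (p i))"
    by metis
  then show ?thesis by (intro exI[of _ "\<lambda>i. fst (p i)"] exI[of _ "\<lambda>i. snd (p i)"])
qed

lemma alice_strategy_kraus:
  assumes "alice_strategy \<pi> d A"
  obtains n K where "alice_kraus \<pi> A n K"
proof -
  have "\<forall>i<rounds \<pi>. cptp (act A i)" using assms by (simp add: alice_strategy_def)
  then show thesis using cptp_kraus_choice[of "rounds \<pi>" "act A"] that assms
    unfolding alice_kraus_def alice_strategy_def by metis
qed

lemma bob_strategy_kraus:
  assumes "bob_strategy \<pi> d A"
  obtains n K where "bob_kraus \<pi> A n K"
proof -
  have "\<forall>i<rounds \<pi>. cptp (act A i)" using assms by (simp add: bob_strategy_def)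
  then show thesis using cptp_kraus_choice[of "rounds \<pi>" "act A"] that assms
    unfolding bob_kraus_def bob_strategy_def by metis
qed

definition exec_dim :: "protocol \<Rightarrow> player \<Rightarrow> player \<Rightarrow> nat \<Rightarrow> nat" where
  "exec_dim \<pi> A B i = mem A i * ((to_alice \<pi> i * to_bob \<pi> i) * mem B i)"

lemma exchange_carrier: "exchange \<pi> A B i \<in>
    carrier_mat (exec_dim \<pi> A B i) ((mem A i * to_bob \<pi> i) * (to_alice \<pi> i * mem B i))"
  unfolding exchange_def exec_dim_def by (rule carrier_matI) (simp_all add: mult_ac swap_mat_def)

text \<open>Composition multiplies Kraus operators, so an execution has one operator for each pair
  of index sequences. The initial messages have dimension 1, which makes the initial register just
  the two inputs.\<close>

lemma kraus_exec:
  assumes A: "alice_kraus \<pi> A nA KA" and B: "bob_kraus \<pi> B nB KB"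
    and start: "to_alice \<pi> 0 = 1" "to_bob \<pi> 0 = 1" and "i \<le> rounds \<pi>"
  shows "kraus (exec_upto \<pi> A B i) ({..<env_dim nA i} \<times> {..<env_dim nB i})
      (\<lambda>(a, b). traj \<pi> A nA KA B nB KB i a b) \<and>
    src (exec_upto \<pi> A B i) = mem A 0 * mem B 0 \<and> trg (exec_upto \<pi> A B i) = exec_dim \<pi> A B i"
  using assms(5)
proof (induction i)
  case 0
  have "kraus (exec_upto \<pi> A B 0) ({..<env_dim nA 0} \<times> {..<env_dim nB 0}) (\<lambda>(a, b). traj \<pi> A nA KA B nB KB 0 a b)"
    by (simp only: exec_upto.simps) (rule kraus_reindex[OF kraus_id], auto simp: bij_betw_def inj_on_def)
  then show ?case using start by (simp add: exec_dim_def split_def)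
next
  case (Suc i)
  let ?E = "exec_upto \<pi> A B i"
  from Suc have ks: "kraus ?E ({..<env_dim nA i} \<times> {..<env_dim nB i}) (\<lambda>(a, b). traj \<pi> A nA KA B nB KB i a b)"
    and E: "src ?E = mem A 0 * mem B 0" "trg ?E = exec_dim \<pi> A B i" by auto
  have i: "i < rounds \<pi>" using Suc by simp
  have a: "kraus (act A i) {..<nA i} (KA i)" "src (act A i) = mem A i * to_alice \<pi> i"
    "trg (act A i) = mem A (Suc i) * to_bob \<pi> (Suc i)" using A i by (auto simp: alice_kraus_def)
  have b: "kraus (act B i) {..<nB i} (KB i)" "src (act B i) = to_bob \<pi> i * mem B i"
    "trg (act B i) = to_alice \<pi> (Suc i) * mem B (Suc i)" using B i by (auto simp: bob_kraus_def)
  let ?eA = "env_dim nA i" and ?eB = "env_dim nB i"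
  let ?X = "tensor (id_map (mem A (Suc i))) (tensor (swap_map (to_bob \<pi> (Suc i)) (to_alice \<pi> (Suc i))) (id_map (mem B (Suc i))))"
  have X: "kraus ?X ({()} \<times> ({()} \<times> {()})) (\<lambda>_. exchange \<pi> A B (Suc i))"
    using kraus_tensor[OF kraus_id kraus_tensor[OF kraus_swap kraus_id]] by (simp add: exchange_def split_def)
  have "src (tensor (act A i) (act B i)) = trg ?E" "src ?X = trg (comp_map (tensor (act A i) (act B i)) ?E)"
    using a b E by (simp_all add: exec_dim_def mult_ac)
  note full = kraus_comp[OF kraus_comp[OF ks kraus_tensor[OF a(1) b(1)] this(1)] X this(2)]
  \<comment> \<open>\<open>?J\<close> is the nested index set that \<open>kraus_comp\<close> and
    \<open>kraus_tensor\<close> produce; \<open>?g\<close> separates the newest digits of the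
    numerals \<open>a\<close> and \<open>b\<close> from the older ones.\<close>
  let ?J = "({()} \<times> ({()} \<times> {()})) \<times> (({..<nA i} \<times> {..<nB i}) \<times> ({..<?eA} \<times> {..<?eB}))"
  let ?g = "\<lambda>(a, b). (((), ((), ())), ((a mod nA i, b div ?eB), (a div nA i, b mod ?eB)))"
  have bij: "bij_betw ?g ({..<env_dim nA (Suc i)} \<times> {..<env_dim nB (Suc i)})
    ?J"
  proof (rule bij_betw_byWitness[where f' = "\<lambda>(_, ((k, l), (a, b))). (a * nA i + k, l * ?eB + b)"])
    show "?g ` ({..<env_dim nA (Suc i)} \<times> {..<env_dim nB (Suc i)})
      \<subseteq> ?J"
    proof (rule image_subsetI)
      fix x assume x: "x \<in> {..<env_dim nA (Suc i)} \<times> {..<env_dim nB (Suc i)}"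
      obtain a b where ab: "x = (a, b)" by force
      then have "a < env_dim nA (Suc i)" "b < env_dim nB (Suc i)" using x by auto
      then show "?g x \<in> ?J"
        using trajectory_digits[of a nA i b nB] by (auto simp: ab)
    qed
    show "(\<lambda>(_, ((k, l), (a, b))). (a * nA i + k, l * ?eB + b)) `
        ?J
      \<subseteq> {..<env_dim nA (Suc i)} \<times> {..<env_dim nB (Suc i)}"
      by (auto simp: mult_add_less mult.commute[of "env_dim nB i" "nB i"])
  qed (auto simp: div_mult_mod_eq)
  have "kraus (exec_upto \<pi> A B (Suc i)) ({..<env_dim nA (Suc i)} \<times> {..<env_dim nB (Suc i)})
    (\<lambda>(a, b). traj \<pi> A nA KA B nB KB (Suc i) a b)"
    unfolding exec_upto.simps by (rule kraus_reindex[OF full bij]) auto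
  then show ?case using E by (simp add: exec_dim_def)
qed

lemma alice_kraus_carrier:
  "alice_kraus \<pi> A nA KA \<Longrightarrow> i < rounds \<pi> \<Longrightarrow> k < nA i \<Longrightarrow>
    KA i k \<in> carrier_mat (mem A (Suc i) * to_bob \<pi> (Suc i)) (mem A i * to_alice \<pi> i)"
  by (auto simp: alice_kraus_def kraus_def)

lemma bob_kraus_carrier:
  "bob_kraus \<pi> B nB KB \<Longrightarrow> i < rounds \<pi> \<Longrightarrow> l < nB i \<Longrightarrow>
    KB i l \<in> carrier_mat (to_alice \<pi> (Suc i) * mem B (Suc i)) (to_bob \<pi> i * mem B i)"
  by (auto simp: bob_kraus_def kraus_def)

lemma traj_carrier:
  assumes "alice_kraus \<pi> A nA KA" "bob_kraus \<pi> B nB KB" "to_alice \<pi> 0 = 1" "to_bob \<pi> 0 = 1"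
    "i \<le> rounds \<pi>" "a < env_dim nA i" "b < env_dim nB i"
  shows "traj \<pi> A nA KA B nB KB i a b \<in> carrier_mat (exec_dim \<pi> A B i) (mem A 0 * mem B 0)"
  using kraus_exec[OF assms(1-5)] assms(6,7) by (auto simp: kraus_def)

section \<open>Purification of a player\<close>

text \<open>
  A purified player applies the Stinespring isometries of the operations, and keeps all the environment
  registers (Alice to the left of her memory, Bob to the right of his).
\<close>

definition purify_alice :: "protocol \<Rightarrow> player \<Rightarrow> (nat \<Rightarrow> nat) \<Rightarrow> (nat \<Rightarrow> nat \<Rightarrow> complex mat) \<Rightarrow> nat \<Rightarrow> complex mat" where
  "purify_alice \<pi> A n K i = kron (1\<^sub>m (env_dim n i))
     (stack_left (n i) (mem A (Suc i) * to_bob \<pi> (Suc i)) (mem A i * to_alice \<pi> i) (K i))"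

definition purify_bob :: "protocol \<Rightarrow> player \<Rightarrow> (nat \<Rightarrow> nat) \<Rightarrow> (nat \<Rightarrow> nat \<Rightarrow> complex mat) \<Rightarrow> nat \<Rightarrow> complex mat" where
  "purify_bob \<pi> B n K i = kron
     (stack_right (n i) (to_alice \<pi> (Suc i) * mem B (Suc i)) (to_bob \<pi> i * mem B i) (K i)) (1\<^sub>m (env_dim n i))"

definition purified_alice :: "protocol \<Rightarrow> player \<Rightarrow> (nat \<Rightarrow> nat) \<Rightarrow> (nat \<Rightarrow> nat \<Rightarrow> complex mat) \<Rightarrow> player" where
  "purified_alice \<pi> A n K =
     \<lparr>mem = (\<lambda>i. env_dim n i * mem A i), act = (\<lambda>i. conj_map (purify_alice \<pi> A n K i))\<rparr>"

definition purified_bob :: "protocol \<Rightarrow> player \<Rightarrow> (nat \<Rightarrow> nat) \<Rightarrow> (nat \<Rightarrow> nat \<Rightarrow> complex mat) \<Rightarrow> player" where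
  "purified_bob \<pi> B n K =
     \<lparr>mem = (\<lambda>i. mem B i * env_dim n i), act = (\<lambda>i. conj_map (purify_bob \<pi> B n K i))\<rparr>"

lemma env_dim_one [simp]: "env_dim (\<lambda>_. Suc 0) i = Suc 0"
  by (simp add: env_dim_def)

lemma purify_alice_isometry:
  assumes "alice_kraus \<pi> A n K" "i < rounds \<pi>"
  shows "adj (purify_alice \<pi> A n K i) * purify_alice \<pi> A n K i = 1\<^sub>m (dim_col (purify_alice \<pi> A n K i))"
proof -
  let ?s = "mem A i * to_alice \<pi> i" and ?t = "mem A (Suc i) * to_bob \<pi> (Suc i)"
  have "adj (stack_left (n i) ?t ?s (K i)) * stack_left (n i) ?t ?s (K i) = 1\<^sub>m ?s"
    using assms by (intro stack_isometry alice_kraus_carrier) (auto simp: alice_kraus_def)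
  then show ?thesis by (simp add: purify_alice_def adj_kron kron_mult kron_one)
qed

lemma purify_bob_isometry:
  assumes "bob_kraus \<pi> B n K" "i < rounds \<pi>"
  shows "adj (purify_bob \<pi> B n K i) * purify_bob \<pi> B n K i = 1\<^sub>m (dim_col (purify_bob \<pi> B n K i))"
proof -
  let ?s = "to_bob \<pi> i * mem B i" and ?t = "to_alice \<pi> (Suc i) * mem B (Suc i)"
  have "adj (stack_right (n i) ?t ?s (K i)) * stack_right (n i) ?t ?s (K i) = 1\<^sub>m ?s"
    using assms by (intro stack_isometry bob_kraus_carrier) (auto simp: bob_kraus_def)
  then show ?thesis by (simp add: purify_bob_def adj_kron kron_mult kron_one)
qed

lemma purified_alice_kraus:
  assumes "alice_kraus \<pi> A n K"
  shows "alice_kraus \<pi> (purified_alice \<pi> A n K) (\<lambda>_. Suc 0) (\<lambda>i _. purify_alice \<pi> A n K i)"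
  unfolding alice_kraus_def purified_alice_def
  using purify_alice_isometry[OF assms]
  by (auto simp: kraus_conj_map isometric_def simp del: index_mult_mat(1) lessThan_Suc)
    (auto simp: purify_alice_def mult_ac)

lemma purified_bob_kraus:
  assumes "bob_kraus \<pi> B n K"
  shows "bob_kraus \<pi> (purified_bob \<pi> B n K) (\<lambda>_. Suc 0) (\<lambda>i _. purify_bob \<pi> B n K i)"
  unfolding bob_kraus_def purified_bob_def
  using purify_bob_isometry[OF assms]
  by (auto simp: kraus_conj_map isometric_def simp del: index_mult_mat(1) lessThan_Suc)
    (auto simp: purify_bob_def mult_ac)

lemma alice_kraus_strategy: "alice_kraus \<pi> A n K \<Longrightarrow> mem A 0 = d \<Longrightarrow> alice_strategy \<pi> d A"
  by (auto simp: alice_kraus_def alice_strategy_def intro: isometric_imp_cptp)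

lemma bob_kraus_strategy: "bob_kraus \<pi> B n K \<Longrightarrow> mem B 0 = d \<Longrightarrow> bob_strategy \<pi> d B"
  by (auto simp: bob_kraus_def bob_strategy_def intro: isometric_imp_cptp)

lemma mat_one_mult: "dim_row X = n \<Longrightarrow> 1\<^sub>m n * X = (X :: complex mat)" "dim_col X = n \<Longrightarrow> X * 1\<^sub>m n = X"
  by (auto intro!: eq_matI)

text \<open>A bra has a single row and leaves only a register of dimension 1, a strict unit, so
  reading out the environment commutes with an operation on the other registers.\<close>

lemma kron_bra_commute_left: "dim_col X = m \<Longrightarrow> dim_row X = t \<Longrightarrow> kron (bra n k) X = X * kron (bra n k) (1\<^sub>m m)"
proof -
  assume X: "dim_col X = m" "dim_row X = t"
  have "X * kron (bra n k) (1\<^sub>m m) = kron (1\<^sub>m 1) X * kron (bra n k) (1\<^sub>m m)" by simp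
  also have "\<dots> = kron (1\<^sub>m 1 * bra n k) (X * 1\<^sub>m m)" by (rule kron_mult) (use X in auto)
  also have "\<dots> = kron (bra n k) X"
    by (simp only: mat_one_mult(1)[OF bra_dim(1)] mat_one_mult(2)[OF X(1)])
  finally show ?thesis by simp
qed

lemma kron_bra_commute_right: "dim_col X = m \<Longrightarrow> dim_row X = t \<Longrightarrow> kron X (bra n k) = X * kron (1\<^sub>m m) (bra n k)"
proof -
  assume X: "dim_col X = m" "dim_row X = t"
  have "X * kron (1\<^sub>m m) (bra n k) = kron X (1\<^sub>m 1) * kron (1\<^sub>m m) (bra n k)" by simp
  also have "\<dots> = kron (X * 1\<^sub>m m) (1\<^sub>m 1 * bra n k)" by (rule kron_mult) (use X in auto)
  also have "\<dots> = kron X (bra n k)"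
    by (simp only: mat_one_mult(1)[OF bra_dim(1)] mat_one_mult(2)[OF X(1)])
  finally show ?thesis by simp
qed

text \<open>Projecting the collected environment onto basis vector \<open>a\<close> selects
  trajectory \<open>a\<close>. A new environment factor is created between the older ones and the
  memory, which makes its index the least significant digit. The bra splits along this digit: its
  last factor turns the stacked isometry into one Kraus operator, the rest commutes down to the
  previous round. The argument 0 is the only index sequence of the purified player.\<close>

lemma traj_purified_alice:
  assumes A: "alice_kraus \<pi> A nA KA" and B: "bob_kraus \<pi> B nB KB"
    and start: "to_alice \<pi> 0 = 1" "to_bob \<pi> 0 = 1"
    and "i \<le> rounds \<pi>" "a < env_dim nA i" "b < env_dim nB i"
  shows "kron (bra (env_dim nA i) a) (1\<^sub>m (exec_dim \<pi> A B i)) *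
      traj \<pi> (purified_alice \<pi> A nA KA) (\<lambda>_. Suc 0) (\<lambda>i _. purify_alice \<pi> A nA KA i) B nB KB i 0 b
    = traj \<pi> A nA KA B nB KB i a b"
  using assms(5-)
proof (induction i arbitrary: a b)
  case 0
  then have "bra 1 0 = 1\<^sub>m 1" by (intro eq_matI) (auto simp: bra_def)
  then show ?case using 0 start by (simp add: exec_dim_def purified_alice_def mat_one_mult)
next
  case (Suc i)
  let ?A' = "purified_alice \<pi> A nA KA"
  let ?T' = "traj \<pi> ?A' (\<lambda>_. Suc 0) (\<lambda>i _. purify_alice \<pi> A nA KA i) B nB KB"
  let ?T = "traj \<pi> A nA KA B nB KB"
  let ?D = "exec_dim \<pi> A B (Suc i)"
  let ?eA = "env_dim nA i" and ?eB = "env_dim nB i"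
  define a1 k b1 l where "a1 = a div nA i" and "k = a mod nA i" and "b1 = b mod ?eB" and "l = b div ?eB"
  have i: "i < rounds \<pi>" using Suc by simp
  note lt = trajectory_digits[where ?nA = nA and ?nB = nB, OF Suc.prems(2,3), folded a1_def k_def b1_def l_def]
  have a: "a = a1 * nA i + k" by (simp add: a1_def k_def)
  have IH: "kron (bra ?eA a1) (1\<^sub>m (exec_dim \<pi> A B i)) * ?T' i 0 b1 = ?T i a1 b1"
    using Suc i lt by simp
  have T'c: "?T' i 0 b1 \<in> carrier_mat (exec_dim \<pi> ?A' B i) (mem ?A' 0 * mem B 0)"
    using lt i by (intro traj_carrier purified_alice_kraus A B start) auto
  let ?t = "mem A (Suc i) * to_bob \<pi> (Suc i)" and ?s = "mem A i * to_alice \<pi> i"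
  let ?tB = "to_alice \<pi> (Suc i) * mem B (Suc i)" and ?sB = "to_bob \<pi> i * mem B i"
  define V where "V = stack_left (nA i) ?t ?s (KA i)"
  define X where "X = exchange \<pi> A B (Suc i)"
  have Xc: "dim_row X = ?D" "dim_col X = ?t * ?tB"
    using exchange_carrier[of \<pi> A B "Suc i"] by (auto simp: X_def)
  have L: "KB i l \<in> carrier_mat ?tB ?sB" by (rule bob_kraus_carrier[OF B i lt(4)])
  have K: "KA i k \<in> carrier_mat ?t ?s" by (rule alice_kraus_carrier[OF A i lt(2)])
  have X': "exchange \<pi> ?A' B (Suc i) = kron (1\<^sub>m ?eA) (kron (1\<^sub>m (nA i)) X)"
    by (simp add: X_def exchange_def purified_alice_def kron_one[symmetric] kron_assoc)
  have V': "kron (purify_alice \<pi> A nA KA i) (KB i l) = kron (1\<^sub>m ?eA) (kron V (KB i l))"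
    by (simp add: purify_alice_def V_def kron_assoc)
  \<comment> \<open>The exchange does not touch the environment, so the bra passes through
    \<open>X\<close> and picks one block of \<open>V\<close>.\<close>
  have Vk: "kron (bra (nA i) k) X * kron V (KB i l) = X * kron (KA i k) (KB i l)"
  proof -
    have "kron (bra (nA i) k) X * kron V (KB i l)
      = X * (kron (bra (nA i) k) (1\<^sub>m (?t * ?tB)) * kron V (KB i l))"
      using Xc L by (subst kron_bra_commute_left[of _ "?t * ?tB"]) (auto simp: mat_mult_assoc V_def mult_ac)
    also have "kron (bra (nA i) k) (1\<^sub>m (?t * ?tB)) * kron V (KB i l)
      = kron (kron (bra (nA i) k) (1\<^sub>m ?t)) (1\<^sub>m ?tB) * kron V (KB i l)"
      by (simp only: kron_assoc kron_one)
    also have "\<dots> = kron (KA i k) (KB i l)"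
      using bra_stack_left[where K = "KA i", OF K lt(2)] L by (subst kron_mult) (auto simp: V_def mat_one_mult)
    finally show ?thesis .
  qed
  have dimE: "exec_dim \<pi> A B i = ?s * ?sB" "exec_dim \<pi> ?A' B i = ?eA * (?s * ?sB)"
    by (simp_all add: exec_dim_def purified_alice_def mult_ac)
  have "kron (bra (env_dim nA (Suc i)) a) (1\<^sub>m (?D)) * ?T' (Suc i) 0 b
    = kron (kron (bra ?eA a1) (bra (nA i) k)) (1\<^sub>m (?D))
      * (kron (1\<^sub>m ?eA) (kron (1\<^sub>m (nA i)) X) * (kron (1\<^sub>m ?eA) (kron V (KB i l)) * ?T' i 0 b1))"
    using lt by (simp add: kron_bra a X' V' flip: b1_def l_def)
  also have "\<dots> = (kron (bra ?eA a1) (kron (bra (nA i) k) (1\<^sub>m (?D)))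
      * kron (1\<^sub>m ?eA) (kron (1\<^sub>m (nA i)) X)) * kron (1\<^sub>m ?eA) (kron V (KB i l)) * ?T' i 0 b1"
    using T'c Xc L dimE by (simp add: mat_mult_assoc kron_assoc V_def)
  also have "\<dots> = kron (bra ?eA a1) (X * kron (KA i k) (KB i l)) * ?T' i 0 b1"
    using Xc L by (simp add: kron_mult mat_one_mult V_def) (simp add: Vk flip: V_def)
  also have "\<dots> = X * kron (KA i k) (KB i l) * (kron (bra ?eA a1) (1\<^sub>m (exec_dim \<pi> A B i)) * ?T' i 0 b1)"
    using Xc L K T'c dimE
    by (subst kron_bra_commute_left[of _ "exec_dim \<pi> A B i"]) (auto simp: mat_mult_assoc)
  also have "\<dots> = ?T (Suc i) a b"
    unfolding IH using traj_carrier[OF A B start, of i a1 b1] i lt Xc L K dimE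
    by (simp add: mat_mult_assoc flip: X_def a1_def k_def b1_def l_def)
  finally show ?case .
qed

text \<open>The mirror image for Bob: his new environment factor lies next to the memory and to the
  left of the older ones, so its index is the most significant digit.\<close>

lemma traj_purified_bob:
  assumes A: "alice_kraus \<pi> A nA KA" and B: "bob_kraus \<pi> B nB KB"
    and start: "to_alice \<pi> 0 = 1" "to_bob \<pi> 0 = 1"
    and "i \<le> rounds \<pi>" "a < env_dim nA i" "b < env_dim nB i"
  shows "kron (1\<^sub>m (exec_dim \<pi> A B i)) (bra (env_dim nB i) b) *
      traj \<pi> A nA KA (purified_bob \<pi> B nB KB) (\<lambda>_. Suc 0) (\<lambda>i _. purify_bob \<pi> B nB KB i) i a 0
    = traj \<pi> A nA KA B nB KB i a b"
  using assms(5-)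
proof (induction i arbitrary: a b)
  case 0
  then have "bra 1 0 = 1\<^sub>m 1" by (intro eq_matI) (auto simp: bra_def)
  then show ?case using 0 start kron_one_right by (simp add: exec_dim_def purified_bob_def mat_one_mult)
next
  case (Suc i)
  let ?B' = "purified_bob \<pi> B nB KB"
  let ?T' = "traj \<pi> A nA KA ?B' (\<lambda>_. Suc 0) (\<lambda>i _. purify_bob \<pi> B nB KB i)"
  let ?T = "traj \<pi> A nA KA B nB KB"
  let ?D = "exec_dim \<pi> A B (Suc i)"
  let ?eA = "env_dim nA i" and ?eB = "env_dim nB i"
  define a1 k b1 l where "a1 = a div nA i" and "k = a mod nA i" and "b1 = b mod ?eB" and "l = b div ?eB"
  have i: "i < rounds \<pi>" using Suc by simp
  note lt = trajectory_digits[where ?nA = nA and ?nB = nB, OF Suc.prems(2,3), folded a1_def k_def b1_def l_def]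
  have b: "b = l * ?eB + b1" by (simp only: b1_def l_def div_mult_mod_eq)
  have IH: "kron (1\<^sub>m (exec_dim \<pi> A B i)) (bra ?eB b1) * ?T' i a1 0 = ?T i a1 b1"
    using Suc i lt by simp
  have T'c: "?T' i a1 0 \<in> carrier_mat (exec_dim \<pi> A ?B' i) (mem A 0 * mem ?B' 0)"
    using lt i by (intro traj_carrier purified_bob_kraus A B start) auto
  let ?t = "mem A (Suc i) * to_bob \<pi> (Suc i)" and ?s = "mem A i * to_alice \<pi> i"
  let ?tB = "to_alice \<pi> (Suc i) * mem B (Suc i)" and ?sB = "to_bob \<pi> i * mem B i"
  define V where "V = stack_right (nB i) ?tB ?sB (KB i)"
  have dimV: "dim_row V = ?tB * nB i" "dim_col V = ?sB" by (simp_all add: V_def)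
  define X where "X = exchange \<pi> A B (Suc i)"
  have Xc: "dim_row X = ?D" "dim_col X = ?t * ?tB"
    using exchange_carrier[of \<pi> A B "Suc i"] by (auto simp: X_def)
  have L: "KB i l \<in> carrier_mat ?tB ?sB" by (rule bob_kraus_carrier[OF B i lt(4)])
  have K: "KA i k \<in> carrier_mat ?t ?s" by (rule alice_kraus_carrier[OF A i lt(2)])
  have X': "exchange \<pi> A ?B' (Suc i) = kron (kron X (1\<^sub>m (nB i))) (1\<^sub>m ?eB)"
    by (simp add: X_def exchange_def purified_bob_def kron_one kron_assoc mult_ac)
  have V': "kron (KA i k) (purify_bob \<pi> B nB KB i) = kron (kron (KA i k) V) (1\<^sub>m ?eB)"
    by (simp add: purify_bob_def V_def kron_assoc)
  have Vk: "kron X (bra (nB i) l) * kron (KA i k) V = X * kron (KA i k) (KB i l)"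
  proof -
    have "kron X (bra (nB i) l) * kron (KA i k) V
      = X * (kron (1\<^sub>m (?t * ?tB)) (bra (nB i) l) * kron (KA i k) V)"
      using Xc K by (subst kron_bra_commute_right[of _ "?t * ?tB"]) (auto simp: mat_mult_assoc V_def mult_ac)
    also have "kron (1\<^sub>m (?t * ?tB)) (bra (nB i) l) * kron (KA i k) V
      = kron (1\<^sub>m ?t) (kron (1\<^sub>m ?tB) (bra (nB i) l)) * kron (KA i k) V"
      by (simp only: kron_assoc[symmetric] kron_one)
    also have "\<dots> = kron (KA i k) (KB i l)"
      using bra_stack_right[where K = "KB i", OF L lt(4)] K by (subst kron_mult) (auto simp: V_def mat_one_mult)
    finally show ?thesis .
  qed
  have dimE: "exec_dim \<pi> A B i = ?s * ?sB" "exec_dim \<pi> A ?B' i = ?s * ?sB * ?eB"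
    by (simp_all add: exec_dim_def purified_bob_def mult_ac)
  have "kron (1\<^sub>m (?D)) (bra (env_dim nB (Suc i)) b) * ?T' (Suc i) a 0
    = kron (1\<^sub>m (?D)) (kron (bra (nB i) l) (bra ?eB b1))
      * (kron (kron X (1\<^sub>m (nB i))) (1\<^sub>m ?eB) * (kron (kron (KA i k) V) (1\<^sub>m ?eB) * ?T' i a1 0))"
    using lt by (simp add: kron_bra b X' V' mult.commute[of "env_dim nB i"] flip: a1_def k_def)
  also have "\<dots> = (kron (kron (1\<^sub>m (?D)) (bra (nB i) l)) (bra ?eB b1)
      * kron (kron X (1\<^sub>m (nB i))) (1\<^sub>m ?eB)) * kron (kron (KA i k) V) (1\<^sub>m ?eB) * ?T' i a1 0"
    unfolding kron_assoc[of "1\<^sub>m (?D)"]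
    using T'c Xc K dimE by (simp add: mat_mult_assoc V_def mult_ac)
  also have "\<dots> = kron (X * kron (KA i k) (KB i l)) (bra ?eB b1) * ?T' i a1 0"
    using Xc K by (simp add: kron_mult mat_one_mult dimV mult_ac) (simp add: Vk)
  also have "\<dots> = X * kron (KA i k) (KB i l) * (kron (1\<^sub>m (exec_dim \<pi> A B i)) (bra ?eB b1) * ?T' i a1 0)"
    using Xc L K T'c dimE
    by (subst kron_bra_commute_right[of _ "exec_dim \<pi> A B i"]) (auto simp: mat_mult_assoc)
  also have "\<dots> = ?T (Suc i) a b"
    unfolding IH using traj_carrier[OF A B start, of i a1 b1] i lt Xc L K dimE
    by (simp add: mat_mult_assoc flip: X_def a1_def k_def b1_def l_def)
  finally show ?case .
qed

section \<open>Preparation of a fixed input by Alice herself\<close>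

definition prepared :: "player \<Rightarrow> nat \<Rightarrow> player" where
  "prepared A j = \<lparr>mem = (mem A)(0 := 1),
     act = (act A)(0 := comp_map (act A 0) (conj_map (ket (mem A 0) j)))\<rparr>"

definition prepared_ops :: "player \<Rightarrow> nat \<Rightarrow> (nat \<Rightarrow> nat \<Rightarrow> complex mat) \<Rightarrow> nat \<Rightarrow> nat \<Rightarrow> complex mat" where
  "prepared_ops A j K = K(0 := (\<lambda>k. K 0 k * ket (mem A 0) j))"

lemma ket_isometry: "j < d \<Longrightarrow> adj (ket d j) * ket d j = 1\<^sub>m 1"
proof (rule eq_matI)
  fix r c assume "j < d" "r < dim_row (1\<^sub>m 1 :: complex mat)" "c < dim_col (1\<^sub>m 1 :: complex mat)"
  then show "(adj (ket d j) * ket d j) $$ (r, c) = 1\<^sub>m 1 $$ (r, c)"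
    by (subst mult_mat_index) (auto simp: ket_def if_distrib cong: if_cong)
qed auto

lemma prepared_kraus:
  assumes A: "alice_kraus \<pi> A n K" and "to_alice \<pi> 0 = 1" "j < mem A 0"
  shows "alice_kraus \<pi> (prepared A j) n (prepared_ops A j K)"
proof -
  let ?ket = "ket (mem A 0) j"
  let ?P = "comp_map (act A 0) (conj_map ?ket)"
  have "kraus ?P {..<n 0} (\<lambda>k. K 0 k * ?ket) \<and> isometric (src ?P) {..<n 0} (\<lambda>k. K 0 k * ?ket)"
    if "0 < rounds \<pi>"
  proof -
    have k: "kraus (act A 0) {..<n 0} (K 0)" "isometric (src (act A 0)) {..<n 0} (K 0)"
      and s: "src (act A 0) = mem A 0"
      using A that assms(2) by (auto simp: alice_kraus_def)
    have "kraus ?P ({..<n 0} \<times> {..<Suc 0}) (\<lambda>(k, l). K 0 k * ?ket)"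
      using s by (intro kraus_comp[OF kraus_conj_map k(1)]) simp
    then have kP: "kraus ?P {..<n 0} (\<lambda>k. K 0 k * ?ket)"
      by (rule kraus_reindex[where g = "\<lambda>k. (k, 0)"]) (auto simp: bij_betw_def inj_on_def)
    have "cptp (conj_map ?ket)"
      using assms(3) by (intro cptp_conj_map) (simp add: ket_isometry del: One_nat_def)
    then have "trace_preserving ?P"
      using isometric_imp_cptp[OF k] s by (intro trace_preserving_comp) (auto simp: cptp_def)
    then show ?thesis using kP kraus_isometric by blast
  qed
  then show ?thesis using A assms(2) by (auto simp: alice_kraus_def prepared_def prepared_ops_def)
qed

text \<open>The preparation is part of the operation of round 0, so it shows up in a trajectory, as
  a ket on the right, once that round has taken place; hence \<open>0 < i\<close>.\<close>

lemma traj_prepared: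
  assumes A: "alice_kraus \<pi> A nA KA" and B: "bob_kraus \<pi> B nB KB"
    and start: "to_alice \<pi> 0 = 1" "to_bob \<pi> 0 = 1"
    and "j < mem A 0" "0 < i" "i \<le> rounds \<pi>" "a < env_dim nA i" "b < env_dim nB i"
  shows "traj \<pi> (prepared A j) nA (prepared_ops A j KA) B nB KB i a b
    = traj \<pi> A nA KA B nB KB i a b * kron (ket (mem A 0) j) (1\<^sub>m (mem B 0))"
  using assms(6-)
proof (induction i arbitrary: a b)
  case 0
  then show ?case by simp
next
  case (Suc i)
  let ?T' = "traj \<pi> (prepared A j) nA (prepared_ops A j KA) B nB KB"
  let ?T = "traj \<pi> A nA KA B nB KB"
  define a1 k b1 l where "a1 = a div nA i" and "k = a mod nA i" and "b1 = b mod env_dim nB i" and "l = b div env_dim nB i"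
  have i: "i < rounds \<pi>" using Suc by simp
  note lt = trajectory_digits[where ?nA = nA and ?nB = nB, OF Suc.prems(3,4), folded a1_def k_def b1_def l_def]
  have L: "KB i l \<in> carrier_mat (to_alice \<pi> (Suc i) * mem B (Suc i)) (to_bob \<pi> i * mem B i)"
    by (rule bob_kraus_carrier[OF B i lt(4)])
  have K: "KA i k \<in> carrier_mat (mem A (Suc i) * to_bob \<pi> (Suc i)) (mem A i * to_alice \<pi> i)"
    by (rule alice_kraus_carrier[OF A i lt(2)])
  have X: "exchange \<pi> (prepared A j) B (Suc i) = exchange \<pi> A B (Suc i)"
    by (simp add: exchange_def prepared_def)
  have Xc: "dim_col (exchange \<pi> A B (Suc i)) =
      (mem A (Suc i) * to_bob \<pi> (Suc i)) * (to_alice \<pi> (Suc i) * mem B (Suc i))"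
    using exchange_carrier[of \<pi> A B "Suc i"] by auto
  show ?case
  \<comment> \<open>In round 0 the operation itself is modified; in later rounds the operations
    agree and the ket is inherited from the induction hypothesis.\<close>
  proof (cases "i = 0")
    case True
    have m0: "mem (prepared A j) 0 = 1" by (simp add: prepared_def)
    have kl: "kron (KA 0 k * ket (mem A 0) j) (KB 0 l) = kron (KA 0 k) (KB 0 l) * kron (ket (mem A 0) j) (1\<^sub>m (mem B 0))"
      using K L True start by (subst kron_mult) (auto simp: mat_one_mult)
    have "?T' (Suc i) a b = exchange \<pi> A B (Suc i) * (kron (KA 0 k * ket (mem A 0) j) (KB 0 l) * 1\<^sub>m (1 * mem B 0))"
      unfolding traj.simps(2) X using True by (simp add: m0 prepared_ops_def k_def l_def)
    also have "\<dots> = exchange \<pi> A B (Suc i) * (kron (KA i k) (KB i l) * 1\<^sub>m (mem A 0 * mem B 0)) * kron (ket (mem A 0) j) (1\<^sub>m (mem B 0))"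
      unfolding kl using True K L Xc start by (simp add: mat_mult_assoc mat_one_mult)
    also have "\<dots> = ?T (Suc i) a b * kron (ket (mem A 0) j) (1\<^sub>m (mem B 0))"
      using True by (simp add: k_def l_def)
    finally show ?thesis .
  next
    case False
    have Tc: "?T i a1 b1 \<in> carrier_mat (exec_dim \<pi> A B i) (mem A 0 * mem B 0)"
      using lt i by (intro traj_carrier A B start) auto
    have IH: "?T' i a1 b1 = ?T i a1 b1 * kron (ket (mem A 0) j) (1\<^sub>m (mem B 0))"
      using Suc.IH[of a1 b1] False i lt by simp
    have "prepared_ops A j KA i = KA i" using False by (simp add: prepared_ops_def)
    then have "?T' (Suc i) a b = exchange \<pi> A B (Suc i) * (kron (KA i k) (KB i l) * ?T' i a1 b1)"
      unfolding traj.simps(2) X by (simp add: a1_def k_def b1_def l_def)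
    also have "\<dots> = exchange \<pi> A B (Suc i) * (kron (KA i k) (KB i l) * ?T i a1 b1) * kron (ket (mem A 0) j) (1\<^sub>m (mem B 0))"
      unfolding IH using Xc K L Tc by (simp add: mat_mult_assoc exec_dim_def mult_ac)
    also have "\<dots> = ?T (Suc i) a b * kron (ket (mem A 0) j) (1\<^sub>m (mem B 0))"
      by (simp add: a1_def k_def b1_def l_def)
    finally show ?thesis .
  qed
qed

lemma exec_trace_preserving:
  assumes A: "alice_kraus \<pi> A nA KA" and B: "bob_kraus \<pi> B nB KB"
    and start: "to_alice \<pi> 0 = 1" "to_bob \<pi> 0 = 1" and "i \<le> rounds \<pi>"
  shows "trace_preserving (exec_upto \<pi> A B i)"
  using assms(5)
proof (induction i)
  case 0
  then show ?case by (simp add: trace_preserving_id)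
next
  case (Suc i)
  then have i: "i < rounds \<pi>" by simp
  note k = kraus_exec[OF A B start, of i]
  have lin: "linear_qmap (exec_upto \<pi> A B i)" and trg: "trg (exec_upto \<pi> A B i) = exec_dim \<pi> A B i"
    using k i by (auto intro: kraus_imp_linear)
  have a: "cptp (act A i)" and b: "cptp (act B i)"
    and d: "src (act A i) = mem A i * to_alice \<pi> i" "trg (act A i) = mem A (Suc i) * to_bob \<pi> (Suc i)"
      "src (act B i) = to_bob \<pi> i * mem B i" "trg (act B i) = to_alice \<pi> (Suc i) * mem B (Suc i)"
    using A B i by (auto simp: alice_kraus_def bob_kraus_def intro: isometric_imp_cptp)
  have linid: "linear_qmap (id_map m)" for m by (rule kraus_imp_linear[OF kraus_id])
  have linsw: "linear_qmap (swap_map m m')" for m m' by (rule kraus_imp_linear[OF kraus_swap])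
  have lintens: "linear_qmap (tensor (act A i) (act B i))"
    using a b by (intro linear_tensor) (auto simp: cptp_def)
  have tp: "trace_preserving (comp_map (tensor (act A i) (act B i)) (exec_upto \<pi> A B i))"
    using Suc i lin trg a b d
    by (intro trace_preserving_comp trace_preserving_tensor) (auto simp: cptp_def exec_dim_def mult_ac)
  have lincomp: "linear_qmap (comp_map (tensor (act A i) (act B i)) (exec_upto \<pi> A B i))"
    using lin lintens trg d by (intro linear_comp_map) (auto simp: exec_dim_def mult_ac)
  show ?case
    unfolding exec_upto.simps using d
    by (intro trace_preserving_comp[OF lincomp tp] trace_preserving_tensor linear_tensor linid linsw
        trace_preserving_id trace_preserving_swap) (simp add: mult_ac)
qed

section \<open>Unitary freedom of Kraus representations\<close>

lemma adj_zero: "adj (0\<^sub>m n m) = 0\<^sub>m m n"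
  by (rule eq_matI) auto

text \<open>With \<open>\<rho> = G * adj G\<close> and its pseudoinverse \<open>R\<close>, the
  matrix \<open>adj G * R\<close> is the pseudoinverse of \<open>G\<close>. It solves
  \<open>C = G * Y\<close> because \<open>C\<close> and \<open>G\<close> have the same range, namely
  that of \<open>\<rho>\<close>. The product \<open>Y * adj Y\<close> is the projection
  \<open>adj G * R * G\<close>, so its complement is a projection too.\<close>

lemma gram_eq_factor:
  assumes G: "G \<in> carrier_mat d n" and C: "C \<in> carrier_mat d m" and eq: "G * adj G = C * adj C"
  obtains Y where "Y \<in> carrier_mat n m" "C = G * Y" "psd n (1\<^sub>m n - Y * adj Y)"
proof -
  define \<rho> where "\<rho> = G * adj G"
  have \<rho>: "\<rho> \<in> carrier_mat d d" "adj \<rho> = \<rho>" using G by (auto simp: \<rho>_def adj_mult)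
  obtain R where R: "R \<in> carrier_mat d d" "adj R = R" "\<rho> * R * \<rho> = \<rho>" "R * \<rho> * R = R" "\<rho> * R = R * \<rho>"
    using hermitian_pinv[OF \<rho>] .
  define Y where "Y = adj G * (R * C)"
  have Y: "Y \<in> carrier_mat n m" using G C R by (auto simp: Y_def)
  have GY: "G * Y = \<rho> * (R * C)" using G C R by (simp add: Y_def \<rho>_def mat_mult_assoc)
  \<comment> \<open>\<open>Z\<close> is the part of \<open>C\<close> outside the range of
    \<open>\<rho>\<close>; since \<open>C * adj C = \<rho>\<close>, the product
    \<open>Z * adj Z\<close> vanishes.\<close>
  define Z where "Z = C - \<rho> * (R * C)"
  have Zc: "Z \<in> carrier_mat d m" using C R \<rho> by (auto simp: Z_def)
  have CC: "C * adj C = \<rho>" using eq by (simp add: \<rho>_def)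
  have "Z * adj Z = C * adj C - \<rho> * (R * (C * adj C)) - (C * (adj C * (R * \<rho>)) - \<rho> * (R * (C * (adj C * (R * \<rho>)))))"
    using C R(1,2) \<rho> by (simp add: Z_def adj_minus adj_mult mat_mult_minus mat_minus_mult mat_mult_assoc)
  moreover have "C * (adj C * (R * \<rho>)) = (C * adj C) * (R * \<rho>)" using C R(1) \<rho> by (simp add: mat_mult_assoc)
  ultimately have "Z * adj Z = \<rho> - \<rho> * (R * \<rho>) - (\<rho> * (R * \<rho>) - \<rho> * (R * (\<rho> * (R * \<rho>))))"
    by (simp add: CC)
  moreover have "\<rho> * R * \<rho> = \<rho> * (R * \<rho>)" using R(1) \<rho>(1) by (simp add: mat_mult_assoc)
  then have "\<rho> * (R * \<rho>) = \<rho>" using R(3) by simp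
  ultimately have "Z * adj Z = \<rho> - \<rho> - (\<rho> - \<rho>)" by simp
  also have "\<dots> = 0\<^sub>m d d" using \<rho> by (intro eq_matI) auto
  finally have "Re (tr (adj (adj Z) * adj Z)) \<le> 0" by (simp add: tr_def)
  then have "adj Z = 0\<^sub>m m d" using tr_adj_mult_le_0[of "adj Z"] Zc by simp
  then have "Z = 0\<^sub>m d m" using adj_adj[of Z] by (simp add: adj_zero)
  have CGY: "C = G * Y"
    unfolding GY
  proof (rule eq_matI)
    fix i j assume ij: "i < dim_row (\<rho> * (R * C))" "j < dim_col (\<rho> * (R * C))"
    then have "C $$ (i, j) - (\<rho> * (R * C)) $$ (i, j) = Z $$ (i, j)" by (simp add: Z_def)
    also have "\<dots> = 0" using \<open>Z = 0\<^sub>m d m\<close> ij \<rho> C by simp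
    finally show "C $$ (i, j) = (\<rho> * (R * C)) $$ (i, j)" by simp
  qed (use \<rho> C in auto)
  define Q where "Q = Y * adj Y"
  have Qc: "Q \<in> carrier_mat n n" "adj Q = Q" using Y by (auto simp: Q_def adj_mult)
  have "Q = adj G * (R * ((C * adj C) * (R * G)))"
    using G C R by (simp add: Q_def Y_def adj_mult mat_mult_assoc)
  also have "\<dots> = adj G * ((R * \<rho> * R) * G)" unfolding CC using G R(1) \<rho>(1) by (simp add: mat_mult_assoc)
  finally have Q: "Q = adj G * (R * G)" using R(4) by simp
  have "Q * Q = adj G * ((R * (G * adj G) * R) * G)" using G R(1) by (simp add: Q mat_mult_assoc)
  then have QQ: "Q * Q = Q" using R(4) unfolding \<rho>_def[symmetric] by (simp add: Q)
  let ?P = "1\<^sub>m n - Q"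
  have "?P * adj ?P = 1\<^sub>m n - Q - (Q - Q)"
    using Qc QQ by (simp add: adj_minus mat_mult_minus mat_minus_mult mat_one_mult)
  also have "\<dots> = ?P" using Qc by (intro eq_matI) auto
  finally have "psd n ?P" using psd_mult_adj[OF minus_carrier_mat[OF Qc(1)], of "1\<^sub>m n"] by simp
  then show thesis using that[OF Y CGY] by (simp add: Q_def)
qed

text \<open>Written as columns of a matrix, the Kraus operators have a Gram matrix that is the Choi
  matrix up to conjugation. Two families for the same map therefore have equal Gram matrices, and
  \<open>gram_eq_factor\<close> relates them. Equal lengths are not assumed, so \<open>Y\<close> is
  a contraction instead of a unitary.\<close>

lemma kraus_freedom:
  assumes E: "kraus E {..<n} G" and F: "kraus F {..<m} C"
    and dims: "src E = s" "src F = s" "trg E = t" "trg F = t"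
    and eq: "\<And>i j r c. i < s \<Longrightarrow> j < s \<Longrightarrow> r < t \<Longrightarrow> c < t \<Longrightarrow>
      app E (ketbra s i j) $$ (r, c) = app F (ketbra s i j) $$ (r, c)"
  obtains Y where "Y \<in> carrier_mat n m" "psd n (1\<^sub>m n - Y * adj Y)"
    "\<And>c r i. c < m \<Longrightarrow> r < t \<Longrightarrow> i < s \<Longrightarrow> C c $$ (r, i) = (\<Sum>a<n. cnj (Y $$ (a, c)) * G a $$ (r, i))"
proof -
  text \<open>Conjugate entries, as \<open>Y\<close> is to describe operators on the environment register.\<close>
  define \<Phi> where "\<Phi> K N = mat (s * t) N (\<lambda>(x, a). cnj (K a $$ (x mod t, x div t)))" for K :: "nat \<Rightarrow> complex mat" and N
  have \<Phi>c: "\<Phi> K N \<in> carrier_mat (s * t) N" for K N by (simp add: \<Phi>_def)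
  have \<Phi>i: "\<Phi> K N $$ (i * t + r, a) = cnj (K a $$ (r, i))" if "i < s" "r < t" "a < N" for K N i r a
    using that by (simp add: \<Phi>_def mult_add_less)
  have gram: "(\<Phi> K N * adj (\<Phi> K N)) $$ (i * t + r, j * t + c) = (\<Sum>a<N. cnj (K a $$ (r, i)) * K a $$ (c, j))"
    if "i < s" "r < t" "j < s" "c < t" for K N i r j c
    using that \<Phi>c[of K N] by (subst mult_mat_index) (auto simp: mult_add_less \<Phi>i)
  have "\<Phi> G n * adj (\<Phi> G n) = \<Phi> C m * adj (\<Phi> C m)"
  proof (rule eq_mat_prodI[of _ s t s t])
    fix i r j c assume *: "i < s" "r < t" "j < s" "c < t"
    \<comment> \<open>Because of the conjugation this entry belongs to the transposed pairs:
      \<open>j\<close>, \<open>i\<close> in the matrix unit and \<open>c\<close>, \<open>r\<close>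
      in the output.\<close>
    then have "(\<Phi> G n * adj (\<Phi> G n)) $$ (i * t + r, j * t + c) = app E (ketbra s j i) $$ (c, r)"
      using kraus_ketbra[OF E, of j i c r] dims by (simp add: gram mult.commute del: index_mult_mat(1))
    also have "\<dots> = (\<Phi> C m * adj (\<Phi> C m)) $$ (i * t + r, j * t + c)"
      using kraus_ketbra[OF F, of j i c r] dims * by (simp add: eq gram mult.commute del: index_mult_mat(1))
    finally show "(\<Phi> G n * adj (\<Phi> G n)) $$ (i * t + r, j * t + c) = (\<Phi> C m * adj (\<Phi> C m)) $$ (i * t + r, j * t + c)" .
  qed (rule mult_carrier_mat[OF \<Phi>c adj_carrier[OF \<Phi>c]])+
  then obtain Y where Y: "Y \<in> carrier_mat n m" "\<Phi> C m = \<Phi> G n * Y" "psd n (1\<^sub>m n - Y * adj Y)"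
    using gram_eq_factor[OF \<Phi>c \<Phi>c] by metis
  have "C c $$ (r, i) = (\<Sum>a<n. cnj (Y $$ (a, c)) * G a $$ (r, i))" if "c < m" "r < t" "i < s" for c r i
  proof -
    have "cnj (C c $$ (r, i)) = (\<Phi> G n * Y) $$ (i * t + r, c)"
      using that by (simp add: \<Phi>i flip: Y(2))
    also have "\<dots> = (\<Sum>a<n. cnj (G a $$ (r, i)) * Y $$ (a, c))"
      using that Y(1) \<Phi>c[of G n] by (subst mult_mat_index) (auto simp: mult_add_less \<Phi>i)
    finally have "C c $$ (r, i) = cnj (\<Sum>a<n. cnj (G a $$ (r, i)) * Y $$ (a, c))"
      by (metis complex_cnj_cnj)
    then show ?thesis by (simp add: mult.commute)
  qed
  then show thesis using that Y by blast
qed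

section \<open>Closeness on the uniform input\<close>

lemma to_nat_on_less: "finite S \<Longrightarrow> x \<in> S \<Longrightarrow> to_nat_on S x < card S"
  using to_nat_on_finite[of S] by (auto simp: bij_betw_def)

lemma to_nat_on_eq_iff: "finite S \<Longrightarrow> x \<in> S \<Longrightarrow> y \<in> S \<Longrightarrow> to_nat_on S x = to_nat_on S y \<longleftrightarrow> x = y"
  by (metis bij_betw_imp_inj_on inj_on_eq_iff to_nat_on_finite)

lemma pair_index_bij:
  assumes "finite U" "finite V"
  shows "bij_betw (pair_index U V) (U \<times> V) {..<card U * card V}"
proof -
  have inj: "inj_on (pair_index U V) (U \<times> V)"
    using assms by (auto simp: inj_on_def pair_index_def mult_add_eq_iff to_nat_on_less to_nat_on_eq_iff)
  moreover have sub: "pair_index U V ` (U \<times> V) \<subseteq> {..<card U * card V}"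
    using assms by (auto simp: pair_index_def mult_add_less to_nat_on_less)
  moreover have "card (pair_index U V ` (U \<times> V)) = card {..<card U * card V}"
    using card_image[OF inj] by (simp add: card_cartesian_product)
  ultimately show ?thesis
    unfolding bij_betw_def using card_subset_eq[OF finite_lessThan sub] by simp
qed

definition uniform :: "'a set \<Rightarrow> 'a \<Rightarrow> real" where
  "uniform S x = 1 / real (card S)"

abbreviation uniform_input :: "'u set \<Rightarrow> 'v set \<Rightarrow> complex mat" where
  "uniform_input U V \<equiv> purified_input U V (uniform (U \<times> V))"

abbreviation uniform_output :: "qmap \<Rightarrow> 'u set \<Rightarrow> 'v set \<Rightarrow> complex mat" where
  "uniform_output E U V \<equiv> on_input E U V (uniform (U \<times> V))"

lemma prob_dist_uniform: "finite S \<Longrightarrow> S \<noteq> {} \<Longrightarrow> prob_dist S (uniform S)"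
  by (simp add: prob_dist_def uniform_def)

text \<open>This is the shape that \<open>choi_index\<close> expects, with \<open>q = 1 / d\<close>;
  since \<open>pair_index\<close> runs through all of \<open>{..<d}\<close>, every basis vector
  takes part.\<close>

lemma purified_uniform_index:
  assumes "finite U" "finite V" and d: "d = card U * card V"
    and ijkl: "i < d" "k < d" "j < d" "l < d"
  shows "uniform_input U V $$ (i * d + k, j * d + l)
    = of_real (1 / d) * (if k = i \<and> l = j then 1 else 0)"
proof -
  have c: "complex_of_real (sqrt (uniform (U \<times> V) x) * sqrt (uniform (U \<times> V) y)) = of_real (1 / d)" for x y
    unfolding uniform_def real_sqrt_mult_self by (simp add: d card_cartesian_product)
  let ?g = "\<lambda>a b. of_real (1 / d) * (ketbra d a b $$ (i, j) * ketbra d a b $$ (k, l))"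
  have "uniform_input U V $$ (i * d + k, j * d + l)
    = (\<Sum>(x, y)\<in>(U \<times> V) \<times> (U \<times> V). ?g (pair_index U V x) (pair_index U V y))"
    unfolding purified_input_def Let_def d[symmetric] c using ijkl
    by (auto simp: msum_index mult_add_less kron_index simp del: ketbra_index intro!: sum.cong)
  also have "\<dots> = (\<Sum>x\<in>U \<times> V. \<Sum>y\<in>U \<times> V. ?g (pair_index U V x) (pair_index U V y))"
    by (simp only: sum.cartesian_product)
  also have "\<dots> = (\<Sum>x\<in>U \<times> V. \<Sum>b<d. ?g (pair_index U V x) b)"
    by (rule sum.cong[OF refl]) (rule sum.reindex_bij_betw[OF pair_index_bij[OF assms(1,2), folded d]])
  also have "\<dots> = (\<Sum>a<d. \<Sum>b<d. ?g a b)"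
    by (rule sum.reindex_bij_betw[OF pair_index_bij[OF assms(1,2), folded d], of "\<lambda>a. \<Sum>b<d. ?g a b"])
  also have "\<dots> = (\<Sum>a<d. \<Sum>b<d. of_real (1 / d) * (if a = i \<and> b = j then 1 else 0) * ketbra d a b $$ (k, l))"
    using ijkl by (intro sum.cong refl) auto
  also have "\<dots> = of_real (1 / d) * ketbra d i j $$ (k, l)"
    using ijkl by (subst sum_delta2) auto
  finally show ?thesis using ijkl by simp
qed

text \<open>The state is \<open>w * adj w\<close> for the maximally entangled unit vector
  \<open>w\<close>. Both facts feed \<open>close_0_imp_eq\<close>.\<close>

lemma purified_uniform:
  assumes "finite U" "finite V" and d: "d = card U * card V" "0 < d"
  shows "psd (d * d) (uniform_input U V)" "tr (uniform_input U V) = 1"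
proof -
  let ?P = "uniform_input U V"
  have Pc: "?P \<in> carrier_mat (d * d) (d * d)" by (simp add: purified_input_def Let_def d)
  define w where "w = mat (d * d) 1 (\<lambda>(x, y). if x div d = x mod d then complex_of_real (1 / sqrt d) else 0)"
  have wc: "w \<in> carrier_mat (d * d) 1" by (simp add: w_def)
  have wi: "w $$ (i * d + k, 0) = (if k = i then of_real (1 / sqrt d) else 0)" if "i < d" "k < d" for i k
    using that by (auto simp: w_def mult_add_less)
  have s: "complex_of_real (1 / sqrt d) * of_real (1 / sqrt d) = of_real (1 / d)"
    by (simp flip: of_real_mult)
  have "?P = w * adj w"
  proof (rule eq_mat_prodI[of _ d d d d])
    fix i k j l assume *: "i < d" "k < d" "j < d" "l < d"
    have "(w * adj w) $$ (i * d + k, j * d + l) = w $$ (i * d + k, 0) * cnj (w $$ (j * d + l, 0))"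
      using * wc by (subst mult_mat_index) (auto simp: mult_add_less)
    then show "?P $$ (i * d + k, j * d + l) = (w * adj w) $$ (i * d + k, j * d + l)"
      using * s by (simp add: purified_uniform_index[OF assms(1,2) d(1)] wi del: index_mult_mat(1))
  qed (use Pc wc in auto)
  then show "psd (d * d) ?P" using psd_mult_adj[OF wc] by simp
  have "tr ?P = (\<Sum>i<d. \<Sum>k<d. ?P $$ (i * d + k, i * d + k))"
    using Pc by (simp add: tr_def sum_lessThan_mult)
  also have "\<dots> = (\<Sum>i<d. \<Sum>k<d. if k = i then of_real (1 / d) else 0)"
    by (intro sum.cong refl) (simp add: purified_uniform_index[OF assms(1,2) d(1)])
  also have "\<dots> = 1" using d by simp
  finally show "tr ?P = 1" .
qed

text \<open>The uniform purified input is a maximally entangled state, so the outputs are Choi states.\<close>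

lemma close_0_uniform_imp_eq:
  assumes UV: "finite U" "finite V" "U \<noteq> {}" "V \<noteq> {}"
    and E: "kraus E I K" "trace_preserving E" and F: "kraus F J L" "trace_preserving F"
    and dims: "src E = card U * card V" "src F = card U * card V" "trg E = trg F"
    and close: "close 0 (uniform_output E U V) (uniform_output F U V)"
    and ij: "i < src E" "j < src E" and rc: "r < trg E" "c < trg E"
  shows "app E (ketbra (src E) i j) $$ (r, c) = app F (ketbra (src E) i j) $$ (r, c)"
proof -
  define d where "d = card U * card V"
  have d: "0 < d" using UV by (simp add: d_def card_gt_0_iff)
  note pu = purified_uniform[OF UV(1,2) d_def d]
  note pi = purified_uniform_index[OF UV(1,2) d_def]
  have P: "uniform_input U V \<in> carrier_mat (d * d) (d * d)" using pu by (simp add: psd_def)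
  have linid: "linear_qmap (id_map d)" by (rule kraus_imp_linear[OF kraus_id])
  have ok: "psd (d * trg G) (uniform_output G U V)" "tr (uniform_output G U V) = 1"
    if "kraus G M N" "trace_preserving G" "src G = d" for G and M :: "'x set" and N
  proof -
    show "psd (d * trg G) (uniform_output G U V)"
      using kraus_psd[OF kraus_tensor[OF kraus_id[of d] that(1)], of "uniform_input U V"] that pu
      by (simp add: on_input_def flip: d_def)
    have "trace_preserving (tensor (id_map d) G)"
      by (rule trace_preserving_tensor[OF linid trace_preserving_id kraus_imp_linear[OF that(1)] that(2)])
    then show "tr (uniform_output G U V) = 1"
      using that P pu by (simp add: on_input_def trace_preserving_def flip: d_def)
  qed
  have eq: "uniform_output E U V = uniform_output F U V"
    using ok[OF E] ok[OF F] dims close by (intro close_0_imp_eq[of "d * trg E"]) (auto simp: d_def)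
  \<comment> \<open>The factor \<open>1 / d\<close> is the same for both maps and non-zero, so equal
    outputs give equal Choi matrices.\<close>
  have entry: "uniform_output G U V $$ (i * trg G + r, j * trg G + c)
      = of_real (1 / d) * app G (ketbra d i j) $$ (r, c)"
    if "linear_qmap G" "src G = d" "trg G = trg E" for G
    using choi_index[OF that(1), where \<rho> = "uniform_input U V" and q = "of_real (1 / d)"]
      pi that ij rc dims by (simp add: on_input_def flip: d_def)
  show ?thesis
    using entry[OF kraus_imp_linear[OF E(1)]] entry[OF kraus_imp_linear[OF F(1)]] eq dims d
    by (simp flip: d_def)
qed

section \<open>The ideal functionality with a dishonest Bob\<close>

text \<open>The operator \<open>|z,z><u,v|\<close> with \<open>z = f u v\<close>. The functionality
  measures both inputs and prepares the answer twice, which gives one Kraus operator per pair of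
  inputs.\<close>

definition func_mat :: "('u \<Rightarrow> 'v \<Rightarrow> 'z) \<Rightarrow> 'u set \<Rightarrow> 'v set \<Rightarrow> 'z set \<Rightarrow> 'u \<times> 'v \<Rightarrow> complex mat" where
  "func_mat f U V Z = (\<lambda>(u, v). kron (ket (card Z) (to_nat_on Z (f u v))) (ket (card Z) (to_nat_on Z (f u v))) *
     kron (bra (card U) (to_nat_on U u)) (bra (card V) (to_nat_on V v)))"

lemma ideal_src_trg [simp]:
  "src (ideal_functionality f U V Z) = card U * card V" "trg (ideal_functionality f U V Z) = card Z * card Z"
  by (simp_all add: ideal_functionality_def)

lemma basis_state_carrier [simp]: "basis_state S x \<in> carrier_mat (card S) (card S)"
  by (simp add: basis_state_def)

lemma basis_state_dim [simp]: "dim_row (basis_state S x) = card S" "dim_col (basis_state S x) = card S"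
  by (simp_all add: basis_state_def)

lemma func_mat_carrier: "func_mat f U V Z x \<in> carrier_mat (card Z * card Z) (card U * card V)"
  by (cases x) (auto simp: func_mat_def intro!: carrier_matI)

lemma func_mat_index:
  assumes "x < card Z" "y < card Z" "i < card U" "j < card V"
  shows "func_mat f U V Z (u, v) $$ (x * card Z + y, i * card V + j) =
    (if x = to_nat_on Z (f u v) \<and> y = to_nat_on Z (f u v) \<and> i = to_nat_on U u \<and> j = to_nat_on V v then 1 else 0)"
proof -
  let ?z = "to_nat_on Z (f u v)"
  have "func_mat f U V Z (u, v) $$ (x * card Z + y, i * card V + j) =
    kron (ket (card Z) ?z) (ket (card Z) ?z) $$ (x * card Z + y, 0 * 1 + 0) *
    kron (bra (card U) (to_nat_on U u)) (bra (card V) (to_nat_on V v)) $$ (0 * 1 + 0, i * card V + j)"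
    using assms unfolding func_mat_def split by (subst mult_mat_index) (auto simp: mult_add_less)
  also have "\<dots> = (ket (card Z) ?z $$ (x, 0) * ket (card Z) ?z $$ (y, 0)) *
    (bra (card U) (to_nat_on U u) $$ (0, i) * bra (card V) (to_nat_on V v) $$ (0, j))"
    using assms by (intro arg_cong2[of _ _ _ _ "(*)"] kron_index) auto
  finally show ?thesis using assms by (simp add: ket_def bra_def)
qed

lemma ideal_kraus:
  assumes "finite U" "finite V" "finite Z" "\<And>u v. u \<in> U \<Longrightarrow> v \<in> V \<Longrightarrow> f u v \<in> Z"
  shows "kraus (ideal_functionality f U V Z) (U \<times> V) (func_mat f U V Z)"
  unfolding kraus_def
proof (intro conjI ballI)
  let ?I = "ideal_functionality f U V Z" and ?M = "func_mat f U V Z"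
  show "?M x \<in> carrier_mat (trg ?I) (src ?I)" for x
    using func_mat_carrier by simp
  fix \<rho> :: "complex mat"
  assume "\<rho> \<in> carrier_mat (src ?I) (src ?I)"
  then have \<rho>: "\<rho> \<in> carrier_mat (card U * card V) (card U * card V)" by simp
  have eq: "\<rho> $$ (pair_index U V x, pair_index U V x) \<cdot>\<^sub>m kron (basis_state Z (f u v)) (basis_state Z (f u v))
      = ?M x * \<rho> * adj (?M x)"
    if x: "x = (u, v)" "u \<in> U" "v \<in> V" for x u v
  proof (rule eq_mat_prodI[of _ "card Z" "card Z" "card Z" "card Z"])
    let ?z = "to_nat_on Z (f u v)" and ?i = "to_nat_on U u" and ?j = "to_nat_on V v"
    note lt = to_nat_on_less[OF assms(1) x(2)] to_nat_on_less[OF assms(2) x(3)]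
    fix a b c e assume *: "a < card Z" "b < card Z" "c < card Z" "e < card Z"
    have F: "?M (u, v) $$ (a * card Z + b, y) =
      (if a = ?z \<and> b = ?z then 1 else 0) * (if y = pair_index U V (u, v) then 1 else 0)"
      if "y < card U * card V" "a < card Z" "b < card Z" for y a b
      using that lt by (auto elim!: mult_add_cases simp: func_mat_index pair_index_def mult_add_eq_iff)
    have p: "pair_index U V (u, v) < card U * card V" using lt by (simp add: pair_index_def mult_add_less)
    have "(?M x * \<rho> * adj (?M x)) $$ (a * card Z + b, c * card Z + e)
      = (\<Sum>i<card U * card V. \<Sum>j<card U * card V. ?M (u, v) $$ (a * card Z + b, i) * \<rho> $$ (i, j) *
          cnj (?M (u, v) $$ (c * card Z + e, j)))"
      unfolding x(1) by (rule conj_index[OF func_mat_carrier \<rho>]) (use * in \<open>auto simp: mult_add_less\<close>)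
    also have "\<dots> = (\<Sum>i<card U * card V. \<Sum>j<card U * card V. (if a = ?z \<and> b = ?z \<and> c = ?z \<and> e = ?z then 1 else 0) *
       (if i = pair_index U V (u, v) \<and> j = pair_index U V (u, v) then 1 else 0) * \<rho> $$ (i, j))"
      using * by (intro sum.cong refl) (auto simp: F)
    also have "\<dots> = (if a = ?z \<and> b = ?z \<and> c = ?z \<and> e = ?z then 1 else 0) * \<rho> $$ (pair_index U V (u, v), pair_index U V (u, v))"
      using p by (subst sum_delta2) auto
    finally show "(\<rho> $$ (pair_index U V x, pair_index U V x) \<cdot>\<^sub>m kron (basis_state Z (f u v)) (basis_state Z (f u v))) $$ (a * card Z + b, c * card Z + e)
      = (?M x * \<rho> * adj (?M x)) $$ (a * card Z + b, c * card Z + e)"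
      using * by (auto simp: x(1) mult_add_less kron_index basis_state_def)
  next
    show "?M x * \<rho> * adj (?M x) \<in> carrier_mat (card Z * card Z) (card Z * card Z)"
      using \<rho> func_mat_carrier[of f U V Z x] by auto
  qed (auto intro!: carrier_matI)
  show "app ?I \<rho> = msum (trg ?I) (U \<times> V)
      (\<lambda>x. ?M x * \<rho> * adj (?M x))"
    unfolding ideal_functionality_def by (auto simp: msum_def eq intro!: cong_mat sum.cong simp del: index_mult_mat(1))
qed (use assms in auto)

lemma ideal_trace_preserving:
  assumes "finite U" "finite V" "finite Z" "\<And>u v. u \<in> U \<Longrightarrow> v \<in> V \<Longrightarrow> f u v \<in> Z"
  shows "trace_preserving (ideal_functionality f U V Z)"
  unfolding trace_preserving_def
proof
  let ?I = "ideal_functionality f U V Z"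
  fix \<rho> :: "complex mat"
  assume "\<rho> \<in> carrier_mat (src ?I) (src ?I)"
  then have \<rho>: "\<rho> \<in> carrier_mat (card U * card V) (card U * card V)" by simp
  have one: "tr (basis_state Z (f u v)) = 1" if "u \<in> U" "v \<in> V" for u v
    using to_nat_on_less[OF assms(3) assms(4)[OF that]] by (simp add: basis_state_def tr_ketbra)
  have trs: "tr (a \<cdot>\<^sub>m A) = a * tr A" if "dim_row A = dim_col A" for a A
    using that by (simp add: tr_def sum_distrib_left)
  have "tr (app ?I \<rho>) = (\<Sum>(u, v)\<in>U \<times> V. \<rho> $$ (pair_index U V (u, v), pair_index U V (u, v)))"
    unfolding ideal_functionality_def qmap.simps
    by (subst tr_msum) (auto simp: trs tr_kron one intro!: sum.cong carrier_matI)
  also have "\<dots> = (\<Sum>x\<in>U \<times> V. \<rho> $$ (pair_index U V x, pair_index U V x))"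
    by (simp add: split_def)
  also have "\<dots> = (\<Sum>i<card U * card V. \<rho> $$ (i, i))"
    by (rule sum.reindex_bij_betw[OF pair_index_bij[OF assms(1,2)], of "\<lambda>i. \<rho> $$ (i, i)"])
  finally show "tr (app ?I \<rho>) = tr \<rho>" using \<rho> by (simp add: tr_def)
qed

lemma mult_ket_index:
  assumes "M \<in> carrier_mat t d" "j < d" "r < t"
  shows "(M * ket d j) $$ (r, 0) = M $$ (r, j)"
  using assms by (subst mult_mat_index) (auto simp: ket_def if_distrib cong: if_cong)

lemma kron_ket: "j < n \<Longrightarrow> kron (ket m i) (ket n j) = ket (m * n) (i * n + j)"
proof (rule eq_mat_prodI[of _ m n 1 1])
  fix k l r s assume *: "j < n" "k < m" "l < n" "r < (1::nat)" "s < (1::nat)"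
  have "kron (ket m i) (ket n j) $$ (k * n + l, r * 1 + s) = ket m i $$ (k, r) * ket n j $$ (l, s)"
    using * by (intro kron_index) auto
  then show "kron (ket m i) (ket n j) $$ (k * n + l, r * 1 + s) = ket (m * n) (i * n + j) $$ (k * n + l, r * 1 + s)"
    using * by (auto simp: ket_def mult_add_less mult_add_eq_iff)
qed (auto simp: ket_def kron_def)

lemma bra_ket:
  assumes "j < d"
  shows "bra d i * ket d j = (if i = j then 1\<^sub>m 1 else 0\<^sub>m 1 1)"
proof (rule eq_matI)
  fix r c assume "r < dim_row (if i = j then 1\<^sub>m 1 else 0\<^sub>m 1 1 :: complex mat)"
    "c < dim_col (if i = j then 1\<^sub>m 1 else 0\<^sub>m 1 1 :: complex mat)"
  then have rc: "r = 0" "c = 0" by (auto split: if_splits)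
  show "(bra d i * ket d j) $$ (r, c) = (if i = j then 1\<^sub>m 1 else 0\<^sub>m 1 1) $$ (r, c)"
    unfolding rc using assms by (subst mult_ket_index[of _ 1]) (auto simp: bra_def)
qed auto

text \<open>Diagonal entries are sums of squared moduli, in which nothing cancels. Whether such an
  entry vanishes is a property of the map, so possibility can be carried from one Kraus
  representation to another.\<close>

lemma kraus_diag_nonzero:
  assumes "kraus E I K" "i < src E" "r < trg E"
  shows "app E (ketbra (src E) i i) $$ (r, r) \<noteq> 0 \<longleftrightarrow> (\<exists>k\<in>I. K k $$ (r, i) \<noteq> 0)"
proof -
  have "app E (ketbra (src E) i i) $$ (r, r) = of_real (\<Sum>k\<in>I. (cmod (K k $$ (r, i)))\<^sup>2)"
    using assms by (simp add: kraus_ketbra flip: complex_norm_square)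
  moreover have "(\<Sum>k\<in>I. (cmod (K k $$ (r, i)))\<^sup>2) = 0 \<longleftrightarrow> (\<forall>k\<in>I. K k $$ (r, i) = 0)"
    using assms by (subst sum_nonneg_eq_0_iff) (auto simp: kraus_def)
  ultimately show ?thesis by (metis of_real_eq_0_iff)
qed

text \<open>The index triple consists of the Kraus index of the adversary's final operation, the
  pair of inputs read by the functionality, and the Kraus index of his first operation. The second
  input of the pair is his choice \<open>w\<close>.\<close>

definition ideal_op :: "('u \<Rightarrow> 'v \<Rightarrow> 'z) \<Rightarrow> 'u set \<Rightarrow> 'v set \<Rightarrow> 'z set \<Rightarrow> nat \<Rightarrow>
    ('j \<Rightarrow> complex mat) \<Rightarrow> ('l \<Rightarrow> complex mat) \<Rightarrow> 'l \<times> ('u \<times> 'v) \<times> 'j \<Rightarrow> complex mat" where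
  "ideal_op f U V Z k K1 K2 = (\<lambda>(l, x, j). kron (1\<^sub>m (card Z)) (K2 l) *
     (kron (func_mat f U V Z x) (1\<^sub>m k) * kron (1\<^sub>m (card U)) (K1 j)))"

lemma ideal_with_bob_kraus:
  assumes fin: "finite U" "finite V" "finite Z" and f: "\<And>u v. u \<in> U \<Longrightarrow> v \<in> V \<Longrightarrow> f u v \<in> Z"
    and bob: "ideal_bob V Z d k \<Lambda>1 \<Lambda>2" and K1: "kraus \<Lambda>1 I1 K1" and K2: "kraus \<Lambda>2 I2 K2"
  shows "kraus (ideal_with_bob f U V Z k \<Lambda>1 \<Lambda>2) (I2 \<times> (U \<times> V) \<times> I1) (ideal_op f U V Z k K1 K2)"
    and "trace_preserving (ideal_with_bob f U V Z k \<Lambda>1 \<Lambda>2)"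
    and "src (ideal_with_bob f U V Z k \<Lambda>1 \<Lambda>2) = card U * card V"
    and "trg (ideal_with_bob f U V Z k \<Lambda>1 \<Lambda>2) = card Z * d"
proof -
  note b = bob[unfolded ideal_bob_def]
  let ?F = "ideal_functionality f U V Z"
  note F = ideal_kraus[OF fin f] ideal_trace_preserving[OF fin f]
  have k1: "kraus (tensor (id_map (card U)) \<Lambda>1) ({()} \<times> I1) (\<lambda>(k, l). kron (1\<^sub>m (card U)) (K1 l))"
    using kraus_tensor[OF kraus_id K1] by simp
  have k2: "kraus (tensor ?F (id_map k)) ((U \<times> V) \<times> {()}) (\<lambda>(x, l). kron (func_mat f U V Z x) (1\<^sub>m k))"
    using kraus_tensor[OF F(1) kraus_id] by simp
  have k3: "kraus (tensor (id_map (card Z)) \<Lambda>2) ({()} \<times> I2) (\<lambda>(k, l). kron (1\<^sub>m (card Z)) (K2 l))"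
    using kraus_tensor[OF kraus_id K2] by simp
  have "src (tensor ?F (id_map k)) = trg (tensor (id_map (card U)) \<Lambda>1)"
    "src (tensor (id_map (card Z)) \<Lambda>2) = trg (comp_map (tensor ?F (id_map k)) (tensor (id_map (card U)) \<Lambda>1))"
    using b by simp_all
  note k21 = kraus_comp[OF k1 k2 this(1)] and full = kraus_comp[OF kraus_comp[OF k1 k2 this(1)] k3 this(2)]
  show "kraus (ideal_with_bob f U V Z k \<Lambda>1 \<Lambda>2) (I2 \<times> (U \<times> V) \<times> I1) (ideal_op f U V Z k K1 K2)"
    unfolding ideal_with_bob_def
    by (rule kraus_reindex[OF full, where g = "\<lambda>(l, x, j). (((), l), ((x, ()), ((), j)))"])
      (auto simp: ideal_op_def intro!: bij_betw_byWitness[where f' = "\<lambda>((_, l), ((x, _), (_, j))). (l, x, j)"])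
  have lin: "linear_qmap (id_map m)" for m by (rule kraus_imp_linear[OF kraus_id])
  have L: "linear_qmap \<Lambda>1" "linear_qmap \<Lambda>2" "trace_preserving \<Lambda>1" "trace_preserving \<Lambda>2"
    using b by (auto simp: cptp_def)
  have tp21: "trace_preserving (comp_map (tensor ?F (id_map k)) (tensor (id_map (card U)) \<Lambda>1))"
    using b by (intro trace_preserving_comp trace_preserving_tensor linear_tensor L lin F(2)
        kraus_imp_linear[OF F(1)] trace_preserving_id) auto
  show "trace_preserving (ideal_with_bob f U V Z k \<Lambda>1 \<Lambda>2)"
    unfolding ideal_with_bob_def using b
    by (intro trace_preserving_comp[OF kraus_imp_linear[OF k21] tp21] trace_preserving_tensor L lin trace_preserving_id) auto
  show "src (ideal_with_bob f U V Z k \<Lambda>1 \<Lambda>2) = card U * card V"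
    "trg (ideal_with_bob f U V Z k \<Lambda>1 \<Lambda>2) = card Z * d"
    using b by (auto simp: ideal_with_bob_def)
qed

lemma kron_zero_left: "kron (0\<^sub>m a b) M = 0\<^sub>m (a * dim_row M) (b * dim_col M)"
  by (rule eq_matI) (auto simp: kron_def less_mult_imp_div_less)

lemma kron_zero_right: "kron M (0\<^sub>m a b) = 0\<^sub>m (dim_row M * a) (dim_col M * b)"
  by (rule eq_mat_prodI[of _ "dim_row M" a "dim_col M" b])
    (auto simp: kron_index mult_add_less intro!: carrier_matI)

text \<open>\<open>\<kappa>\<close> is the unnormalised content of the auxiliary register after the
  adversary has fed \<open>w\<close> to the functionality. Neither \<open>u\<close> nor
  \<open>u'\<close> occurs in it: Alice's input enters through the answer and the condition
  \<open>u' = u\<close> alone.\<close>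

lemma ideal_op_column:
  assumes u: "u \<in> U" "u' \<in> U" and v: "v \<in> V" and fin: "finite U" "finite V"
    and K1: "K1 j \<in> carrier_mat (card V * k) (card V)" and K2: "K2 l \<in> carrier_mat d (card Z * k)"
    and \<kappa>: "\<kappa> = kron (bra (card V) (to_nat_on V w)) (1\<^sub>m k) * (K1 j * ket (card V) (to_nat_on V v))"
  shows "ideal_op f U V Z k K1 K2 (l, (u', w), j) * ket (card U * card V) (pair_index U V (u, v))
    = (if u' = u then kron (ket (card Z) (to_nat_on Z (f u w))) (K2 l * kron (ket (card Z) (to_nat_on Z (f u w))) \<kappa>)
       else 0\<^sub>m (card Z * d) 1)"
proof -
  let ?z = "ket (card Z) (to_nat_on Z (f u' w))"
  let ?X = "ideal_op f U V Z k K1 K2 (l, (u', w), j) * ket (card U * card V) (pair_index U V (u, v))"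
  let ?u = "ket (card U) (to_nat_on U u)" and ?v = "ket (card V) (to_nat_on V v)"
  let ?bu = "bra (card U) (to_nat_on U u')" and ?bw = "bra (card V) (to_nat_on V w)"
  let ?\<xi> = "K1 j * ?v"
  note lt = to_nat_on_less[OF fin(1) u(1)] to_nat_on_less[OF fin(2) v]
  have \<xi>: "dim_row ?\<xi> = card V * k" "dim_col ?\<xi> = 1" using K1 by auto
  have \<kappa>c: "dim_row \<kappa> = k" "dim_col \<kappa> = 1" using \<xi> by (auto simp: \<kappa>)
  have "?X
    = kron (1\<^sub>m (card Z)) (K2 l) * (kron (func_mat f U V Z (u', w)) (1\<^sub>m k) * (kron (1\<^sub>m (card U)) (K1 j) * kron ?u ?v))"
    using lt K1 K2 func_mat_carrier[of f U V Z "(u', w)"]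
    by (simp add: ideal_op_def kron_ket pair_index_def mat_mult_assoc mult_ac)
  also have "kron (1\<^sub>m (card U)) (K1 j) * kron ?u ?v = kron ?u ?\<xi>"
    using K1 by (subst kron_mult) (auto simp: mat_one_mult)
  also have "kron (func_mat f U V Z (u', w)) (1\<^sub>m k) = kron (kron ?z ?z) (1\<^sub>m k) * kron (kron ?bu ?bw) (1\<^sub>m k)"
    by (subst kron_mult) (auto simp: func_mat_def mat_one_mult)
  also have "(kron (kron ?z ?z) (1\<^sub>m k) * kron (kron ?bu ?bw) (1\<^sub>m k)) * kron ?u ?\<xi>
    = kron (kron ?z ?z) (1\<^sub>m k) * kron (?bu * ?u) \<kappa>"
  proof -
    have "kron (kron ?bu ?bw) (1\<^sub>m k) * kron ?u ?\<xi> = kron (?bu * ?u) \<kappa>"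
      unfolding kron_assoc \<kappa> using \<xi> by (intro kron_mult) auto
    then show ?thesis using \<xi> by (subst mat_mult_assoc) auto
  qed
  finally have eq: "?X
    = kron (1\<^sub>m (card Z)) (K2 l) * (kron (kron ?z ?z) (1\<^sub>m k) * kron (?bu * ?u) \<kappa>)" .
  show ?thesis
  proof (cases "u' = u")
    case True
    then have "kron (?bu * ?u) \<kappa> = \<kappa>" using bra_ket[OF lt(1)] by simp
    moreover have "kron (kron ?z ?z) (1\<^sub>m k) * \<kappa> = kron ?z (kron ?z \<kappa>)"
    proof -
      have "kron (kron ?z ?z) (1\<^sub>m k) * kron (1\<^sub>m 1) \<kappa> = kron (kron ?z ?z * 1\<^sub>m 1) (1\<^sub>m k * \<kappa>)"
        using \<kappa>c by (intro kron_mult) auto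
      also have "\<dots> = kron (kron ?z ?z) \<kappa>" using \<kappa>c by (simp add: mat_one_mult)
      finally show ?thesis by (simp add: kron_assoc)
    qed
    moreover have "kron (1\<^sub>m (card Z)) (K2 l) * kron ?z (kron ?z \<kappa>) = kron ?z (K2 l * kron ?z \<kappa>)"
      using K2 \<kappa>c by (subst kron_mult) (auto simp: mat_one_mult)
    ultimately show ?thesis using eq True by simp
  next
    case False
    then have "?bu * ?u = 0\<^sub>m 1 1" using bra_ket[OF lt(1)] u fin by (simp add: to_nat_on_eq_iff)
    then have "kron (?bu * ?u) \<kappa> = 0\<^sub>m k 1" using \<kappa>c by (simp add: kron_zero_left)
    moreover have "kron (kron ?z ?z) (1\<^sub>m k) * 0\<^sub>m k 1 = 0\<^sub>m (card Z * (card Z * k)) 1"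
      by (rule right_mult_zero_mat) (auto intro!: carrier_matI)
    moreover have "kron (1\<^sub>m (card Z)) (K2 l) * 0\<^sub>m (card Z * (card Z * k)) 1 = 0\<^sub>m (card Z * d) 1"
      by (rule right_mult_zero_mat) (use K2 in \<open>auto intro!: carrier_matI\<close>)
    ultimately show ?thesis using False eq by simp
  qed
qed

text \<open>
  The choice \<open>w\<close> of the ideal adversary depends on Bob's input \<open>v\<close> only: if it is possible together with
  one input of Alice, it is possible together with every input of Alice.
\<close>

lemma ideal_op_column_transfer:
  assumes fin: "finite U" "finite V" "finite Z" and f: "f u w \<in> Z"
    and u: "u0 \<in> U" "u' \<in> U" "u \<in> U" and v: "v \<in> V" and j: "j \<in> I1" and l: "l \<in> I2"
    and bob: "ideal_bob V Z d k \<Lambda>1 \<Lambda>2" and K1: "kraus \<Lambda>1 I1 K1" and K2: "kraus \<Lambda>2 I2 K2"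
    and r: "r < card Z * d" and nz: "ideal_op f U V Z k K1 K2 (l, (u', w), j) $$ (r, pair_index U V (u0, v)) \<noteq> 0"
  shows "\<exists>l'\<in>I2. \<exists>y<d. ideal_op f U V Z k K1 K2 (l', (u, w), j) $$
    (to_nat_on Z (f u w) * d + y, pair_index U V (u, v)) \<noteq> 0"
proof -
  note b = bob[unfolded ideal_bob_def]
  let ?C = "ideal_op f U V Z k K1 K2" and ?z0 = "ket (card Z) (to_nat_on Z (f u0 w))"
  have K1c: "K1 j \<in> carrier_mat (card V * k) (card V)" using K1 j b by (auto simp: kraus_def)
  have K2c: "K2 l' \<in> carrier_mat d (card Z * k)" if "l' \<in> I2" for l' using K2 b that by (auto simp: kraus_def)
  define \<kappa> where "\<kappa> = kron (bra (card V) (to_nat_on V w)) (1\<^sub>m k) * (K1 j * ket (card V) (to_nat_on V v))"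
  have \<kappa>c: "\<kappa> \<in> carrier_mat k 1" using K1c by (auto simp: \<kappa>_def intro!: carrier_matI)
  have opc: "?C (l', (u', w), j) \<in> carrier_mat (card Z * d) (card U * card V)" if "l' \<in> I2" for l' u'
    using K1c K2c[OF that] by (auto simp: ideal_op_def intro!: carrier_matI)
  have lt: "pair_index U V (u'', v) < card U * card V" if "u'' \<in> U" for u''
    using to_nat_on_less[OF fin(1) that] to_nat_on_less[OF fin(2) v] by (simp add: pair_index_def mult_add_less)
  have "(?C (l, (u', w), j) * ket (card U * card V) (pair_index U V (u0, v))) $$ (r, 0) \<noteq> 0"
    using nz by (subst mult_ket_index[OF opc[OF l] lt[OF u(1)] r])
  then have nz': "kron ?z0 (K2 l * kron ?z0 \<kappa>) $$ (r, 0) \<noteq> 0"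
    unfolding ideal_op_column[OF u(1,2) v fin(1,2), where ?f = f and ?K1.0 = K1 and ?K2.0 = K2 and j = j and l = l, OF K1c K2c[OF l] \<kappa>_def] using r
    by (auto split: if_splits)
  \<comment> \<open>If \<open>\<kappa>\<close> vanished, the choice \<open>w\<close> would be
    impossible for this \<open>j\<close>, whatever Alice's input.\<close>
  have \<kappa>0: "\<kappa> \<noteq> 0\<^sub>m k 1"
  proof
    assume "\<kappa> = 0\<^sub>m k 1"
    then have "kron ?z0 \<kappa> = 0\<^sub>m (card Z * k) 1"
      by (simp add: kron_zero_right)
    then have "K2 l * kron ?z0 \<kappa> = 0\<^sub>m d 1" using K2c[OF l] by simp
    moreover have "kron ?z0 (0\<^sub>m d 1) $$ (r, 0) = 0"
      using r by (auto simp: kron_def elim!: mult_add_cases)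
    ultimately show False using nz' by simp
  qed
  let ?z = "to_nat_on Z (f u w)"
  have z: "?z < card Z" using to_nat_on_less[OF fin(3) f] .
  define \<xi> where "\<xi> = kron (ket (card Z) ?z) \<kappa>"
  have \<xi>c: "\<xi> \<in> carrier_mat (card Z * k) 1" using \<kappa>c by (auto simp: \<xi>_def intro!: carrier_matI)
  \<comment> \<open>A trace-preserving map does not annihilate the non-zero positive operator
    \<open>\<xi> * adj \<xi>\<close>, so some Kraus operator of \<open>\<Lambda>2\<close> survives.
    Its index may differ from \<open>l\<close>, because the answer changes with Alice's
    input.\<close>
  have "\<exists>l'\<in>I2. K2 l' * \<xi> \<noteq> 0\<^sub>m d 1"
  proof (rule ccontr)
    assume "\<not> ?thesis"
    then have 0: "K2 l' * \<xi> = 0\<^sub>m d 1" if "l' \<in> I2" for l' using that by auto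
    have "K2 l' * (\<xi> * adj \<xi>) * adj (K2 l') = 0\<^sub>m d d" if "l' \<in> I2" for l'
    proof -
      have "K2 l' * (\<xi> * adj \<xi>) * adj (K2 l') = (K2 l' * \<xi>) * adj (K2 l' * \<xi>)"
        using K2c[OF that] \<xi>c by (simp add: adj_mult mat_mult_assoc)
      also have "\<dots> = 0\<^sub>m d d" by (simp add: 0[OF that] adj_zero)
      finally show ?thesis .
    qed
    then have "app \<Lambda>2 (\<xi> * adj \<xi>) = 0\<^sub>m d d"
      using K2 b \<xi>c by (auto simp: kraus_def msum_def intro!: eq_matI simp del: index_mult_mat(1))
    moreover have "\<xi> * adj \<xi> \<in> carrier_mat (src \<Lambda>2) (src \<Lambda>2)" using \<xi>c b by auto
    then have "tr (app \<Lambda>2 (\<xi> * adj \<xi>)) = tr (\<xi> * adj \<xi>)"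
      using b by (simp add: cptp_def trace_preserving_def)
    ultimately have "tr (\<xi> * adj \<xi>) = 0" by (simp add: tr_def)
    moreover have "tr (\<xi> * adj \<xi>) = tr (adj \<xi> * \<xi>)" by (rule tr_comm) auto
    ultimately have \<xi>0: "\<xi> = 0\<^sub>m (card Z * k) 1" using tr_adj_mult_le_0[of \<xi>] \<xi>c by simp
    have "\<kappa> = 0\<^sub>m k 1"
    proof (rule eq_matI)
      fix m c assume "m < dim_row (0\<^sub>m k 1 :: complex mat)" "c < dim_col (0\<^sub>m k 1 :: complex mat)"
      then have m: "m < k" "c = 0" by auto
      have "\<xi> $$ (?z * k + m, 0 * 1 + 0) = ket (card Z) ?z $$ (?z, 0) * \<kappa> $$ (m, 0)"
        unfolding \<xi>_def using z m \<kappa>c by (intro kron_index) auto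
      then show "\<kappa> $$ (m, c) = 0\<^sub>m k 1 $$ (m, c)" using z m by (simp add: \<xi>0 ket_def mult_add_less)
    qed (use \<kappa>c in auto)
    then show False using \<kappa>0 by simp
  qed
  then obtain l' where l': "l' \<in> I2" "K2 l' * \<xi> \<noteq> 0\<^sub>m d 1" by auto
  have "\<exists>y<d. (K2 l' * \<xi>) $$ (y, 0) \<noteq> 0"
  proof (rule ccontr)
    assume "\<not> ?thesis"
    then have "K2 l' * \<xi> = 0\<^sub>m d 1"
      using K2c[OF l'(1)] \<xi>c by (intro eq_matI) (auto simp del: index_mult_mat(1))
    then show False using l' by simp
  qed
  then obtain y where y: "y < d" "(K2 l' * \<xi>) $$ (y, 0) \<noteq> 0" by auto
  have "?C (l', (u, w), j) $$ (?z * d + y, pair_index U V (u, v))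
    = kron (ket (card Z) ?z) (K2 l' * \<xi>) $$ (?z * d + y, 0 * 1 + 0)"
    unfolding mult_ket_index[OF opc[OF l'(1), of u] lt[OF u(3)] mult_add_less[OF z y(1)], symmetric]
      ideal_op_column[OF u(3,3) v fin(1,2), where ?f = f and ?K1.0 = K1 and ?K2.0 = K2 and j = j and l = l', OF K1c K2c[OF l'(1)] \<kappa>_def]
    by (simp add: \<xi>_def del: index_mult_mat(1))
  also have "\<dots> = ket (card Z) ?z $$ (?z, 0) * (K2 l' * \<xi>) $$ (y, 0)"
    using z y K2c[OF l'(1)] \<xi>c by (intro kron_index) auto
  also have "\<dots> \<noteq> 0" using y z by (simp add: ket_def)
  finally show ?thesis using l' y by blast
qed

section \<open>Reduced states and outcome weights\<close>

lemma psd_kron_one: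
  assumes "psd n A"
  shows "psd (n * m) (kron A (1\<^sub>m m))"
proof -
  obtain B where B: "psd n B" "B * B = A" using psd_root[OF assms] .
  have Bc: "B \<in> carrier_mat n n" "adj B = B" using B(1) by (auto simp: psd_def)
  have "kron B (1\<^sub>m m) * adj (kron B (1\<^sub>m m)) = kron A (1\<^sub>m m)"
    using Bc by (simp add: adj_kron kron_mult B(2) mat_one_mult)
  then show ?thesis using psd_mult_adj[of "kron B (1\<^sub>m m)" "n * m" "n * m"] Bc
    by (metis carrier_matI carrier_matD kron_dim index_one_mat(2,3))
qed

text \<open>\<open>g a a'\<close> stands for the entry \<open>(a', a)\<close> of a reduced state, so
  this is the Born rule, with the partial trace over the other registers left inside
  \<open>g\<close>.\<close>

definition quad :: "nat \<Rightarrow> complex mat \<Rightarrow> (nat \<Rightarrow> nat \<Rightarrow> complex) \<Rightarrow> complex" where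
  "quad N M g = (\<Sum>a<N. \<Sum>a'<N. M $$ (a, a') * g a a')"

lemma tr_kron_one_mult:
  assumes M: "M \<in> carrier_mat N N" and \<rho>: "\<rho> \<in> carrier_mat (N * D) (N * D)"
  shows "tr (kron M (1\<^sub>m D) * \<rho>) = quad N M (\<lambda>a a'. \<Sum>r<D. \<rho> $$ (a' * D + r, a * D + r))"
proof -
  have "tr (kron M (1\<^sub>m D) * \<rho>) = (\<Sum>x<N * D. \<Sum>y<N * D. kron M (1\<^sub>m D) $$ (x, y) * \<rho> $$ (y, x))"
    using assms by (subst tr_mult) auto
  also have "\<dots> = (\<Sum>a<N. \<Sum>r<D. \<Sum>a'<N. \<Sum>r'<D. kron M (1\<^sub>m D) $$ (a * D + r, a' * D + r') * \<rho> $$ (a' * D + r', a * D + r))"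
    by (simp only: sum_lessThan_mult)
  also have "\<dots> = (\<Sum>a<N. \<Sum>r<D. \<Sum>a'<N. \<Sum>r'<D. if r' = r then M $$ (a, a') * \<rho> $$ (a' * D + r', a * D + r) else 0)"
    using M by (intro sum.cong refl) (subst kron_index, auto)
  also have "\<dots> = (\<Sum>a<N. \<Sum>r<D. \<Sum>a'<N. M $$ (a, a') * \<rho> $$ (a' * D + r, a * D + r))"
    by simp
  also have "\<dots> = (\<Sum>a<N. \<Sum>a'<N. \<Sum>r<D. M $$ (a, a') * \<rho> $$ (a' * D + r, a * D + r))"
    by (intro sum.cong refl sum.swap)
  finally show ?thesis by (simp add: quad_def sum_distrib_left)
qed

text \<open>For a rank-one measurement operator the Born rule gives the squared norm of the
  superposition with coefficients \<open>cnj (y a)\<close>. When \<open>y\<close> is a column of the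
  matrix from \<open>kraus_freedom\<close>, that superposition is a column of a Kraus operator of
  the ideal side.\<close>

lemma quad_rank_one:
  "quad N (mat N N (\<lambda>(a, a'). y a * cnj (y a'))) (\<lambda>a a'. \<Sum>s<t. g a' s * cnj (g a s))
    = of_real (\<Sum>s<t. (cmod (\<Sum>a<N. cnj (y a) * g a s))\<^sup>2)"
proof -
  have "quad N (mat N N (\<lambda>(a, a'). y a * cnj (y a'))) (\<lambda>a a'. \<Sum>s<t. g a' s * cnj (g a s))
    = (\<Sum>a<N. \<Sum>a'<N. \<Sum>s<t. (cnj (y a') * g a' s) * (y a * cnj (g a s)))"
    by (simp add: quad_def sum_distrib_left mult_ac)
  also have "\<dots> = (\<Sum>a<N. \<Sum>s<t. \<Sum>a'<N. (cnj (y a') * g a' s) * (y a * cnj (g a s)))"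
    by (intro sum.cong refl sum.swap)
  also have "\<dots> = (\<Sum>s<t. \<Sum>a<N. \<Sum>a'<N. (cnj (y a') * g a' s) * (y a * cnj (g a s)))"
    by (rule sum.swap)
  also have "\<dots> = (\<Sum>s<t. (\<Sum>a'<N. cnj (y a') * g a' s) * cnj (\<Sum>a<N. cnj (y a) * g a s))"
    by (intro sum.cong refl, subst sum.swap) (simp add: sum_product)
  also have "\<dots> = of_real (\<Sum>s<t. (cmod (\<Sum>a<N. cnj (y a) * g a s))\<^sup>2)"
    by (simp only: complex_norm_square of_real_sum)
  finally show ?thesis .
qed

text \<open>The diagonal of the completeness relation: the squared amplitudes out of basis state
  \<open>i\<close> form a probability distribution over Kraus index and output.\<close>

lemma kraus_weight:
  assumes "kraus E I K" "trace_preserving E" "i < src E"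
  shows "(\<Sum>k\<in>I. \<Sum>r<trg E. (cmod (K k $$ (r, i)))\<^sup>2) = 1"
proof -
  have "complex_of_real (\<Sum>k\<in>I. \<Sum>r<trg E. (cmod (K k $$ (r, i)))\<^sup>2)
    = (\<Sum>k\<in>I. \<Sum>r<trg E. cnj (K k $$ (r, i)) * K k $$ (r, i))"
    by (simp only: of_real_sum complex_norm_square mult.commute)
  also have "\<dots> = 1"
    using isometric_index[OF kraus_isometric[OF assms(1,2)], of "trg E" i i] assms by (auto simp: kraus_def)
  finally show ?thesis by (metis of_real_eq_1_iff)
qed

lemma two_party_protocolD:
  assumes "two_party_protocol \<pi> U V Z"
  shows "to_alice \<pi> 0 = 1" "to_bob \<pi> 0 = 1" "mem (alice \<pi>) 0 = card U" "mem (alice \<pi>) (rounds \<pi>) = card Z"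
    "mem (bob \<pi>) 0 = card V" "mem (bob \<pi>) (rounds \<pi>) = card Z"
    "alice_strategy \<pi> (card U) (alice \<pi>)" "bob_strategy \<pi> (card V) (bob \<pi>)"
    "\<And>i. i \<le> rounds \<pi> \<Longrightarrow> 0 < to_alice \<pi> i" "\<And>i. i \<le> rounds \<pi> \<Longrightarrow> 0 < to_bob \<pi> i"
  using assms by (auto simp: two_party_protocol_def alice_strategy_def bob_strategy_def)

lemma exec_dim_rounds:
  "two_party_protocol \<pi> U V Z \<Longrightarrow> exec_dim \<pi> A B (rounds \<pi>) = mem A (rounds \<pi>) * mem B (rounds \<pi>)"
  by (simp add: two_party_protocol_def exec_dim_def)

section \<open>Functions that do not depend on Bob's input\<close>

text \<open>Discards each message and answers with basis state 0. The map is written as its own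
  Kraus sum, which makes \<open>kraus\<close> immediate; the completeness relation rests on message
  dimensions being positive, so that state 0 exists.\<close>

definition idle_player :: "protocol \<Rightarrow> player" where
  "idle_player \<pi> = \<lparr>mem = (\<lambda>_. 1), act = (\<lambda>i. \<lparr>src = to_alice \<pi> i, trg = to_bob \<pi> (Suc i),
     app = (\<lambda>\<rho>. msum (to_bob \<pi> (Suc i)) {..<to_alice \<pi> i}
       (\<lambda>k. (ket (to_bob \<pi> (Suc i)) 0 * bra (to_alice \<pi> i) k) * \<rho> * adj (ket (to_bob \<pi> (Suc i)) 0 * bra (to_alice \<pi> i) k)))\<rparr>)\<rparr>"

lemma ket_bra: "ket t i * bra s j = mat t s (\<lambda>(r, c). if r = i \<and> c = j then 1 else 0)"
  by (rule eq_matI) (auto simp: mult_mat_index ket_def bra_def simp del: index_mult_mat(1))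

lemma idle_kraus:
  assumes "\<And>i. i \<le> rounds \<pi> \<Longrightarrow> 0 < to_bob \<pi> i"
  shows "alice_kraus \<pi> (idle_player \<pi>) (to_alice \<pi>) (\<lambda>i k. ket (to_bob \<pi> (Suc i)) 0 * bra (to_alice \<pi> i) k)"
  unfolding alice_kraus_def
proof (intro allI impI)
  fix i assume "i < rounds \<pi>"
  then have t: "0 < to_bob \<pi> (Suc i)" using assms by simp
  let ?s = "to_alice \<pi> i" and ?t = "to_bob \<pi> (Suc i)"
  have "isometric ?s {..<?s} (\<lambda>k. ket ?t 0 * bra ?s k)"
    unfolding isometric_def
  proof (intro allI impI)
    fix x y assume xy: "x < ?s" "y < ?s"
    have "(adj (ket ?t 0 * bra ?s k) * (ket ?t 0 * bra ?s k)) $$ (x, y) = (if k = x then if x = y then 1 else 0 else 0)" for k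
      unfolding ket_bra using xy t
      by (subst mult_mat_index) (auto simp: if_distrib sum.If_cases cong: if_cong)
    then show "(\<Sum>k<?s. (adj (ket ?t 0 * bra ?s k) * (ket ?t 0 * bra ?s k)) $$ (x, y)) = (if x = y then 1 else 0)"
      using xy by simp
  qed
  then show "kraus (act (idle_player \<pi>) i) {..<?s} (\<lambda>k. ket ?t 0 * bra ?s k) \<and>
      isometric (src (act (idle_player \<pi>) i)) {..<?s} (\<lambda>k. ket ?t 0 * bra ?s k) \<and>
      src (act (idle_player \<pi>) i) = mem (idle_player \<pi>) i * ?s \<and> trg (act (idle_player \<pi>) i) = mem (idle_player \<pi>) (Suc i) * ?t"
    by (auto simp: idle_player_def kraus_def intro!: carrier_matI)
qed

text \<open>The conclusion of the theorem as a predicate, shared by the degenerate cases and the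
  main argument.\<close>

definition alice_learns ::
  "protocol \<Rightarrow> ('u \<Rightarrow> 'v \<Rightarrow> 'z) \<Rightarrow> 'u set \<Rightarrow> 'v set \<Rightarrow> 'z set \<Rightarrow> bool" where
  "alice_learns \<pi> f U V Z \<longleftrightarrow>
    (\<exists>A m M (h :: nat \<Rightarrow> 'u \<Rightarrow> 'z). alice_strategy \<pi> 1 A \<and> povm (mem A (rounds \<pi>)) m M \<and>
      (\<forall>w < m. \<forall>u \<in> U. h w u \<in> Z) \<and>
      (\<forall>v \<in> V. (\<Sum>w | w < m \<and> (\<forall>u \<in> U. h w u = f u v). outcome_prob \<pi> A M V v w) = 1))"

text \<open>Nothing has to be learned from Bob, so a measurement with a single outcome on a register
  of dimension 1 suffices; its probability is 1 by trace preservation.\<close>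

lemma cheating_constant:
  assumes fin: "finite V" and prot: "two_party_protocol \<pi> U V Z"
    and g: "\<And>u. u \<in> U \<Longrightarrow> g u \<in> Z" "\<And>u v. u \<in> U \<Longrightarrow> v \<in> V \<Longrightarrow> f u v = g u"
  shows "alice_learns \<pi> f U V Z"
  unfolding alice_learns_def
proof (intro exI conjI ballI)
  let ?A = "idle_player \<pi>" and ?M = "\<lambda>_. 1\<^sub>m 1" and ?h = "\<lambda>_. g"
  note D = two_party_protocolD[OF prot]
  note start = D(1,2) and bob = D(8) and pos = D(10)
  note A = idle_kraus[OF pos]
  obtain nB KB where B: "bob_kraus \<pi> (bob \<pi>) nB KB" using bob_strategy_kraus[OF bob] .
  show "alice_strategy \<pi> 1 ?A" using alice_kraus_strategy[OF A] by (simp add: idle_player_def)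
  show "povm (mem ?A (rounds \<pi>)) 1 ?M"
    using psd_mult_adj[of "1\<^sub>m 1" 1 1]
    by (auto simp: povm_def idle_player_def msum_def intro!: eq_matI)
  show "\<forall>w<1. \<forall>u\<in>U. ?h w u \<in> Z" using g by simp
  fix v assume v: "v \<in> V"
  let ?E = "execution \<pi> ?A (bob \<pi>)"
  let ?in = "kron (1\<^sub>m 1) (basis_state V v)"
  note k = kraus_exec[OF A B start order_refl, folded execution_def]
  have tp: "trace_preserving ?E" using exec_trace_preserving[OF A B start order_refl] by (simp add: execution_def)
  have inc: "?in \<in> carrier_mat (src ?E) (src ?E)"
    using k bob by (simp add: idle_player_def bob_strategy_def)
  have "app ?E ?in \<in> carrier_mat (trg ?E) (trg ?E)"
    using linear_qmap_carrier[OF _ inc] k kraus_imp_linear by blast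
  moreover have "trg ?E = mem (bob \<pi>) (rounds \<pi>)"
    using k by (simp add: exec_dim_rounds[OF prot] idle_player_def)
  ultimately have "outcome_prob \<pi> ?A ?M V v 0 = Re (tr (app ?E ?in))"
    by (simp add: outcome_prob_def mat_one_mult)
  also have "\<dots> = Re (tr ?in)" using tp inc by (simp add: trace_preserving_def)
  also have "\<dots> = 1" using to_nat_on_less[OF fin v] by (simp add: basis_state_def tr_ketbra)
  moreover have "{w. w < 1 \<and> (\<forall>u\<in>U. ?h w u = f u v)} = {0 :: nat}" using g v by auto
  ultimately show "(\<Sum>w | w < 1 \<and> (\<forall>u\<in>U. ?h w u = f u v). outcome_prob \<pi> ?A ?M V v w) = 1" by simp
qed

section \<open>The cheating strategy\<close>

text \<open>Two executions share their amplitudes: cheating Alice with environment \<open>a\<close>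
  against honest Bob with Kraus indices \<open>b\<close>, and honest Alice with Kraus indices
  \<open>a\<close> against purified Bob with environment \<open>b\<close>. Both come down to the
  trajectory of the honest players for \<open>a\<close> and \<open>b\<close>. Since
  \<open>M w\<close> acts on Alice's environment alone, all the rest, including \<open>b\<close>, is
  summed out.\<close>

lemma outcome_prob_traj:
  assumes prot: "two_party_protocol \<pi> U V Z" and fin: "finite V" and rounds: "0 < rounds \<pi>"
    and A: "alice_kraus \<pi> (alice \<pi>) nA KA" and B: "bob_kraus \<pi> (bob \<pi>) nB KB"
    and j: "j < card U" and v: "v \<in> V"
    and N: "N = env_dim nA (rounds \<pi>)" and M: "M w = kron Q (1\<^sub>m (card Z))" and Q: "Q \<in> carrier_mat N N"
    and A0: "A0 = prepared (alice \<pi>) j" and K0: "K0 = prepared_ops (alice \<pi>) j KA"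
    and i: "i = j * card V + to_nat_on V v" and eB: "eB = env_dim nB (rounds \<pi>)"
    and G: "\<And>a. G a = traj \<pi> (alice \<pi>) nA KA (purified_bob \<pi> (bob \<pi>) nB KB)
      (\<lambda>_. Suc 0) (\<lambda>i _. purify_bob \<pi> (bob \<pi>) nB KB i) (rounds \<pi>) a 0"
  shows "outcome_prob \<pi> (purified_alice \<pi> A0 nA K0) M V v w
    = Re (quad N Q (\<lambda>a a'. \<Sum>s<card Z * (card Z * eB). G a' $$ (s, i) * cnj (G a $$ (s, i))))"
proof -
  let ?n = "rounds \<pi>" and ?D = "card Z * card Z" and ?v = "to_nat_on V v"
  let ?B = "bob \<pi>" and ?A = "alice \<pi>"
  note D = two_party_protocolD[OF prot]
  note start = D(1,2) and alice = D(3,4) and bob = D(5,6) and strat = D(7,8)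
  have vlt: "?v < card V" using to_nat_on_less[OF fin v] .
  let ?A' = "purified_alice \<pi> A0 nA K0"
  let ?T' = "traj \<pi> ?A' (\<lambda>_. Suc 0) (\<lambda>i _. purify_alice \<pi> A0 nA K0 i) ?B nB KB ?n 0"
  let ?Tprep = "traj \<pi> A0 nA K0 ?B nB KB ?n"
  let ?T = "traj \<pi> ?A nA KA ?B nB KB ?n"
  have A0k: "alice_kraus \<pi> A0 nA K0"
    unfolding A0 K0 using A start(1) j alice by (intro prepared_kraus) auto
  have A'k: "alice_kraus \<pi> ?A' (\<lambda>_. Suc 0) (\<lambda>i _. purify_alice \<pi> A0 nA K0 i)"
    by (rule purified_alice_kraus[OF A0k])
  have A0m: "mem A0 ?n = card Z" "mem A0 0 = 1" using rounds alice by (auto simp: A0 prepared_def)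
  have A'm: "mem ?A' ?n = N * card Z" "mem ?A' 0 = 1" using A0m by (auto simp: purified_alice_def N)
  let ?E = "execution \<pi> ?A' ?B"
  note kE = kraus_exec[OF A'k B start order_refl, folded execution_def]
  have sE: "src ?E = card V" "trg ?E = N * ?D"
    using kE bob A'm exec_dim_rounds[OF prot] by (auto simp: mult.assoc)
  define \<rho> where "\<rho> = app ?E (ketbra (card V) ?v ?v)"
  have \<rho>c: "\<rho> \<in> carrier_mat (N * ?D) (N * ?D)"
    using linear_qmap_carrier[OF kraus_imp_linear[OF conjunct1[OF kE]]] sE by (auto simp: \<rho>_def)
  have entry: "?T' b $$ (a * ?D + r, ?v) = G a $$ (r * eB + b, i)"
    if "a < N" "b < eB" "r < ?D" for a b r
  proof -
    have dims: "exec_dim \<pi> A0 ?B ?n = ?D" "exec_dim \<pi> ?A' ?B ?n = N * ?D" "exec_dim \<pi> ?A ?B ?n = ?D"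
      "exec_dim \<pi> ?A (purified_bob \<pi> ?B nB KB) ?n = ?D * eB"
      using exec_dim_rounds[OF prot] A0m A'm bob alice by (auto simp: purified_bob_def eB)
    have T'c: "?T' b \<in> carrier_mat (N * ?D) (card V)"
      using traj_carrier[OF A'k B start order_refl, of 0 b] that dims A'm bob by (simp add: eB)
    have Tc: "?T a b \<in> carrier_mat ?D (card U * card V)"
      using traj_carrier[OF A B start order_refl, of a b] that dims alice bob by (simp add: eB N)
    have Gc: "G a \<in> carrier_mat (?D * eB) (card U * card V)"
      using traj_carrier[OF A purified_bob_kraus[OF B] start order_refl, of a 0] that dims alice bob
      by (simp add: G N purified_bob_def)
    have "?T' b $$ (a * ?D + r, ?v) = (kron (bra N a) (1\<^sub>m ?D) * ?T' b) $$ (r, ?v)"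
      using bra_left_index[OF T'c] that vlt by simp
    also have "\<dots> = ?Tprep a b $$ (r, ?v)"
      using traj_purified_alice[OF A0k B start order_refl, of a b] that dims by (simp add: N eB)
    also have "\<dots> = (?T a b * kron (ket (card U) j) (1\<^sub>m (card V))) $$ (r, ?v)"
      unfolding A0 K0
      using traj_prepared[OF A B start, of j ?n a b] that j alice bob rounds by (simp add: N eB)
    also have "\<dots> = (?T a b * kron (ket (card U) j) (1\<^sub>m (card V)) * ket (card V) ?v) $$ (r, 0)"
      using Tc vlt that by (intro mult_ket_index[of _ ?D "card V", symmetric]) (auto intro!: carrier_matI)
    also have "\<dots> = (?T a b * (kron (ket (card U) j) (1\<^sub>m (card V)) * kron (1\<^sub>m 1) (ket (card V) ?v))) $$ (r, 0)"
      using Tc by (simp add: mat_mult_assoc)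
    also have "kron (ket (card U) j) (1\<^sub>m (card V)) * kron (1\<^sub>m 1) (ket (card V) ?v) = kron (ket (card U) j) (ket (card V) ?v)"
      by (subst kron_mult) (auto simp: mat_one_mult simp del: One_nat_def)
    also have "\<dots> = ket (card U * card V) i" using vlt by (simp add: kron_ket i)
    also have "(?T a b * ket (card U * card V) i) $$ (r, 0) = ?T a b $$ (r, i)"
      using Tc that j vlt by (intro mult_ket_index) (auto simp: i mult_add_less)
    also have "\<dots> = (kron (1\<^sub>m ?D) (bra eB b) * G a) $$ (r, i)"
      using traj_purified_bob[OF A B start order_refl, of a b] that dims by (simp add: N eB G)
    also have "\<dots> = G a $$ (r * eB + b, i)"
      using bra_right_index[OF Gc] that j vlt by (simp add: i mult_add_less)
    finally show ?thesis .
  qed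
  have \<rho>i: "\<rho> $$ (a' * ?D + r, a * ?D + r) = (\<Sum>b<eB. G a' $$ (r * eB + b, i) * cnj (G a $$ (r * eB + b, i)))"
    if "a < N" "a' < N" "r < ?D" for a a' r
  proof -
    have "\<rho> $$ (a' * ?D + r, a * ?D + r)
      = (\<Sum>(x, b)\<in>{..<Suc 0} \<times> {..<eB}. ?T' b $$ (a' * ?D + r, ?v) * cnj (?T' b $$ (a * ?D + r, ?v)))"
      unfolding \<rho>_def using kraus_ketbra[OF conjunct1[OF kE], of ?v ?v "a' * ?D + r" "a * ?D + r"] sE vlt that
      by (simp add: mult_add_less eB split_def) (simp add: sum.cartesian_product')
    also have "\<dots> = (\<Sum>b<eB. ?T' b $$ (a' * ?D + r, ?v) * cnj (?T' b $$ (a * ?D + r, ?v)))"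
      by (simp add: sum.cartesian_product')
    also have "\<dots> = (\<Sum>b<eB. G a' $$ (r * eB + b, i) * cnj (G a $$ (r * eB + b, i)))"
      using that by (intro sum.cong refl) (simp add: entry)
    finally show ?thesis .
  qed
  have "outcome_prob \<pi> ?A' M V v w = Re (tr (kron Q (1\<^sub>m ?D) * \<rho>))"
    by (simp add: outcome_prob_def M bob kron_assoc kron_one \<rho>_def basis_state_def)
  also have "tr (kron Q (1\<^sub>m ?D) * \<rho>) = quad N Q (\<lambda>a a'. \<Sum>r<?D. \<rho> $$ (a' * ?D + r, a * ?D + r))"
    by (rule tr_kron_one_mult[OF Q \<rho>c])
  also have "\<dots> = quad N Q (\<lambda>a a'. \<Sum>s<card Z * (card Z * eB). G a' $$ (s, i) * cnj (G a $$ (s, i)))"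
    unfolding quad_def mult.assoc[symmetric, of "card Z" "card Z" eB] sum_lessThan_mult[of _ ?D eB]
    by (intro sum.cong refl) (simp add: \<rho>i)
  finally show ?thesis .
qed

text \<open>On the uniform input, correctness equates the honest channel with the functionality,
  whose Kraus operators have a single non-zero entry. A possible output exhibits that entry, and its
  column determines \<open>u\<close> and \<open>v\<close>.\<close>

lemma correct_output:
  assumes fin: "finite U" "finite V" "finite Z" and f: "\<And>u v. u \<in> U \<Longrightarrow> v \<in> V \<Longrightarrow> f u v \<in> Z"
    and prot: "two_party_protocol \<pi> U V Z" and cor: "correct 0 \<pi> f U V Z"
    and u: "u \<in> U" and v: "v \<in> V" and xy: "x < card Z" "y < card Z"
    and nz: "app (execution \<pi> (alice \<pi>) (bob \<pi>))
      (ketbra (card U * card V) (pair_index U V (u, v)) (pair_index U V (u, v))) $$ (x * card Z + y, x * card Z + y) \<noteq> 0"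
  shows "x = to_nat_on Z (f u v)" "y = to_nat_on Z (f u v)"
proof -
  let ?H = "execution \<pi> (alice \<pi>) (bob \<pi>)" and ?I = "ideal_functionality f U V Z"
  let ?d = "card U * card V" and ?i = "pair_index U V (u, v)" and ?R = "x * card Z + y"
  note D = two_party_protocolD[OF prot]
  note start = D(1,2) and alice = D(3,4) and bob = D(5,6) and strat = D(7,8)
  obtain nA KA where A: "alice_kraus \<pi> (alice \<pi>) nA KA" using alice_strategy_kraus[OF strat(1)] .
  obtain nB KB where B: "bob_kraus \<pi> (bob \<pi>) nB KB" using bob_strategy_kraus[OF strat(2)] .
  note kH = kraus_exec[OF A B start order_refl, folded execution_def]
  have sH: "src ?H = ?d" "trg ?H = card Z * card Z" using kH exec_dim_rounds[OF prot] alice bob by auto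
  have tpH: "trace_preserving ?H" using exec_trace_preserving[OF A B start order_refl] by (simp add: execution_def)
  have kI: "kraus ?I (U \<times> V) (func_mat f U V Z)" by (rule ideal_kraus[OF fin], erule (1) f)
  have tpI: "trace_preserving ?I" by (rule ideal_trace_preserving[OF fin], erule (1) f)
  have prob: "prob_dist (U \<times> V) (uniform (U \<times> V))" using fin u v by (intro prob_dist_uniform) auto
  note lt = to_nat_on_less[OF fin(1) u] to_nat_on_less[OF fin(2) v]
  have i: "?i < ?d" using lt by (simp add: pair_index_def mult_add_less)
  have R: "?R < card Z * card Z" using xy by (simp add: mult_add_less)
  have ne: "U \<noteq> {}" "V \<noteq> {}" using u v by auto
  have "app ?I (ketbra ?d ?i ?i) $$ (?R, ?R) \<noteq> 0"
    using close_0_uniform_imp_eq[OF fin(1,2) ne conjunct1[OF kH] tpH kI tpI, of ?i ?i ?R ?R] sH cor prob i R nz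
    unfolding correct_def by simp
  then obtain u2 v2 where 2: "u2 \<in> U" "v2 \<in> V" "func_mat f U V Z (u2, v2) $$ (?R, ?i) \<noteq> 0"
    using kraus_diag_nonzero[OF kI, of ?i ?R] i R by auto
  then have eqs: "x = to_nat_on Z (f u2 v2)" "y = to_nat_on Z (f u2 v2)"
      "to_nat_on U u = to_nat_on U u2" "to_nat_on V v = to_nat_on V v2"
    unfolding pair_index_def split func_mat_index[OF xy lt] by presburger+
  have "u = u2" "v = v2"
    using eqs(3,4) to_nat_on_eq_iff[OF fin(1) u 2(1)] to_nat_on_eq_iff[OF fin(2) v 2(2)] by blast+
  then show "x = to_nat_on Z (f u v)" "y = to_nat_on Z (f u v)" using eqs(1,2) by blast+
qed

lemma cheating_main:
  assumes fin: "finite U" "finite V" "finite Z" and f: "\<And>u v. u \<in> U \<Longrightarrow> v \<in> V \<Longrightarrow> f u v \<in> Z"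
    and prot: "two_party_protocol \<pi> U V Z" and cor: "correct 0 \<pi> f U V Z"
    and sec: "secure_against_bob 0 \<pi> f U V Z"
    and ne: "U \<noteq> {}" "V \<noteq> {}" and rounds: "0 < rounds \<pi>"
  shows "alice_learns \<pi> f U V Z"
proof -
  let ?n = "rounds \<pi>" and ?A = "alice \<pi>" and ?B = "bob \<pi>" and ?d = "card U * card V"
  note D = two_party_protocolD[OF prot]
  note start = D(1,2) and alice = D(3,4) and bob = D(5,6) and strat = D(7,8)
  obtain nA KA where A: "alice_kraus \<pi> ?A nA KA" using alice_strategy_kraus[OF strat(1)] .
  obtain nB KB where B: "bob_kraus \<pi> ?B nB KB" using bob_strategy_kraus[OF strat(2)] .
  define N eB where "N = env_dim nA ?n" and "eB = env_dim nB ?n"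
  define B' where "B' = purified_bob \<pi> ?B nB KB"
  have B'k: "bob_kraus \<pi> B' (\<lambda>_. Suc 0) (\<lambda>i _. purify_bob \<pi> ?B nB KB i)"
    unfolding B'_def by (rule purified_bob_kraus[OF B])
  have B'm: "mem B' 0 = card V" "mem B' ?n = card Z * eB" using bob by (auto simp: B'_def purified_bob_def eB_def)
  let ?T = "traj \<pi> ?A nA KA ?B nB KB ?n"
  define G where "G a = traj \<pi> ?A nA KA B' (\<lambda>_. Suc 0) (\<lambda>i _. purify_bob \<pi> ?B nB KB i) ?n a 0" for a
  let ?E = "execution \<pi> ?A B'" and ?H = "execution \<pi> ?A ?B"
  let ?d2 = "card Z * eB"
  let ?t = "card Z * ?d2"
  note kE0 = kraus_exec[OF A B'k start order_refl, folded execution_def]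
  note kH = kraus_exec[OF A B start order_refl, folded execution_def]
  \<comment> \<open>Purified Bob contributes only the index sequence 0, so the Kraus operators are
    indexed by Alice's sequences.\<close>
  have kE: "kraus ?E {..<N} G"
    using kE0 by (intro kraus_reindex[OF conjunct1[OF kE0], where g = "\<lambda>a. (a, 0)"])
      (auto simp: bij_betw_def inj_on_def G_def N_def)
  have sE: "src ?E = ?d" "trg ?E = ?t" using kE0 exec_dim_rounds[OF prot] alice B'm by auto
  have sH: "src ?H = ?d" "trg ?H = card Z * card Z" using kH exec_dim_rounds[OF prot] alice bob by auto
  have tpE: "trace_preserving ?E" using exec_trace_preserving[OF A B'k start order_refl] by (simp add: execution_def)
  have prob: "prob_dist (U \<times> V) (uniform (U \<times> V))" using fin ne by (intro prob_dist_uniform) auto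
  \<comment> \<open>Security enters once: for purified honest Bob and the uniform
    distribution.\<close>
  have "bob_strategy \<pi> (card V) B'" using bob_kraus_strategy[OF B'k] B'm by simp
  then obtain k \<Lambda>1 \<Lambda>2 where ib: "ideal_bob V Z ?d2 k \<Lambda>1 \<Lambda>2"
    and cl: "close 0 (on_input ?E U V (uniform (U \<times> V))) (on_input (ideal_with_bob f U V Z k \<Lambda>1 \<Lambda>2) U V (uniform (U \<times> V)))"
    using sec prob B'm unfolding secure_against_bob_def by metis
  let ?F = "ideal_with_bob f U V Z k \<Lambda>1 \<Lambda>2"
  obtain N1 :: nat and K1 where K1: "kraus \<Lambda>1 {..<N1} K1" using cptp_kraus ib unfolding ideal_bob_def by metis
  obtain N2 :: nat and K2 where K2: "kraus \<Lambda>2 {..<N2} K2" using cptp_kraus ib unfolding ideal_bob_def by metis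
  let ?J = "{..<N2} \<times> (U \<times> V) \<times> {..<N1}"
  let ?C = "ideal_op f U V Z k K1 K2"
  have kF: "kraus ?F ?J ?C" "trace_preserving ?F" "src ?F = ?d" "trg ?F = ?t"
    by (rule ideal_with_bob_kraus[OF fin _ ib K1 K2], erule (1) f)+
  have EF: "app ?E (ketbra ?d i j) $$ (r, c) = app ?F (ketbra ?d i j) $$ (r, c)"
    if "i < ?d" "j < ?d" "r < ?t" "c < ?t" for i j r c
    using close_0_uniform_imp_eq[OF fin(1,2) ne kE tpE kF(1,2)] kF(3,4) sE cl that by simp
  \<comment> \<open>Measurement outcomes are natural numbers, so the Kraus indices of the ideal side
    are enumerated.\<close>
  define m where "m = card ?J"
  obtain e where e: "bij_betw e {..<m} ?J"
    using ex_bij_betw_nat_finite[of ?J] fin by (auto simp: m_def atLeast0LessThan)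
  have kF': "kraus ?F {..<m} (\<lambda>w. ?C (e w))" by (rule kraus_reindex[OF kF(1) e]) simp
  obtain Y where Y: "Y \<in> carrier_mat N m" "psd N (1\<^sub>m N - Y * adj Y)"
    and CY: "\<And>c r i. c < m \<Longrightarrow> r < ?t \<Longrightarrow> i < ?d \<Longrightarrow> ?C (e c) $$ (r, i) = (\<Sum>a<N. cnj (Y $$ (a, c)) * G a $$ (r, i))"
    by (rule kraus_freedom[OF kE kF' sE(1) kF(3) sE(2) kF(4)], erule (3) EF, blast)
  obtain u0 where u0: "u0 \<in> U" using ne by auto
  obtain v0 where v0: "v0 \<in> V" using ne by auto
  define j where "j = to_nat_on U u0"
  have j: "j < card U" using to_nat_on_less[OF fin(1) u0] by (simp add: j_def)
  define A0 K0 where "A0 = prepared ?A j" and "K0 = prepared_ops ?A j KA"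
  define A' where "A' = purified_alice \<pi> A0 nA K0"
  \<comment> \<open>Each column of \<open>Y\<close> gives a rank-one operator; the extra outcome
    \<open>m\<close> takes the remainder and completes the sum to the identity.\<close>
  define Q where "Q w = (if w < m then mat N N (\<lambda>(a, a'). Y $$ (a, w) * cnj (Y $$ (a', w))) else 1\<^sub>m N - Y * adj Y)" for w
  define M where "M w = kron (Q w) (1\<^sub>m (card Z))" for w
  \<comment> \<open>Kraus indices have the form \<open>(l, (u', w'), j')\<close>; the projections
    extract \<open>w'\<close>, the input that the adversary gives to the functionality.\<close>
  define wit where "wit w = snd (fst (snd (e w)))" for w
  \<comment> \<open>\<open>v0\<close> is a default that keeps \<open>h\<close> inside
    \<open>Z\<close> for outcome \<open>m\<close>, whose probability turns out to be 0.\<close>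
  define h where "h w u = f u (if w < m then wit w else v0)" for w u
  have A0k: "alice_kraus \<pi> A0 nA K0"
    unfolding A0_def K0_def using A start(1) j alice by (intro prepared_kraus) auto
  have A'm: "mem A' ?n = N * card Z" "mem A' 0 = 1"
    using rounds alice by (auto simp: A'_def purified_alice_def A0_def prepared_def N_def)
  have 1: "alice_strategy \<pi> 1 A'"
    unfolding A'_def using alice_kraus_strategy[OF purified_alice_kraus[OF A0k]] A'm by (simp add: A'_def)
  have Qc: "Q w \<in> carrier_mat N N" for w using Y(1) by (auto simp: Q_def)
  have YY: "(Y * adj Y) $$ (a, a') = (\<Sum>w<m. Q w $$ (a, a'))" if "a < N" "a' < N" for a a'
    using Y(1) that by (subst mult_mat_index) (auto simp: Q_def)
  have Qsum: "(\<Sum>w<Suc m. Q w $$ (a, a')) = 1\<^sub>m N $$ (a, a')" if "a < N" "a' < N" for a a'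
  proof -
    have "Q m $$ (a, a') = 1\<^sub>m N $$ (a, a') - (Y * adj Y) $$ (a, a')"
      unfolding Q_def using that Y(1) by (simp del: index_mult_mat(1))
    then show ?thesis using YY[OF that] by simp
  qed
  have Qpsd: "psd N (Q w)" for w
  proof (cases "w < m")
    case True
    define y where "y = mat N 1 (\<lambda>(a, _). Y $$ (a, w))"
    have "Q w = y * adj y"
      using True by (intro eq_matI) (auto simp: Q_def y_def mult_mat_index simp del: index_mult_mat(1))
    then show ?thesis using psd_mult_adj[of y N 1] by (simp add: y_def)
  next
    case False
    then show ?thesis using Y by (simp add: Q_def)
  qed
  have 2: "povm (mem A' ?n) (Suc m) M"
    unfolding povm_def A'm(1)
  proof (intro conjI allI impI)
    show "psd (N * card Z) (M w)" for w unfolding M_def by (rule psd_kron_one[OF Qpsd])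
    show "msum (N * card Z) {..<Suc m} M = 1\<^sub>m (N * card Z)"
    proof (rule eq_mat_prodI[of _ N "card Z" N "card Z"])
      fix a r a' r' assume *: "a < N" "r < card Z" "a' < N" "r' < card Z"
      have "msum (N * card Z) {..<Suc m} M $$ (a * card Z + r, a' * card Z + r')
        = (\<Sum>w<Suc m. Q w $$ (a, a') * 1\<^sub>m (card Z) $$ (r, r'))"
      proof -
        have "kron (Q w) (1\<^sub>m (card Z)) $$ (a * card Z + r, a' * card Z + r')
          = Q w $$ (a, a') * 1\<^sub>m (card Z) $$ (r, r')" for w
          by (rule kron_index) (use * Qc[of w] in auto)
        then show ?thesis using * by (simp add: msum_index mult_add_less M_def del: sum.lessThan_Suc index_one_mat(1))
      qed
      also have "\<dots> = 1\<^sub>m N $$ (a, a') * 1\<^sub>m (card Z) $$ (r, r')"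
        using Qsum[OF *(1,3)] by (simp only: sum_distrib_right[symmetric])
      finally show "msum (N * card Z) {..<Suc m} M $$ (a * card Z + r, a' * card Z + r')
        = 1\<^sub>m (N * card Z) $$ (a * card Z + r, a' * card Z + r')"
        using * by (auto simp: mult_add_less mult_add_eq_iff)
    qed auto
  qed
  have wit: "wit w \<in> V" if "w < m" for w
  proof -
    have "e w \<in> ?J" using e that by (auto simp: bij_betw_def)
    then show ?thesis by (auto simp: wit_def)
  qed
  have 3: "\<forall>w<Suc m. \<forall>u\<in>U. h w u \<in> Z" using wit v0 f by (auto simp: h_def)
  have 4: "(\<Sum>w | w < Suc m \<and> (\<forall>u \<in> U. h w u = f u v). outcome_prob \<pi> A' M V v w) = 1" if v: "v \<in> V" for v
  proof -
    define i where "i = j * card V + to_nat_on V v"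
    have vlt: "to_nat_on V v < card V" using to_nat_on_less[OF fin(2) v] .
    have i: "i < ?d" using j vlt by (simp add: i_def mult_add_less)
    have ip: "i = pair_index U V (u0, v)" by (simp add: i_def j_def pair_index_def)
    let ?g = "\<lambda>a a'. \<Sum>s<?t. G a' $$ (s, i) * cnj (G a $$ (s, i))"
    have P: "outcome_prob \<pi> A' M V v w = Re (quad N (Q w) ?g)" for w
      unfolding A'_def
      by (rule outcome_prob_traj[OF prot fin(2) rounds A B j v N_def M_def Qc A0_def K0_def i_def eB_def])
        (simp add: G_def B'_def)
    \<comment> \<open>The superposition selected by column \<open>w\<close> of \<open>Y\<close> is
      exactly the ideal Kraus operator with index \<open>e w\<close>, so the outcome has the weight
      of that operator on the input.\<close>
    have Pw: "outcome_prob \<pi> A' M V v w = (\<Sum>s<?t. (cmod (?C (e w) $$ (s, i)))\<^sup>2)" if "w < m" for w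
    proof -
      have "Q w = mat N N (\<lambda>(a, a'). Y $$ (a, w) * cnj (Y $$ (a', w)))" using that by (simp add: Q_def)
      then have "quad N (Q w) ?g = of_real (\<Sum>s<?t. (cmod (\<Sum>a<N. cnj (Y $$ (a, w)) * G a $$ (s, i)))\<^sup>2)"
        by (simp only: quad_rank_one[of N "\<lambda>a. Y $$ (a, w)" "\<lambda>a s. G a $$ (s, i)" ?t])
      also have "(\<Sum>s<?t. (cmod (\<Sum>a<N. cnj (Y $$ (a, w)) * G a $$ (s, i)))\<^sup>2) = (\<Sum>s<?t. (cmod (?C (e w) $$ (s, i)))\<^sup>2)"
        using that i by (intro sum.cong refl) (simp add: CY)
      finally show ?thesis unfolding P by simp
    qed
    \<comment> \<open>Trace preservation of the ideal side gives the outcomes below \<open>m\<close>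
      total weight 1, which leaves nothing for outcome \<open>m\<close>.\<close>
    have total: "(\<Sum>w<m. outcome_prob \<pi> A' M V v w) = 1"
      using kraus_weight[OF kF' kF(2), of i] i kF(3,4) by (simp add: Pw)
    have all: "(\<Sum>w<Suc m. outcome_prob \<pi> A' M V v w) = 1"
    proof -
      have "(\<Sum>w<Suc m. quad N (Q w) ?g) = (\<Sum>a<N. \<Sum>w<Suc m. \<Sum>a'<N. Q w $$ (a, a') * ?g a a')"
        unfolding quad_def by (rule sum.swap)
      also have "\<dots> = (\<Sum>a<N. \<Sum>a'<N. \<Sum>w<Suc m. Q w $$ (a, a') * ?g a a')"
        by (intro sum.cong refl sum.swap)
      also have "\<dots> = (\<Sum>a<N. \<Sum>a'<N. 1\<^sub>m N $$ (a, a') * ?g a a')"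
        by (intro sum.cong refl) (simp only: sum_distrib_right[symmetric] Qsum lessThan_iff)
      also have "\<dots> = (\<Sum>a<N. \<Sum>a'<N. if a' = a then ?g a a' else 0)"
        by (intro sum.cong refl) auto
      also have "\<dots> = (\<Sum>a<N. ?g a a)" by simp
      also have "\<dots> = of_real (\<Sum>a<N. \<Sum>s<?t. (cmod (G a $$ (s, i)))\<^sup>2)"
        by (simp only: complex_norm_square of_real_sum)
      also have "\<dots> = 1" using kraus_weight[OF kE tpE, of i] i sE by simp
      finally show ?thesis unfolding P by (metis Re_sum one_complex.sel(1))
    qed
    have last: "outcome_prob \<pi> A' M V v m = 0" using all total by simp
    \<comment> \<open>A possible outcome shows that the adversary can choose \<open>w'\<close> on
      input \<open>v\<close>. This choice is then possible together with every \<open>u\<close>, and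
      Alice's ideal output is \<open>f u w'\<close>; equality of the channels carries this output
      over to the execution, where correctness forces it to be \<open>f u v\<close>.\<close>
    have bad: "outcome_prob \<pi> A' M V v w = 0" if w: "w < m" and "\<not> (\<forall>u\<in>U. h w u = f u v)" for w
    proof (rule ccontr)
      assume "outcome_prob \<pi> A' M V v w \<noteq> 0"
      then obtain s where s: "s < ?t" "?C (e w) $$ (s, i) \<noteq> 0"
        unfolding Pw[OF w] by (metis (no_types, lifting) lessThan_iff norm_zero power_zero_numeral sum.neutral)
      obtain l u' w' j' where ew: "e w = (l, (u', w'), j')" by (metis prod.exhaust)
      have "e w \<in> ?J" using e w by (auto simp: bij_betw_def)
      then have mem: "l < N2" "u' \<in> U" "w' \<in> V" "j' < N1" by (auto simp: ew)
      have w': "wit w = w'" by (simp add: wit_def ew)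
      have "h w u = f u v" if u: "u \<in> U" for u
      proof -
        let ?z = "to_nat_on Z (f u w')" and ?i = "pair_index U V (u, v)"
        have z: "?z < card Z" using to_nat_on_less[OF fin(3) f[OF u mem(3)]] .
        have il: "?i < ?d" using to_nat_on_less[OF fin(1) u] vlt by (simp add: pair_index_def mult_add_less)
        obtain l' y where y: "l' < N2" "y < ?d2" "?C (l', (u, w'), j') $$ (?z * ?d2 + y, ?i) \<noteq> 0"
          using ideal_op_column_transfer[where f = f and l = l and j = j' and ?I1.0 = "{..<N1}" and ?I2.0 = "{..<N2}",
            OF fin f[OF u mem(3)] u0 mem(2) u v _ _ ib K1 K2 s(1)]
          mem s(2) by (auto simp: ew ip)
        have r: "?z * ?d2 + y < ?t" using z y by (simp add: mult_add_less)
        have "app ?F (ketbra ?d ?i ?i) $$ (?z * ?d2 + y, ?z * ?d2 + y) \<noteq> 0"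
          using kraus_diag_nonzero[OF kF(1), of ?i "?z * ?d2 + y"] kF(3,4) il r y u mem by force
        then have "app ?E (ketbra ?d ?i ?i) $$ (?z * ?d2 + y, ?z * ?d2 + y) \<noteq> 0"
          using EF il r by simp
        then obtain a where a: "a < N" "G a $$ (?z * ?d2 + y, ?i) \<noteq> 0"
          using kraus_diag_nonzero[OF kE, of ?i "?z * ?d2 + y"] sE il r by auto
        obtain y1 b where yb: "y1 < card Z" "b < eB" "y = y1 * eB + b" using mult_add_cases[OF y(2)] .
        let ?R = "?z * card Z + y1"
        have R: "?R < card Z * card Z" using z yb by (simp add: mult_add_less)
        \<comment> \<open>The index is regrouped: Bob's purified output is split, so that the two
          honest outputs form one factor and his environment the other.\<close>
        have Rb: "?z * ?d2 + y = ?R * eB + b" using yb by (simp add: algebra_simps)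
        have dims: "exec_dim \<pi> ?A ?B ?n = card Z * card Z" "exec_dim \<pi> ?A B' ?n = card Z * card Z * eB"
          using exec_dim_rounds[OF prot] alice bob B'm by auto
        have Gc: "G a \<in> carrier_mat (card Z * card Z * eB) ?d"
          using traj_carrier[OF A B'k start order_refl, of a 0] a dims alice B'm by (simp add: G_def N_def)
        have "?T a b $$ (?R, ?i) = (kron (1\<^sub>m (card Z * card Z)) (bra eB b) * G a) $$ (?R, ?i)"
          using traj_purified_bob[OF A B start order_refl, of a b] a yb dims by (simp add: G_def N_def eB_def B'_def)
        also have "\<dots> = G a $$ (?z * ?d2 + y, ?i)"
          unfolding Rb by (rule bra_right_index[OF Gc yb(2) R il])
        finally have "?T a b $$ (?R, ?i) \<noteq> 0" using a by simp
        then have nz: "app ?H (ketbra ?d ?i ?i) $$ (?R, ?R) \<noteq> 0"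
          using kraus_diag_nonzero[OF conjunct1[OF kH], of ?i ?R] sH il R a(1) yb(2) by (force simp: N_def eB_def)
        have "?z = to_nat_on Z (f u v)"
          by (rule correct_output[OF fin _ prot cor u v z yb(1) nz], erule (1) f)
        then have "f u w' = f u v"
          using to_nat_on_eq_iff[OF fin(3) f[OF u mem(3)] f[OF u v]] by blast
        then show ?thesis using w by (simp add: h_def w')
      qed
      then show False using that by blast
    qed
    have "(\<Sum>w | w < Suc m \<and> (\<forall>u \<in> U. h w u = f u v). outcome_prob \<pi> A' M V v w)
      = (\<Sum>w<Suc m. outcome_prob \<pi> A' M V v w)"
    proof (rule sum.mono_neutral_left)
      show "\<forall>w\<in>{..<Suc m} - {w. w < Suc m \<and> (\<forall>u\<in>U. h w u = f u v)}. outcome_prob \<pi> A' M V v w = 0"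
      proof
        fix w assume "w \<in> {..<Suc m} - {w. w < Suc m \<and> (\<forall>u\<in>U. h w u = f u v)}"
        then have "w = m \<or> w < m" "\<not> (\<forall>u\<in>U. h w u = f u v)" by auto
        then show "outcome_prob \<pi> A' M V v w = 0" using bad[of w] last by blast
      qed
    qed auto
    then show ?thesis using all by simp
  qed
  show ?thesis unfolding alice_learns_def using 1 2 3 4 by blast
qed

theorem theorem1:
  fixes f :: "'u \<Rightarrow> 'v \<Rightarrow> 'z" and U :: "'u set" and V :: "'v set" and Z :: "'z set"
    and \<pi> :: protocol
  assumes "finite U" and "finite V" and "finite Z"
    and "\<And>u v. u \<in> U \<Longrightarrow> v \<in> V \<Longrightarrow> f u v \<in> Z"
    and "two_party_protocol \<pi> U V Z"
    and "correct 0 \<pi> f U V Z"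
    and "secure_against_bob 0 \<pi> f U V Z"
  shows "\<exists>(A :: player) (m :: nat) (M :: nat \<Rightarrow> complex mat) (h :: nat \<Rightarrow> 'u \<Rightarrow> 'z).
    alice_strategy \<pi> 1 A \<and>
    povm (mem A (rounds \<pi>)) m M \<and>
    (\<forall>w < m. \<forall>u \<in> U. h w u \<in> Z) \<and>
    (\<forall>v \<in> V. (\<Sum>w | w < m \<and> (\<forall>u \<in> U. h w u = f u v). outcome_prob \<pi> A M V v w) = 1)"
proof -
  note fin = assms(1-3) and f = assms(4) and prot = assms(5)
  \<comment> \<open>The main argument needs an input for Alice to prepare, a first operation to
    absorb the preparation, and a default input of Bob. The other cases come down to functions that
    do not depend on \<open>v\<close>.\<close>
  consider (U) "U = {}" | (V) "U \<noteq> {}" "V = {}" | (rounds) "U \<noteq> {}" "V \<noteq> {}" "rounds \<pi> = 0"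
    | (main) "U \<noteq> {}" "V \<noteq> {}" "0 < rounds \<pi>"
    by blast
  then have "alice_learns \<pi> f U V Z"
  proof cases
    case U
    then show ?thesis by (intro cheating_constant[OF fin(2) prot]) auto
  next
    case V
    \<comment> \<open>Values of \<open>h\<close> require an element of \<open>Z\<close>. A
      trace-preserving operation cannot lead from a non-zero to a zero dimension, so Alice's
      registers stay non-trivial up to her output, of dimension \<open>card Z\<close>.\<close>
    have pos: "i \<le> rounds \<pi> \<Longrightarrow> 0 < mem (alice \<pi>) i" for i
    proof (induction i)
      case 0
      then show ?case using prot fin V by (simp add: two_party_protocol_def alice_strategy_def card_gt_0_iff)
    next
      case (Suc i)
      let ?P = "act (alice \<pi>) i"
      have P: "cptp ?P" "src ?P = mem (alice \<pi>) i * to_alice \<pi> i" "trg ?P = mem (alice \<pi>) (Suc i) * to_bob \<pi> (Suc i)"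
        using prot Suc.prems by (auto simp: two_party_protocol_def alice_strategy_def)
      have "0 < src ?P" using Suc prot P by (simp add: two_party_protocol_def)
      then have "tr (app ?P (ketbra (src ?P) 0 0)) = 1"
        using P by (simp add: cptp_def trace_preserving_def tr_ketbra)
      moreover have "app ?P (ketbra (src ?P) 0 0) \<in> carrier_mat (trg ?P) (trg ?P)"
        using P(1) by (intro linear_qmap_carrier) (simp_all add: cptp_def)
      ultimately have "0 < trg ?P" by (cases "trg ?P") (auto simp: tr_def)
      then show ?case using P by simp
    qed
    have "card Z \<noteq> 0" using pos[of "rounds \<pi>"] prot by (simp add: two_party_protocol_def)
    then obtain z where "z \<in> Z" by fastforce
    then show ?thesis using V by (intro cheating_constant[OF fin(2) prot, where g = "\<lambda>_. z"]) auto
  next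
    case rounds
    obtain v0 where v0: "v0 \<in> V" using rounds by auto
    have cards: "card U = card Z" "card V = card Z"
      and m0: "mem (alice \<pi>) 0 = card U" "mem (bob \<pi>) 0 = card V"
      using prot rounds by (auto simp: two_party_protocol_def alice_strategy_def bob_strategy_def)
    have E: "execution \<pi> (alice \<pi>) (bob \<pi>) = id_map (card U * card V)"
      using rounds m0 by (simp add: execution_def)
    \<comment> \<open>Without rounds each player outputs the own input unchanged, so correctness
      identifies the index of \<open>f u v\<close> with that of \<open>u\<close>, for every
      \<open>v\<close>.\<close>
    have ideal: "to_nat_on U u = to_nat_on Z (f u v)" if u: "u \<in> U" and v: "v \<in> V" for u v
    proof -
      let ?i = "pair_index U V (u, v)"
      note lt = to_nat_on_less[OF fin(1) u] to_nat_on_less[OF fin(2) v]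
      have "?i < card U * card V" using lt by (simp add: pair_index_def mult_add_less)
      then have "app (execution \<pi> (alice \<pi>) (bob \<pi>)) (ketbra (card U * card V) ?i ?i) $$ (?i, ?i) \<noteq> 0"
        by (simp add: E)
      then have nz: "app (execution \<pi> (alice \<pi>) (bob \<pi>)) (ketbra (card U * card V) ?i ?i) $$
          (to_nat_on U u * card Z + to_nat_on V v, to_nat_on U u * card Z + to_nat_on V v) \<noteq> 0"
        using cards(2) by (simp add: pair_index_def)
      show ?thesis
        by (rule correct_output[OF fin _ prot assms(6) u v lt[unfolded cards] nz], erule (1) f)
    qed
    have const: "f u v = f u v0" if "u \<in> U" "v \<in> V" for u v
    proof -
      have "to_nat_on Z (f u v) = to_nat_on Z (f u v0)"
        using ideal[OF that] ideal[OF that(1) v0] by (rule subst)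
      then show ?thesis using to_nat_on_eq_iff[OF fin(3) f[OF that] f[OF that(1) v0]] by blast
    qed
    show ?thesis
      by (rule cheating_constant[OF fin(2) prot, where g = "\<lambda>u. f u v0"], erule f[OF _ v0], erule (1) const)
  next
    case main
    show ?thesis by (rule cheating_main[OF fin _ prot assms(6,7) main], erule (1) f)
  qed
  then show ?thesis unfolding alice_learns_def .
qed

end
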